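(* (a) For every uniform chain $A$ of rank $\omega+\omega$ there are a compatible pair $(\sigma,\pi)$ and a short array $(U_k)_{k\in K}$ for $(\sigma,\pi)$ such that $A\cong\mathcal A(\sigma,\pi)\{U_k\}_{k\in K}$; respectively (in the alternative indexing) a short array $(V_l)_{l\in X}$ such that $A\cong\mathcal A(\sigma,\pi)\{V_l\}_{l\in X}$. (b) For every compatible pair $(\sigma,\pi)$ and every short array $(U_k)_{k\in K}$ for $(\sigma,\pi)$, respectively $(V_l)_{l\in X}$, the chain $\mathcal A(\sigma,\pi)\{U_k\}_{k\in K}$, respectively $\mathcal A(\sigma,\pi)\{V_l\}_{l\in X}$, is a uniform chain of rank $\omega+\omega$.
   Context: Chains. A chain is a linearly ordered set; $\cong$ is order isomorphism; $A+B$ is the ordered sum, $AB=\sum_{b\in B}A$ the anti-lexicographic product; $1$ is the one-element chain. For a chain $A$ define convex equivalence relations $\rho_\alpha$: $\rho_0$ is equality; $A/\alpha$ is the quotient chain of classes $[x]_\alpha$ (the $\alpha$-components); $x\rho_{\alpha+1}y$ iff the interval between $[x]_\alpha$ and $[y]_\alpha$ in $A/\alpha$ is finite; for limit $\alpha$, $x\rho_\alpha y$ iff $x\rho_\beta y$ for some $\beta<\alpha$. $\mathrm{rk}(A)$ is the least $\alpha$ with $A/\alpha\cong1$ (all chains are assumed to have a rank). $A$ is uniform if $A^{\ge x}=\{y\in A:x\le y\}$ has the same order type for all $x\in A$; then $\mathrm f A$ is this common tail. Strings. $\mathcal S(\alpha)$ is the set of $s:\alpha\to\alpha$ with $s(i)\le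 i$ for all $i<\alpha$; $|s|$ is the length. For $s\in\mathcal S(n+1)$, $n\ge1$: $s^-=s\restriction n$, and $s^+$ is $s$ with its next-to-last entry $s(n-1)$ deleted (in $\mathcal S(n)$ iff $s(n)<n$). The tree of $s\in\mathcal S(n+1)$ has root $(s;0)$; a node $(t;k)$ with $|t|=m+1\ge2$ has the single child $(t^-;0)$ if $t(m)=m$, and a left child $(t^+;k+1)$ and right child $(t^-;0)$ if $t(m)<m$. Leaves are the nodes $(\langle0\rangle;k)$ on level $|s|-1$, ordered left to right; $\ell(s)$ is their number and $\mathrm{wt}^s(i)=k$ if the $i$th leaf ($0\le i<\ell(s)$) is $(\langle0\rangle;k)$. Chains over $\omega$. For uniform chains $M_i$ of rank $\omega$: $\mathcal A(\langle0\rangle)[M_0]=M_0$; for $|s|=n+1\ge2$, $\mathcal A(s)[M_0,\dots,M_{\ell(s)-1}]=\mathcal A(s^-)[M_0,\dots,M_{\ell(s)-1}]\mathbb Z$ if $s(n)=n$ (then $\ell(s)=\ell(s^-)$), and $=\mathcal A(s^+)[M_0,\dots,M_{\ell(s^+)-1}]+\mathcal A(s^-)[M_{\ell(s^+)},\dots,M_{\ell(s)-1}]\mathbb N$ if $s(n)<n$ (then $\ell(s)=\ell(s^+)+\ell(s^-)$). Compatible pairs. Let $\sigma\in\mathcal S(\omega+1)$, $\pi:\omega\to\omega+1$. For $n\in\omega$ let $w_n$ be the least $v$ with $n\le v<\omega$, $\pi(v)>0$ if it exists, else $w_n=\omega$. The derived sequence is $s_n=(\sigma\restriction n)^\frown\sigma(w_n)$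 (the entry $\sigma(w_n)$ appended to $\sigma\restriction n$). The pair is compatible if for all $n\in\omega$: $\sigma(w_n)\le n$, and $\sigma(w_{n+1})=n+1$ iff $\pi(n)=\omega$. Then $s_n\in\mathcal S(n+1)$, $s_n=s_{n+1}^+$ if $\pi(n)=0$ and $s_n=s_{n+1}^-$ if $\pi(n)>0$. New positions. Fix a compatible $(\sigma,\pi)$ with derived sequence $(s_n)$. Call $0$ a new stage with new position $0$. For $n\in\omega$, $n+1$ is a new stage iff either ($\pi(n)=0$ and $s_{n+1}(n)=0$), with new position $\ell(s_n)$, or ($0<\pi(n)<\omega$ and $s_{n+1}(n+1)=0$), with new position $0$. Let $\eta_0=0<\eta_1<\dots$ enumerate the new stages, let $K\le\omega$ be their number (identified with the set $\{k:k<K\}$), and let $\kappa_n=\max\{k:\eta_k\le n\}$. Let $X=\{\max_{i<\ell(s_n)}\mathrm{wt}^{s_n}(i): n \text{ a new stage}\}$; the map $\eta_k\mapsto\max_i\mathrm{wt}^{s_{\eta_k}}(i)$ is strictly increasing in $k$. Short arrays. A short array for $(\sigma,\pi)$ is a family $(U_k)_{k\in K}$ of uniform chains of rank $\omega$ with $\mathrm f U_k\cong\mathrm f U_{k'}$ for all $k,k'\in K$. It determines arrays $\mathbf M_n=(M^{(n)}_i)_{i<\ell(s_n)}$ recursively: $\mathbf M_0=(U_0)$. If $\pi(n)=\omega$, $\mathbf M_{n+1}=\mathbf M_n$. If $\pi(n)=0$, the initial segment of $\mathbf M_{n+1}$ of length $\ell(s_{n+1}^+)=\ell(s_n)$ is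 $\mathbf M_n$; if $0<\pi(n)<\omega$, the final segment of $\mathbf M_{n+1}$ of length $\ell(s_{n+1}^-)=\ell(s_n)$ is $\mathbf M_n$. In the last two cases, if $n+1$ is a new stage, the entry of $\mathbf M_{n+1}$ at the new position is $U_{\kappa_{n+1}}$; every remaining entry $M^{(n+1)}_i$ outside the copied segment equals $M^{(n+1)}_j$ for any position $j$ in the copied segment with $\mathrm{wt}^{s_{n+1}}(j)=\mathrm{wt}^{s_{n+1}}(i)$ (such $j$ exist, and the choice does not matter up to isomorphism). $\mathcal A(\sigma,\pi)\{U_k\}_{k\in K}$ is the union (direct limit) of the chains $C_n=\mathcal A(s_n)[\mathbf M_n]$ along embeddings $C_n\to C_{n+1}$ mapping $C_n$ isomorphically onto an $(\omega+n)$-component of $C_{n+1}$: the one with exactly $\pi(n)$ predecessor $(\omega+n)$-components in $C_{n+1}$ if $\pi(n)<\omega$, and any one if $\pi(n)=\omega$. Alternative indexing: a family $(V_l)_{l\in X}$ of uniform rank-$\omega$ chains with pairwise isomorphic tails is also called a short array, and $\mathcal A(\sigma,\pi)\{V_l\}_{l\in X}:=\mathcal A(\sigma,\pi)\{U_k\}_{k\in K}$, where $U_k=V_l$ for $l=\max_i\mathrm{wt}^{s_{\eta_k}}(i)$. *)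

theory Defs
  imports Main "HOL-Library.Extended_Nat" "HOL-Library.Infinite_Set"
    "HOL-Library.Product_Lexorder"
begin

section \<open>Chains\<close>

text \<open>A chain is a relation \<open>A\<close> with \<open>Linear_order A\<close>; its underlying set is \<open>Field A\<close>.\<close>

definition chain_iso :: "'a rel \<Rightarrow> 'b rel \<Rightarrow> bool" (infix "\<cong>\<^sub>c" 50)
  where "A \<cong>\<^sub>c B \<longleftrightarrow> (\<exists>f. iso A B f)"

definition chain_sum :: "'a rel \<Rightarrow> 'b rel \<Rightarrow> ('a + 'b) rel"
  where "chain_sum A B =
    {(Inl x, Inl y) |x y. (x, y) \<in> A} \<union> {(Inr x, Inr y) |x y. (x, y) \<in> B}
    \<union> {(Inl x, Inr y) |x y. x \<in> Field A \<and> y \<in> Field B}"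

definition chain_prod :: "'a rel \<Rightarrow> 'b rel \<Rightarrow> ('a \<times> 'b) rel"
  where "chain_prod A B =
    {((a, b), (a', b')) |a b a' b'. a \<in> Field A \<and> a' \<in> Field A \<and> b \<in> Field B \<and> b' \<in> Field B
       \<and> (((b, b') \<in> B \<and> b \<noteq> b') \<or> (b = b' \<and> (a, a') \<in> A))}"

definition nat_chain :: "nat rel" where "nat_chain = {(m, n). m \<le> n}"

definition int_chain :: "int rel" where "int_chain = {(m, n). m \<le> n}"

definition one_chain :: "unit rel" where "one_chain = {((), ())}"

text \<open>The order induced by a preorder \<open>A\<close> on the classes of an equivalence relation \<open>R\<close> on
  \<open>Field A\<close>, comparing representatives. If \<open>A\<close> is a chain and \<open>R\<close> is convex, this is the quotient
  chain \<open>A/R\<close>.\<close>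

definition quot_chain :: "'a rel \<Rightarrow> 'a rel \<Rightarrow> 'a set rel"
  where "quot_chain A R =
    {(c, d). c \<in> Field A // R \<and> d \<in> Field A // R \<and> (\<exists>x\<in>c. \<exists>y\<in>d. (x, y) \<in> A)}"

definition interval :: "'a rel \<Rightarrow> 'a \<Rightarrow> 'a \<Rightarrow> 'a set"
  where "interval Q c d = {e. ((c, e) \<in> Q \<and> (e, d) \<in> Q) \<or> ((d, e) \<in> Q \<and> (e, c) \<in> Q)}"

definition condense :: "'a rel \<Rightarrow> 'a rel \<Rightarrow> 'a rel"
  where "condense A R = {(x, y). x \<in> Field A \<and> y \<in> Field A
    \<and> finite (interval (quot_chain A R) (R `` {x}) (R `` {y}))}"

text \<open>The relations \<open>\<rho>\<^sub>\<alpha>\<close>, with \<open>\<alpha>\<close> ranging over an arbitrary type of class \<open>wellorder\<close>. In the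
  second case \<open>\<alpha>\<close> is the successor of \<open>GREATEST \<beta>. \<beta> < \<alpha>\<close>.\<close>

function crel :: "'a rel \<Rightarrow> 'o::wellorder \<Rightarrow> 'a rel" where
  "crel A \<alpha> =
    (if \<forall>\<beta>. \<alpha> \<le> \<beta> then Id_on (Field A)
     else if \<exists>\<beta><\<alpha>. \<forall>\<gamma><\<alpha>. \<gamma> \<le> \<beta> then condense A (crel A (GREATEST \<beta>. \<beta> < \<alpha>))
     else (\<Union>\<beta>\<in>{..<\<alpha>}. crel A \<beta>))"
  by pat_completeness auto
termination
proof (relation "inv_image {(x, y). x < y} snd", goal_cases)
  case 1
  show ?case by (simp add: wf wf_inv_image)
next
  case (2 A \<alpha>)
  then obtain \<beta> where "\<beta> < \<alpha>" "\<forall>\<gamma><\<alpha>. \<gamma> \<le> \<beta>" by blast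
  then have "(GREATEST \<beta>. \<beta> < \<alpha>) < \<alpha>" by (metis (mono_tags, lifting) GreatestI2_order)
  then show ?case by simp
next
  case (3 A \<alpha> \<beta>)
  then show ?case by simp
qed

declare crel.simps [simp del]

definition components :: "'a rel \<Rightarrow> 'o::wellorder \<Rightarrow> 'a set set"
  where "components A \<alpha> = Field A // crel A \<alpha>"

definition quot :: "'a rel \<Rightarrow> 'o::wellorder \<Rightarrow> 'a set rel"
  where "quot A \<alpha> = quot_chain A (crel A \<alpha>)"

definition has_rank :: "'a rel \<Rightarrow> 'o::wellorder \<Rightarrow> bool"
  where "has_rank A \<alpha> \<longleftrightarrow> quot A \<alpha> \<cong>\<^sub>c one_chain \<and> (\<forall>\<beta><\<alpha>. \<not> quot A \<beta> \<cong>\<^sub>c one_chain)"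

text \<open>Ordinals below \<open>\<omega>\<^sup>2\<close> are represented by \<open>nat \<times> nat\<close> with the lexicographic order, the pair
  \<open>(i, j)\<close> standing for \<open>\<omega> \<cdot> i + j\<close>. The lemma \<open>crel_lex\<close> confirms the resulting recursion.\<close>

type_synonym ordinal = "nat \<times> nat"

abbreviation omega_plus :: "nat \<Rightarrow> ordinal" where "omega_plus n \<equiv> (1, n)"

abbreviation omega_omega :: ordinal where "omega_omega \<equiv> (2, 0)"

lemma crel_lex:
  "crel A (0::nat, 0::nat) = Id_on (Field A)"
  "crel A (i::nat, Suc j) = condense A (crel A (i, j))"
  "crel A (Suc i, 0::nat) = (\<Union>\<beta>\<in>{(i', j' :: nat). i' \<le> i}. crel A \<beta>)"
proof -
  show "crel A (0::nat, 0::nat) = Id_on (Field A)"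
    by (subst crel.simps) (simp add: less_eq_prod_def)
next
  have pred: "(i, j) < (i, Suc j)" "\<And>\<gamma>. \<gamma> < (i, Suc j) \<Longrightarrow> \<gamma> \<le> (i, j)"
    by (auto simp: less_prod_def less_eq_prod_def)
  have nonzero: "\<not> (\<forall>\<beta>. (i, Suc j) \<le> \<beta>)"
    using pred(1) leD by blast
  have succ: "\<exists>\<beta><(i, Suc j). \<forall>\<gamma><(i, Suc j). \<gamma> \<le> \<beta>"
    using pred by blast
  have "(GREATEST \<beta>. \<beta> < (i, Suc j)) = (i, j)"
    using pred by (intro Greatest_equality)
  then show "crel A (i, Suc j) = condense A (crel A (i, j))"
    by (subst crel.simps) (simp only: if_not_P[OF nonzero] if_P[OF succ])
next
  have nonzero: "\<not> (\<forall>\<beta>. (Suc i, 0::nat) \<le> \<beta>)"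
    by (auto simp: less_eq_prod_def intro!: exI[of _ i])
  have limit: "\<not> (\<exists>\<beta><(Suc i, 0::nat). \<forall>\<gamma><(Suc i, 0). \<gamma> \<le> \<beta>)"
  proof clarify
    fix a b assume "(a, b) < (Suc i, 0::nat)" and max: "\<forall>\<gamma><(Suc i, 0). \<gamma> \<le> (a, b)"
    then have "(a, Suc b) < (Suc i, 0)" by (auto simp: less_prod_def)
    with max have "(a, Suc b) \<le> (a, b)" by blast
    then show False by (auto simp: less_eq_prod_def)
  qed
  have "{..<(Suc i, 0::nat)} = {(i', j' :: nat). i' \<le> i}"
    by (auto simp: less_prod_def)
  then show "crel A (Suc i, 0::nat) = (\<Union>\<beta>\<in>{(i', j' :: nat). i' \<le> i}. crel A \<beta>)"
    by (subst crel.simps) (simp only: if_not_P[OF nonzero] if_not_P[OF limit])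
qed

definition tail :: "'a rel \<Rightarrow> 'a \<Rightarrow> 'a rel"
  where "tail A x = Restr A (above A x)"

definition uniform :: "'a rel \<Rightarrow> bool"
  where "uniform A \<longleftrightarrow> Linear_order A \<and> (\<forall>x\<in>Field A. \<forall>y\<in>Field A. tail A x \<cong>\<^sub>c tail A y)"

text \<open>The common tail \<open>f A\<close> of a nonempty uniform chain, well defined up to isomorphism.\<close>

definition common_tail :: "'a rel \<Rightarrow> 'a rel"
  where "common_tail A = tail A (SOME x. x \<in> Field A)"


section \<open>Strings and their trees\<close>

text \<open>The elements of \<open>\<S>(n+1)\<close> are lists \<open>s\<close> of length \<open>n + 1\<close> with \<open>s ! i \<le> i\<close>.\<close>

definition finite_strings :: "nat \<Rightarrow> nat list set"
  where "finite_strings n = {s. length s = n \<and> (\<forall>i<n. s ! i \<le> i)}"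

definition str_minus :: "nat list \<Rightarrow> nat list"
  where "str_minus s = butlast s"

definition str_plus :: "nat list \<Rightarrow> nat list"
  where "str_plus s = butlast (butlast s) @ [last s]"

text \<open>\<open>leaves s k\<close> lists, from left to right, the second components of the leaves below the node
  \<open>(s; k)\<close>. Hence the weights of \<open>s\<close> are the entries of \<open>leaves s 0\<close>.\<close>

function leaves :: "nat list \<Rightarrow> nat \<Rightarrow> nat list" where
  "leaves s k =
    (if length s \<le> 1 then [k]
     else if last s = length s - 1 then leaves (str_minus s) 0
     else leaves (str_plus s) (k + 1) @ leaves (str_minus s) 0)"
  by pat_completeness auto
termination
  by (relation "measure (\<lambda>(s, k). length s)") (auto simp: str_minus_def str_plus_def)

declare leaves.simps [simp del]

definition num_leaves :: "nat list \<Rightarrow> nat"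
  where "num_leaves s = length (leaves s 0)"

definition wt :: "nat list \<Rightarrow> nat \<Rightarrow> nat"
  where "wt s i = leaves s 0 ! i"

definition max_wt :: "nat list \<Rightarrow> nat"
  where "max_wt s = Max (wt s ` {..<num_leaves s})"


section \<open>Chains over \<open>\<omega>\<close>\<close>

text \<open>A single type of points, closed under the sums and products needed for \<open>\<A>(s)[M]\<close>.\<close>

datatype 'a point = Base 'a | Prod "'a point \<times> int" | Sum "'a point + 'a point \<times> nat"

function arr :: "nat list \<Rightarrow> 'a rel list \<Rightarrow> 'a point rel" where
  "arr s M =
    (if length s \<le> 1 then dir_image (M ! 0) Base
     else if last s = length s - 1
       then dir_image (chain_prod (arr (str_minus s) M) int_chain) Prod
     else dir_image
       (chain_sum (arr (str_plus s) (take (num_leaves (str_plus s)) M))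
         (chain_prod (arr (str_minus s) (drop (num_leaves (str_plus s)) M)) nat_chain)) Sum)"
  by pat_completeness auto
termination
  by (relation "measure (\<lambda>(s, M). length s)") (auto simp: str_minus_def str_plus_def)

declare arr.simps [simp del]


section \<open>Compatible pairs\<close>

text \<open>The type \<open>enat\<close> plays the role of the ordinal \<open>\<omega> + 1\<close>.\<close>

definition next_pos :: "(nat \<Rightarrow> enat) \<Rightarrow> nat \<Rightarrow> enat"
  where "next_pos \<pi> n =
    (if \<exists>v\<ge>n. \<pi> v > 0 then enat (LEAST v. n \<le> v \<and> \<pi> v > 0) else \<infinity>)"

text \<open>All entries of a derived sequence are finite when \<open>\<sigma> i \<le> i\<close> and \<open>\<sigma> (w\<^sub>n) \<le> n\<close>.\<close>

definition derived :: "(enat \<Rightarrow> enat) \<Rightarrow> (nat \<Rightarrow> enat) \<Rightarrow> nat \<Rightarrow> nat list"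
  where "derived \<sigma> \<pi> n =
    map (\<lambda>i. the_enat (\<sigma> (enat i))) [0..<n] @ [the_enat (\<sigma> (next_pos \<pi> n))]"

definition compatible :: "(enat \<Rightarrow> enat) \<Rightarrow> (nat \<Rightarrow> enat) \<Rightarrow> bool"
  where "compatible \<sigma> \<pi> \<longleftrightarrow>
    (\<forall>i. \<sigma> i \<le> i) \<and>
    (\<forall>n. \<sigma> (next_pos \<pi> n) \<le> enat n \<and>
         (\<sigma> (next_pos \<pi> (Suc n)) = enat (Suc n) \<longleftrightarrow> \<pi> n = \<infinity>))"

lemma derived_finite_strings:
  assumes "compatible \<sigma> \<pi>"
  shows "derived \<sigma> \<pi> n \<in> finite_strings (Suc n)"
proof -
  have fin: "the_enat e \<le> m" if "e \<le> enat m" for e m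
    using that by (cases e) auto
  from assms have "\<sigma> (enat i) \<le> enat i" "\<sigma> (next_pos \<pi> n) \<le> enat n" for i
    by (auto simp: compatible_def)
  then show ?thesis
    by (auto simp: finite_strings_def derived_def nth_append less_Suc_eq intro!: fin)
qed


section \<open>New positions\<close>

definition new_stage :: "(enat \<Rightarrow> enat) \<Rightarrow> (nat \<Rightarrow> enat) \<Rightarrow> nat \<Rightarrow> bool"
  where "new_stage \<sigma> \<pi> m \<longleftrightarrow>
    m = 0 \<or>
    (\<exists>n. m = Suc n \<and>
      ((\<pi> n = 0 \<and> derived \<sigma> \<pi> (Suc n) ! n = 0) \<or>
       (0 < \<pi> n \<and> \<pi> n < \<infinity> \<and> derived \<sigma> \<pi> (Suc n) ! Suc n = 0)))"

definition new_position :: "(enat \<Rightarrow> enat) \<Rightarrow> (nat \<Rightarrow> enat) \<Rightarrow> nat \<Rightarrow> nat"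
  where "new_position \<sigma> \<pi> m =
    (case m of 0 \<Rightarrow> 0 | Suc n \<Rightarrow> if \<pi> n = 0 then num_leaves (derived \<sigma> \<pi> n) else 0)"

text \<open>\<open>stage \<sigma> \<pi> k\<close> is \<open>\<eta>\<^sub>k\<close>; it is meaningful for \<open>k \<in> index_set \<sigma> \<pi>\<close>, which is the set \<open>K\<close>.\<close>

definition stage :: "(enat \<Rightarrow> enat) \<Rightarrow> (nat \<Rightarrow> enat) \<Rightarrow> nat \<Rightarrow> nat"
  where "stage \<sigma> \<pi> k = enumerate {m. new_stage \<sigma> \<pi> m} k"

definition index_set :: "(enat \<Rightarrow> enat) \<Rightarrow> (nat \<Rightarrow> enat) \<Rightarrow> nat set"
  where "index_set \<sigma> \<pi> =
    {k. finite {m. new_stage \<sigma> \<pi> m} \<longrightarrow> k < card {m. new_stage \<sigma> \<pi> m}}"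

definition stage_index :: "(enat \<Rightarrow> enat) \<Rightarrow> (nat \<Rightarrow> enat) \<Rightarrow> nat \<Rightarrow> nat"
  where "stage_index \<sigma> \<pi> n = Max {k \<in> index_set \<sigma> \<pi>. stage \<sigma> \<pi> k \<le> n}"

definition weight_set :: "(enat \<Rightarrow> enat) \<Rightarrow> (nat \<Rightarrow> enat) \<Rightarrow> nat set"
  where "weight_set \<sigma> \<pi> = {max_wt (derived \<sigma> \<pi> n) |n. new_stage \<sigma> \<pi> n}"


section \<open>Short arrays\<close>

definition short_family :: "nat set \<Rightarrow> (nat \<Rightarrow> 'a rel) \<Rightarrow> bool"
  where "short_family I U \<longleftrightarrow>
    (\<forall>k\<in>I. uniform (U k) \<and> has_rank (U k) (omega_plus 0)) \<and>
    (\<forall>k\<in>I. \<forall>k'\<in>I. common_tail (U k) \<cong>\<^sub>c common_tail (U k'))"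

definition short_array :: "(enat \<Rightarrow> enat) \<Rightarrow> (nat \<Rightarrow> enat) \<Rightarrow> (nat \<Rightarrow> 'a rel) \<Rightarrow> bool"
  where "short_array \<sigma> \<pi> U \<longleftrightarrow> short_family (index_set \<sigma> \<pi>) U"

definition short_array_wt :: "(enat \<Rightarrow> enat) \<Rightarrow> (nat \<Rightarrow> enat) \<Rightarrow> (nat \<Rightarrow> 'a rel) \<Rightarrow> bool"
  where "short_array_wt \<sigma> \<pi> V \<longleftrightarrow> short_family (weight_set \<sigma> \<pi>) V"

definition reindex ::
    "(enat \<Rightarrow> enat) \<Rightarrow> (nat \<Rightarrow> enat) \<Rightarrow> (nat \<Rightarrow> 'a rel) \<Rightarrow> nat \<Rightarrow> 'a rel"
  where "reindex \<sigma> \<pi> V k = V (max_wt (derived \<sigma> \<pi> (stage \<sigma> \<pi> k)))"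

text \<open>Position in \<open>M\<^sub>n\<^sub>+\<^sub>1\<close> of the first entry copied from \<open>M\<^sub>n\<close>, which forms an initial segment
  if \<open>\<pi> n = 0\<close>, and a final segment if \<open>0 < \<pi> n < \<infinity>\<close>.\<close>

definition copy_start :: "(enat \<Rightarrow> enat) \<Rightarrow> (nat \<Rightarrow> enat) \<Rightarrow> nat \<Rightarrow> nat"
  where "copy_start \<sigma> \<pi> n =
    (if \<pi> n = 0 then 0
     else num_leaves (derived \<sigma> \<pi> (Suc n)) - num_leaves (derived \<sigma> \<pi> n))"

definition copied :: "(enat \<Rightarrow> enat) \<Rightarrow> (nat \<Rightarrow> enat) \<Rightarrow> nat \<Rightarrow> nat set"
  where "copied \<sigma> \<pi> n =
    {copy_start \<sigma> \<pi> n ..< copy_start \<sigma> \<pi> n + num_leaves (derived \<sigma> \<pi> n)}"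

definition determines_arrays ::
    "(enat \<Rightarrow> enat) \<Rightarrow> (nat \<Rightarrow> enat) \<Rightarrow> (nat \<Rightarrow> 'a rel) \<Rightarrow> (nat \<Rightarrow> 'a rel list) \<Rightarrow> bool"
  where "determines_arrays \<sigma> \<pi> U M \<longleftrightarrow>
    M 0 = [U 0] \<and>
    (\<forall>n. if \<pi> n = \<infinity> then M (Suc n) = M n
      else
        length (M (Suc n)) = num_leaves (derived \<sigma> \<pi> (Suc n)) \<and>
        (\<forall>i<num_leaves (derived \<sigma> \<pi> n). M (Suc n) ! (copy_start \<sigma> \<pi> n + i) = M n ! i) \<and>
        (\<forall>i<num_leaves (derived \<sigma> \<pi> (Suc n)). i \<notin> copied \<sigma> \<pi> n \<longrightarrow>
          (if new_stage \<sigma> \<pi> (Suc n) \<and> i = new_position \<sigma> \<pi> (Suc n)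
           then M (Suc n) ! i = U (stage_index \<sigma> \<pi> (Suc n))
           else \<exists>j\<in>copied \<sigma> \<pi> n.
             wt (derived \<sigma> \<pi> (Suc n)) j = wt (derived \<sigma> \<pi> (Suc n)) i \<and>
             M (Suc n) ! i = M (Suc n) ! j)))"


section \<open>The chain \<open>\<A>(\<sigma>, \<pi>){U\<^sub>k}\<close>\<close>

text \<open>The direct limit of chains \<open>C n\<close> along embeddings \<open>e n\<close> from \<open>C n\<close> to \<open>C (n + 1)\<close>: points
  \<open>(n, x)\<close> with \<open>x\<close> in \<open>C n\<close> are compared, and identified, through their images at a common level.
  Here \<open>fold e [n..<k]\<close> is the composite embedding of \<open>C n\<close> into \<open>C k\<close>.\<close>

definition direct_limit :: "(nat \<Rightarrow> 'b rel) \<Rightarrow> (nat \<Rightarrow> 'b \<Rightarrow> 'b) \<Rightarrow> (nat \<times> 'b) set rel"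
  where "direct_limit C e =
    quot_chain
      {((n, x), (m, y)) |n x m y. x \<in> Field (C n) \<and> y \<in> Field (C m) \<and>
        (fold e [n..<max n m] x, fold e [m..<max n m] y) \<in> C (max n m)}
      {((n, x), (m, y)) |n x m y. x \<in> Field (C n) \<and> y \<in> Field (C m) \<and>
        fold e [n..<max n m] x = fold e [m..<max n m] y}"

definition predecessors :: "'a rel \<Rightarrow> 'a \<Rightarrow> 'a set"
  where "predecessors Q c = {d. (d, c) \<in> Q \<and> d \<noteq> c}"

definition array_embeddings ::
    "(nat \<Rightarrow> enat) \<Rightarrow> (nat \<Rightarrow> 'b rel) \<Rightarrow> (nat \<Rightarrow> 'b \<Rightarrow> 'b) \<Rightarrow> bool"
  where "array_embeddings \<pi> C e \<longleftrightarrow>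
    (\<forall>n. \<exists>c \<in> components (C (Suc n)) (omega_plus n).
      iso (C n) (Restr (C (Suc n)) c) (e n) \<and>
      (\<pi> n < \<infinity> \<longrightarrow>
        finite (predecessors (quot (C (Suc n)) (omega_plus n)) c) \<and>
        enat (card (predecessors (quot (C (Suc n)) (omega_plus n)) c)) = \<pi> n))"

text \<open>The arrays \<open>M\<^sub>n\<close> and the embeddings involve choices which only affect the result up to
  isomorphism; \<open>array_chain \<sigma> \<pi> U\<close> is the set of all chains \<open>\<A>(\<sigma>, \<pi>){U\<^sub>k}\<close> obtained from
  admissible choices.\<close>

definition array_chain ::
    "(enat \<Rightarrow> enat) \<Rightarrow> (nat \<Rightarrow> enat) \<Rightarrow> (nat \<Rightarrow> 'a rel) \<Rightarrow> (nat \<times> 'a point) set rel set"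
  where "array_chain \<sigma> \<pi> U =
    {direct_limit C e |C e M. determines_arrays \<sigma> \<pi> U M \<and>
      C = (\<lambda>n. arr (derived \<sigma> \<pi> n) (M n)) \<and> array_embeddings \<pi> C e}"

definition array_chain_wt ::
    "(enat \<Rightarrow> enat) \<Rightarrow> (nat \<Rightarrow> enat) \<Rightarrow> (nat \<Rightarrow> 'a rel) \<Rightarrow> (nat \<times> 'a point) set rel set"
  where "array_chain_wt \<sigma> \<pi> V = array_chain \<sigma> \<pi> (reindex \<sigma> \<pi> V)"

end

theory Submission
  imports Defs
begin

text \<open>
  Everything rests on the structure of the components of a uniform chain \<open>A\<close> of rank \<open>\<omega> + \<omega>\<close>. The relations
  \<open>\<rho>\<^sub>\<alpha>\<close> are local (\<open>crel_convex_emb\<close>), so an isomorphism between two tails of \<open>A\<close> respects the components of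
  \<open>A\<close>. Hence all \<open>(\<omega>+n)\<close>-components have isomorphic tails, none of them is the last one in its
  \<open>(\<omega>+n+1)\<close>-component, and an \<open>(\<omega>+n+1)\<close>-component, in which only finitely many \<open>(\<omega>+n)\<close>-components lie
  between any two points, is an ordered sum of \<open>(\<omega>+n)\<close>-components indexed by \<open>\<nat>\<close> or \<open>\<int>\<close> (\<open>comp_blocks\<close>).
  All summands with a predecessor are isomorphic (\<open>next_comp_iso\<close>), to a generic component \<open>Y\<^sub>n\<close>, say. So
  an \<open>(\<omega>+n+1)\<close>-component is \<open>Y\<^sub>n \<int>\<close> or \<open>F + Y\<^sub>n \<nat>\<close>, and iterating this at the left end shows that, given
  the \<open>Y\<^sub>i\<close>, it is determined by the least \<open>k\<close> such that it has a first \<open>(\<omega>+k)\<close>-component and, if \<open>k = 0\<close>,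
  by its first \<open>\<omega>\<close>-component. In other words, an \<open>(\<omega>+n)\<close>-component is \<open>\<A>(s)[M]\<close>, where \<open>s(i)\<close>, for \<open>i < n\<close>,
  is this \<open>k\<close> for \<open>Y\<^sub>i\<close>, \<open>s(n)\<close> is the one for the component itself, and \<open>M\<close> has the first \<open>\<omega>\<close>-component of \<open>Y\<^sub>w\<close> at
  leaves of weight \<open>w < n\<close>, and that of the component itself at the leaf of weight \<open>n\<close>
  (\<open>comp_weighted_chain\<close>).

  For part (a), fix a point of \<open>A\<close> and let \<open>C\<^sub>n\<close> be its \<open>(\<omega>+n)\<close>-component. Let \<open>\<pi>(n)\<close> count the predecessors of
  \<open>C\<^sub>n\<close> in \<open>C\<^sub>n\<^sub>+\<^sub>1\<close>, let \<open>\<sigma>(n)\<close> be the number \<open>k\<close> of \<open>Y\<^sub>n\<close>, and \<open>\<sigma>(\<omega>)\<close> that of \<open>A\<close>. The derived sequence then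
  describes the \<open>C\<^sub>n\<close>, and the new stages are those at which an \<open>\<omega>\<close>-component enters \<open>M\<^sub>n\<close> which is not
  already there; these form the short array (\<open>uniform_chain_decomposition\<close>). Any chain built from
  these data is isomorphic to \<open>A\<close>, since the isomorphisms on level \<open>n + 1\<close> can be chosen to map level \<open>n\<close> to
  level \<open>n\<close>, and such isomorphisms can be glued (\<open>glue_isos\<close>), whether or not they extend each other.

  For part (b), the arrays \<open>M\<^sub>n\<close> exist and are unique, each entry being a function of its weight
  (\<open>determines_arrays_entry\<close>, \<open>determines_arrays_unique\<close>). By induction, \<open>C\<^sub>n = \<A>(s\<^sub>n)[M\<^sub>n]\<close> is
  uniform of rank \<open>\<omega> + n\<close> (\<open>weighted_chain_tails\<close>). The point is that a uniform chain of rank \<open>\<omega> + n\<close> has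
  no last component on any lower level, so that the \<open>(\<omega>+n)\<close>-components of an ordered sum of such chains
  are exactly the summands (\<open>block_crel_iff\<close>); this also provides the embeddings. The union is uniform
  because two of its points lie in a common \<open>C\<^sub>n\<close>, beyond which their tails coincide
  (\<open>convex_union_uniform\<close>).

  The two ways of indexing a short array are equivalent because the maximal weight is strictly
  increasing along the new stages (\<open>max_wt_strict_mono\<close>).
\<close>


section \<open>Linear orders and isomorphisms\<close>

lemma lin_refl: "Linear_order A \<Longrightarrow> x \<in> Field A \<Longrightarrow> (x, x) \<in> A"
  by (auto simp: order_on_defs refl_on_def)

lemma lin_trans: "Linear_order A \<Longrightarrow> (x, y) \<in> A \<Longrightarrow> (y, z) \<in> A \<Longrightarrow> (x, z) \<in> A"
  by (auto simp: order_on_defs dest: transD)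

lemma lin_antisym: "Linear_order A \<Longrightarrow> (x, y) \<in> A \<Longrightarrow> (y, x) \<in> A \<Longrightarrow> x = y"
  by (auto simp: order_on_defs dest: antisymD)

lemma lin_total: "Linear_order A \<Longrightarrow> x \<in> Field A \<Longrightarrow> y \<in> Field A \<Longrightarrow> (x, y) \<in> A \<or> (y, x) \<in> A"
  by (cases "x = y") (auto simp: order_on_defs refl_on_def total_on_def)

lemma lin_Field: "(x, y) \<in> A \<Longrightarrow> x \<in> Field A" "(x, y) \<in> A \<Longrightarrow> y \<in> Field A"
  by (auto simp: Field_def)

lemma Linear_orderI:
  assumes "\<And>x. x \<in> Field A \<Longrightarrow> (x, x) \<in> A"
    and "\<And>x y z. (x, y) \<in> A \<Longrightarrow> (y, z) \<in> A \<Longrightarrow> (x, z) \<in> A"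
    and "\<And>x y. (x, y) \<in> A \<Longrightarrow> (y, x) \<in> A \<Longrightarrow> x = y"
    and "\<And>x y. x \<in> Field A \<Longrightarrow> y \<in> Field A \<Longrightarrow> (x, y) \<in> A \<or> (y, x) \<in> A"
  shows "Linear_order A"
  using assms unfolding order_on_defs refl_on_def trans_def antisym_def total_on_def
  by (auto simp: Field_def)

lemma Field_Restr_lin: "Linear_order A \<Longrightarrow> Field (Restr A D) = Field A \<inter> D"
  by (fastforce simp: Field_def dest: lin_refl[unfolded Field_def])

lemma Linear_order_Restr: "Linear_order A \<Longrightarrow> Linear_order (Restr A D)"
  by (rule Linear_orderI)
    (auto simp: Field_Restr_lin intro: lin_refl lin_trans dest: lin_antisym lin_total)

lemma finite_has_least:
  assumes "Linear_order A" "finite X" "X \<noteq> {}" "X \<subseteq> Field A"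
  shows "\<exists>m\<in>X. \<forall>x\<in>X. (m, x) \<in> A"
  using assms(2,3,4)
proof (induction X rule: finite_ne_induct)
  case (singleton x)
  then show ?case using lin_refl[OF assms(1)] by auto
next
  case (insert x X)
  then obtain m where "m \<in> X" "\<forall>x\<in>X. (m, x) \<in> A" by auto
  with insert.prems show ?case
    using lin_total[OF assms(1), of x m] lin_trans[OF assms(1)] lin_refl[OF assms(1)]
    by (metis insert_iff subset_iff)
qed

lemma finite_has_greatest:
  assumes "Linear_order A" "finite X" "X \<noteq> {}" "X \<subseteq> Field A"
  shows "\<exists>m\<in>X. \<forall>x\<in>X. (x, m) \<in> A"
  using finite_has_least[of "A\<inverse>" X] assms by simp

lemma iso_bij_order:
  "iso A B f \<longleftrightarrow> bij_betw f (Field A) (Field B) \<and>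
    (\<forall>a\<in>Field A. \<forall>b\<in>Field A. (a, b) \<in> A \<longleftrightarrow> (f a, f b) \<in> B)"
  using iso_iff2 by blast

lemma Linear_order_iso:
  assumes "iso A B f" "Linear_order A"
  shows "Linear_order B"
proof -
  have b: "Field B = f ` Field A" "inj_on f (Field A)"
    and o: "\<And>a b. a \<in> Field A \<Longrightarrow> b \<in> Field A \<Longrightarrow> (a, b) \<in> A \<longleftrightarrow> (f a, f b) \<in> B"
    using assms(1) by (auto simp: iso_bij_order bij_betw_def)
  show ?thesis
  proof (rule Linear_orderI, goal_cases)
    case (1 x)
    then show ?case using b o lin_refl[OF assms(2)] by auto
  next
    case (2 x y z)
    then have "x \<in> Field B" "y \<in> Field B" "z \<in> Field B" by (auto simp: Field_def)
    with 2 show ?case unfolding b using o lin_trans[OF assms(2)] by (elim imageE) metis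
  next
    case (3 x y)
    then have "x \<in> Field B" "y \<in> Field B" by (auto simp: Field_def)
    with 3 show ?case unfolding b using o lin_antisym[OF assms(2)] by (elim imageE) metis
  next
    case (4 x y)
    then show ?case unfolding b using o lin_total[OF assms(2)] by (elim imageE) metis
  qed
qed

lemma iso_comp:
  assumes "iso A B f" "iso B C g"
  shows "iso A C (g \<circ> f)"
  using assms unfolding iso_bij_order by (auto intro: bij_betw_trans dest: bij_betwE)

lemma iso_inv:
  assumes "iso A B f"
  shows "iso B A (inv_into (Field A) f)"
  using assms unfolding iso_bij_order
  by (auto simp: bij_betw_inv_into bij_betw_inv_into_right bij_betw_imp_surj_on inv_into_into)

lemma chain_iso_refl: "A \<cong>\<^sub>c A"
  unfolding chain_iso_def iso_bij_order by (intro exI[of _ id]) auto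

lemma chain_iso_sym: "A \<cong>\<^sub>c B \<Longrightarrow> B \<cong>\<^sub>c A"
  unfolding chain_iso_def using iso_inv by blast

lemma chain_iso_trans: "A \<cong>\<^sub>c B \<Longrightarrow> B \<cong>\<^sub>c C \<Longrightarrow> A \<cong>\<^sub>c C"
  unfolding chain_iso_def using iso_comp by blast

lemma iso_Restr:
  assumes "iso A B f" "Linear_order A" "D \<subseteq> Field A"
  shows "iso (Restr A D) (Restr B (f ` D)) f"
proof -
  have B: "Linear_order B" using assms Linear_order_iso by blast
  have "Field (Restr A D) = D" using assms by (auto simp: Field_Restr_lin)
  moreover have "Field (Restr B (f ` D)) = f ` D"
    using assms B by (auto simp: Field_Restr_lin iso_bij_order bij_betw_def)
  ultimately show ?thesis
    using assms(1,3) by (fastforce simp: iso_bij_order bij_betw_def intro: inj_on_subset)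
qed

section \<open>Tails\<close>

lemma Field_tail: "Linear_order A \<Longrightarrow> Field (tail A x) = above A x"
  unfolding tail_def by (auto simp: Field_Restr_lin above_def lin_Field)

lemma tail_iff: "Linear_order A \<Longrightarrow> (y, z) \<in> tail A x \<longleftrightarrow> (x, y) \<in> A \<and> (y, z) \<in> A"
  by (auto simp: tail_def above_def dest: lin_trans)

lemma Linear_order_tail: "Linear_order A \<Longrightarrow> Linear_order (tail A x)"
  unfolding tail_def by (rule Linear_order_Restr)

lemma iso_tail:
  assumes "iso A B f" "Linear_order A" "x \<in> Field A"
  shows "iso (tail A x) (tail B (f x)) f"
proof -
  have "f ` above A x = above B (f x)"
  proof
    show "f ` above A x \<subseteq> above B (f x)"
      using assms by (auto simp: above_def iso_bij_order dest: lin_Field)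
    show "above B (f x) \<subseteq> f ` above A x"
    proof
      fix y assume "y \<in> above B (f x)"
      then have y: "(f x, y) \<in> B" by (auto simp: above_def)
      then obtain z where "z \<in> Field A" "y = f z"
        using assms(1) lin_Field(2)[OF y] unfolding iso_bij_order bij_betw_def by blast
      with y show "y \<in> f ` above A x" using assms by (auto simp: above_def iso_bij_order)
    qed
  qed
  then show ?thesis
    unfolding tail_def using iso_Restr[OF assms(1,2), of "above A x"] by (auto simp: above_def Field_def)
qed

text \<open>All tails of \<open>A\<close> are isomorphic to all tails of \<open>B\<close>. A linear order is uniform iff this holds for \<open>A\<close> and
  \<open>A\<close>.\<close>

definition tails_iso :: "'a rel \<Rightarrow> 'b rel \<Rightarrow> bool"
  where "tails_iso A B \<longleftrightarrow> (\<forall>x\<in>Field A. \<forall>y\<in>Field B. tail A x \<cong>\<^sub>c tail B y)"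

lemma uniform_iff: "uniform A \<longleftrightarrow> Linear_order A \<and> tails_iso A A"
  by (simp add: uniform_def tails_iso_def)

lemma tails_iso_cong:
  assumes "A \<cong>\<^sub>c A'" "B \<cong>\<^sub>c B'" "Linear_order A" "Linear_order B" "tails_iso A' B'"
  shows "tails_iso A B"
  unfolding tails_iso_def
proof (intro ballI)
  fix x y assume xy: "x \<in> Field A" "y \<in> Field B"
  obtain f g where fg: "iso A A' f" "iso B B' g" using assms by (auto simp: chain_iso_def)
  then have "f x \<in> Field A'" "g y \<in> Field B'" using xy by (auto simp: iso_bij_order dest: bij_betwE)
  then have "tail A' (f x) \<cong>\<^sub>c tail B' (g y)" using assms(5) by (auto simp: tails_iso_def)
  moreover have "tail A x \<cong>\<^sub>c tail A' (f x)" "tail B y \<cong>\<^sub>c tail B' (g y)"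
    using iso_tail[OF fg(1) assms(3) xy(1)] iso_tail[OF fg(2) assms(4) xy(2)]
    by (auto simp: chain_iso_def)
  ultimately show "tail A x \<cong>\<^sub>c tail B y"
    by (meson chain_iso_trans chain_iso_sym)
qed

lemma Field_eq_empty_iso: "A \<cong>\<^sub>c B \<Longrightarrow> Field A = {} \<longleftrightarrow> Field B = {}"
  by (auto simp: chain_iso_def iso_bij_order bij_betw_def)

lemma uniform_iso: "A \<cong>\<^sub>c B \<Longrightarrow> uniform B \<Longrightarrow> uniform A"
  by (meson tails_iso_cong uniform_iff Linear_order_iso chain_iso_sym chain_iso_def)

section \<open>Condensation\<close>

text \<open>An equivalence relation on a chain with convex classes.\<close>

definition convex_equiv :: "'a rel \<Rightarrow> 'a rel \<Rightarrow> bool"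
  where "convex_equiv A R \<longleftrightarrow> equiv (Field A) R \<and>
    (\<forall>x y z. (x, y) \<in> A \<longrightarrow> (y, z) \<in> A \<longrightarrow> (x, z) \<in> R \<longrightarrow> (x, y) \<in> R)"

lemma convex_equivD:
  assumes "convex_equiv A R"
  shows "x \<in> Field A \<Longrightarrow> (x, x) \<in> R" "(x, y) \<in> R \<Longrightarrow> (y, x) \<in> R"
    "(x, y) \<in> R \<Longrightarrow> (y, z) \<in> R \<Longrightarrow> (x, z) \<in> R" "(x, y) \<in> R \<Longrightarrow> x \<in> Field A" "(x, y) \<in> R \<Longrightarrow> y \<in> Field A"
    "(x, y) \<in> A \<Longrightarrow> (y, z) \<in> A \<Longrightarrow> (x, z) \<in> R \<Longrightarrow> (x, y) \<in> R"
  using assms unfolding convex_equiv_def equiv_def refl_on_def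
  by (blast dest: symD transD)+

lemma convex_equivD_right:
  assumes "convex_equiv A R" "(x, y) \<in> A" "(y, z) \<in> A" "(x, z) \<in> R"
  shows "(y, z) \<in> R"
  using assms convex_equivD by metis

lemma convex_equivI:
  assumes "R \<subseteq> Field A \<times> Field A"
    and "\<And>x. x \<in> Field A \<Longrightarrow> (x, x) \<in> R"
    and "\<And>x y. (x, y) \<in> R \<Longrightarrow> (y, x) \<in> R"
    and "\<And>x y z. (x, y) \<in> R \<Longrightarrow> (y, z) \<in> R \<Longrightarrow> (x, z) \<in> R"
    and "\<And>x y z. (x, y) \<in> A \<Longrightarrow> (y, z) \<in> A \<Longrightarrow> (x, z) \<in> R \<Longrightarrow> (x, y) \<in> R"
  shows "convex_equiv A R"
  using assms unfolding convex_equiv_def equiv_def refl_on_def sym_def trans_def by blast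

lemma class_eq_iff:
  assumes "convex_equiv A R" "x \<in> Field A" "y \<in> Field A"
  shows "R `` {x} = R `` {y} \<longleftrightarrow> (x, y) \<in> R"
  using eq_equiv_class_iff[of "Field A" R x y] assms by (simp add: convex_equiv_def)

lemma quot_chain_iff:
  assumes "Linear_order A" "convex_equiv A R" "x \<in> Field A" "y \<in> Field A"
  shows "(R `` {x}, R `` {y}) \<in> quot_chain A R \<longleftrightarrow> (x, y) \<in> A \<or> (x, y) \<in> R"
proof
  note R = convex_equivD[OF assms(2)] convex_equivD_right[OF assms(2)]
  assume "(R `` {x}, R `` {y}) \<in> quot_chain A R"
  then obtain u v where uv: "(x, u) \<in> R" "(y, v) \<in> R" "(u, v) \<in> A"
    by (auto simp: quot_chain_def)
  show "(x, y) \<in> A \<or> (x, y) \<in> R"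
  proof (rule disjCI)
    assume "(x, y) \<notin> R"
    show "(x, y) \<in> A"
    proof (rule ccontr)
      assume "(x, y) \<notin> A"
      then have yx: "(y, x) \<in> A" using lin_total assms by metis
      have n: "(u, y) \<notin> R" "(x, v) \<notin> R" using uv \<open>(x, y) \<notin> R\<close> R by metis+
      have "(v, x) \<in> A"
        using n uv yx R(6)[of y x v] lin_total[OF assms(1), of x v] assms R \<open>(x, y) \<notin> R\<close> by metis
      then have "(u, x) \<in> A" using uv lin_trans[OF assms(1)] by metis
      then have "(u, v) \<in> R" using R(6)[of u v x] uv \<open>(v, x) \<in> A\<close> R by metis
      then show False using n uv R by metis
    qed
  qed
next
  assume "(x, y) \<in> A \<or> (x, y) \<in> R"
  then have "\<exists>v. (y, v) \<in> R \<and> (x, v) \<in> A"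
    using convex_equivD(1,2)[OF assms(2)] assms lin_refl[OF assms(1)] by metis
  then have "\<exists>u\<in>R `` {x}. \<exists>v\<in>R `` {y}. (u, v) \<in> A"
    using convex_equivD(1)[OF assms(2,3)] by auto
  then show "(R `` {x}, R `` {y}) \<in> quot_chain A R"
    using assms(3,4) by (simp add: quot_chain_def quotientI)
qed

lemma Field_quot_chain:
  assumes "Linear_order A" "convex_equiv A R"
  shows "Field (quot_chain A R) = Field A // R"
proof
  show "Field (quot_chain A R) \<subseteq> Field A // R" by (auto simp: quot_chain_def Field_def)
  show "Field A // R \<subseteq> Field (quot_chain A R)"
  proof
    fix c assume "c \<in> Field A // R"
    then obtain x where "x \<in> Field A" "c = R `` {x}" by (auto simp: quotient_def)
    then show "c \<in> Field (quot_chain A R)"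
      using quot_chain_iff[OF assms, of x x] lin_refl[OF assms(1)] by (auto simp: Field_def)
  qed
qed

text \<open>Intervals of the quotient chain consist of the classes of the points of the interval, so that
  condensation can be computed in the chain itself.\<close>

lemma interval_quot_chain:
  assumes "Linear_order A" "convex_equiv A R" "x \<in> Field A" "y \<in> Field A"
  shows "interval (quot_chain A R) (R `` {x}) (R `` {y}) = (\<lambda>z. R `` {z}) ` interval A x y"
    (is "?L = ?R")
proof
  show "?R \<subseteq> ?L"
    using assms by (auto simp: interval_def quot_chain_iff lin_Field)
next
  show "?L \<subseteq> ?R"
  proof
    fix c assume c: "c \<in> ?L"
    then have "c \<in> Field (quot_chain A R)" by (auto simp: interval_def Field_def)
    then obtain z where z: "z \<in> Field A" "c = R `` {z}"
      unfolding Field_quot_chain[OF assms(1,2)] by (auto simp: quotient_def)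
    consider "(x, z) \<in> R" | "(y, z) \<in> R" | "(x, z) \<notin> R" "(y, z) \<notin> R" by blast
    then show "c \<in> ?R"
    proof cases
      case 1
      then have "c = R `` {x}" using z class_eq_iff[OF assms(2)] assms by blast
      moreover have "x \<in> interval A x y" using assms lin_refl lin_total by (fastforce simp: interval_def)
      ultimately show ?thesis by blast
    next
      case 2
      then have "c = R `` {y}" using z class_eq_iff[OF assms(2)] assms by blast
      moreover have "y \<in> interval A x y" using assms lin_refl lin_total by (fastforce simp: interval_def)
      ultimately show ?thesis by blast
    next
      \<comment> \<open>Off the two end classes, the order of the quotient is that of the representatives.\<close>
      case 3
      then have "(z, x) \<notin> R" "(z, y) \<notin> R" using convex_equivD[OF assms(2)] by blast+
      with 3 c z have "z \<in> interval A x y"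
        by (auto simp: interval_def quot_chain_iff[OF assms(1,2)] assms)
      then show ?thesis using z by blast
    qed
  qed
qed

lemma condense_iff:
  assumes "Linear_order A" "convex_equiv A R"
  shows "(x, y) \<in> condense A R \<longleftrightarrow> x \<in> Field A \<and> y \<in> Field A \<and>
    finite ((\<lambda>z. R `` {z}) ` interval A x y)"
  using interval_quot_chain[OF assms] by (auto simp: condense_def)

lemma interval_subset_Un:
  assumes "Linear_order A" "x \<in> Field A" "y \<in> Field A" "z \<in> Field A"
  shows "interval A x z \<subseteq> interval A x y \<union> interval A y z"
proof
  fix w assume w: "w \<in> interval A x z"
  then have "w \<in> Field A" by (auto simp: interval_def dest: lin_Field)
  then have "(y, w) \<in> A \<or> (w, y) \<in> A" using lin_total[OF assms(1)] assms(3) by blast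
  with w show "w \<in> interval A x y \<union> interval A y z" unfolding interval_def by blast
qed

lemma convex_equiv_condense:
  assumes "Linear_order A" "convex_equiv A R"
  shows "convex_equiv A (condense A R)"
proof (rule convex_equivI, goal_cases)
  case 1
  then show ?case by (auto simp: condense_def)
next
  case (2 x)
  have "interval A x x \<subseteq> {x}" using lin_antisym[OF assms(1)] by (auto simp: interval_def)
  then show ?case using 2 by (auto simp: condense_iff[OF assms] intro: finite_subset)
next
  case (3 x y)
  moreover have "interval A y x = interval A x y" by (auto simp: interval_def)
  ultimately show ?case by (auto simp: condense_iff[OF assms])
next
  case (4 x y z)
  then have "finite ((\<lambda>z. R `` {z}) ` (interval A x y \<union> interval A y z))"
    by (auto simp: condense_iff[OF assms] image_Un)
  with 4 show ?case
    using interval_subset_Un[OF assms(1), of x y z] finite_subset[OF image_mono]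
    by (auto simp: condense_iff[OF assms])
next
  case (5 x y z)
  have "interval A x y \<subseteq> interval A x z"
    using 5 lin_antisym[OF assms(1)] lin_trans[OF assms(1)] unfolding interval_def by blast
  with 5 show ?case using finite_subset[OF image_mono]
    by (auto simp: condense_iff[OF assms] lin_Field)
qed

lemma condense_mono:
  assumes "Linear_order A" "convex_equiv A R"
  shows "R \<subseteq> condense A R"
proof clarify
  fix x y assume xy: "(x, y) \<in> R"
  note R = convex_equivD[OF assms(2)]
  have F: "x \<in> Field A" "y \<in> Field A" using xy R by blast+
  have "R `` {z} = R `` {x}" if "z \<in> interval A x y" for z
  proof -
    have "(x, z) \<in> A \<and> (z, y) \<in> A \<or> (y, z) \<in> A \<and> (z, x) \<in> A"
      using that by (simp add: interval_def)
    then have "(z, x) \<in> R"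
    proof
      assume "(x, z) \<in> A \<and> (z, y) \<in> A"
      then have "(x, z) \<in> R" using R(6) xy by blast
      then show ?thesis by (rule R(2))
    next
      assume "(y, z) \<in> A \<and> (z, x) \<in> A"
      then show ?thesis using convex_equivD_right[OF assms(2), of y z x] R(2)[OF xy] by blast
    qed
    then show ?thesis using class_eq_iff[OF assms(2)] R(4,5) by simp
  qed
  then have "(\<lambda>z. R `` {z}) ` interval A x y \<subseteq> {R `` {x}}" by blast
  then show "(x, y) \<in> condense A R"
    using F finite_subset by (auto simp: condense_iff[OF assms])
qed

section \<open>The relations \<open>crel\<close>\<close>

lemma ordinal_cases:
  fixes \<alpha> :: ordinal
  obtains "\<alpha> = (0, 0)" | i j where "\<alpha> = (i, Suc j)" | i where "\<alpha> = (Suc i, 0)"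
  by (cases \<alpha>; cases "fst \<alpha>"; cases "snd \<alpha>") auto

lemma ordinal_less_simps:
  fixes \<beta> :: ordinal
  shows "\<beta> < (i, Suc j) \<longleftrightarrow> \<beta> \<le> (i, j)" "\<beta> < (Suc i, 0) \<longleftrightarrow> fst \<beta> \<le> i" "\<not> \<beta> < (0, 0)"
  by (cases \<beta>; auto simp: less_prod_def less_eq_prod_def)+

lemma crel_mono_convex_equiv:
  fixes \<alpha> :: ordinal
  assumes "Linear_order A"
  shows "convex_equiv A (crel A \<alpha>) \<and> (\<forall>\<beta>\<le>\<alpha>. crel A \<beta> \<subseteq> crel A \<alpha>)"
proof (induction \<alpha> rule: less_induct)
  case (less \<alpha>)
  consider "\<alpha> = (0, 0)" | i j where "\<alpha> = (i, Suc j)" | i where "\<alpha> = (Suc i, 0)"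
    by (rule ordinal_cases)
  then show ?case
  proof cases
    case 1
    have "convex_equiv A (Id_on (Field A))"
      by (rule convex_equivI) (auto dest: lin_antisym[OF assms] lin_Field)
    moreover have "\<beta> = \<alpha>" if "\<beta> \<le> \<alpha>" for \<beta>
      using that ordinal_less_simps(3)[of \<beta>] unfolding 1 by simp
    ultimately show ?thesis using 1 by (auto simp: crel_lex)
  next
    case (2 i j)
    have ih: "convex_equiv A (crel A (i, j))" "\<forall>\<beta>\<le>(i, j). crel A \<beta> \<subseteq> crel A (i, j)"
      using less[of "(i, j)"] 2 by (auto simp: ordinal_less_simps)
    have "crel A \<beta> \<subseteq> crel A \<alpha>" if "\<beta> \<le> \<alpha>" for \<beta>
    proof (cases "\<beta> = \<alpha>")
      case False
      then have "\<beta> \<le> (i, j)" using that 2 by (metis ordinal_less_simps(1) order_le_imp_less_or_eq)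
      then have "crel A \<beta> \<subseteq> crel A (i, j)" using ih(2) by blast
      then show ?thesis using condense_mono[OF assms ih(1)] 2 by (simp add: crel_lex)
    qed simp
    then show ?thesis using convex_equiv_condense[OF assms ih(1)] 2 by (auto simp: crel_lex)
  next
    case (3 i)
    define I :: "ordinal set" where "I = {\<beta>. fst \<beta> \<le> i}"
    have I: "{(i', j' :: nat). i' \<le> i} = I" by (auto simp: I_def)
    have cr: "(x, y) \<in> crel A \<alpha> \<longleftrightarrow> (\<exists>\<beta>\<in>I. (x, y) \<in> crel A \<beta>)" for x y
      by (simp only: 3 crel_lex I UN_iff)
    have crI: "(x, y) \<in> crel A \<alpha>" if "\<beta> \<in> I" "(x, y) \<in> crel A \<beta>" for x y \<beta>
      unfolding cr using that by (rule bexI[rotated])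
    have lt: "\<beta> < \<alpha>" if "\<beta> \<in> I" for \<beta>
      using that 3 by (simp add: I_def ordinal_less_simps)
    have ih: "convex_equiv A (crel A \<beta>)" "\<gamma> \<le> \<beta> \<Longrightarrow> crel A \<gamma> \<subseteq> crel A \<beta>" if "\<beta> \<in> I" for \<beta> \<gamma>
      using less[OF lt[OF that]] by blast+
    have "convex_equiv A (crel A \<alpha>)"
    proof (rule convex_equivI, goal_cases)
      case 1
      show ?case
      proof (rule subrelI)
        fix x y assume "(x, y) \<in> crel A \<alpha>"
        then obtain \<beta> where "\<beta> \<in> I" "(x, y) \<in> crel A \<beta>" unfolding cr by (rule bexE)
        then show "(x, y) \<in> Field A \<times> Field A" using convex_equivD(4,5)[OF ih(1)] by simp
      qed
    next
      case (2 x)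
      have "(0, 0) \<in> I" by (simp add: I_def)
      then show ?case using convex_equivD(1)[OF ih(1) 2] crI by simp
    next
      case (3 x y)
      then obtain \<beta> where b: "\<beta> \<in> I" "(x, y) \<in> crel A \<beta>" unfolding cr by (rule bexE)
      show ?case by (rule crI[OF b(1) convex_equivD(2)[OF ih(1)[OF b(1)] b(2)]])
    next
      case (4 x y z)
      obtain \<beta> where b: "\<beta> \<in> I" "(x, y) \<in> crel A \<beta>" using 4(1) unfolding cr by (rule bexE)
      obtain \<gamma> where c: "\<gamma> \<in> I" "(y, z) \<in> crel A \<gamma>" using 4(2) unfolding cr by (rule bexE)
      show ?case
      proof (cases "\<beta> \<le> \<gamma>")
        case True
        then have "(x, y) \<in> crel A \<gamma>" using ih(2)[OF c(1)] b(2) by blast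
        then show ?thesis by (rule crI[OF c(1) convex_equivD(3)[OF ih(1)[OF c(1)] _ c(2)]])
      next
        case False
        then have "\<gamma> \<le> \<beta>" by simp
        then have "(y, z) \<in> crel A \<beta>" using ih(2)[OF b(1)] c(2) by blast
        then show ?thesis by (rule crI[OF b(1) convex_equivD(3)[OF ih(1)[OF b(1)] b(2)]])
      qed
    next
      case (5 x y z)
      then obtain \<beta> where b: "\<beta> \<in> I" "(x, z) \<in> crel A \<beta>" unfolding cr by (blast elim: bexE)
      show ?case by (rule crI[OF b(1) convex_equivD(6)[OF ih(1)[OF b(1)] 5(1,2) b(2)]])
    qed
    moreover have "crel A \<beta> \<subseteq> crel A \<alpha>" if "\<beta> \<le> \<alpha>" for \<beta>
    proof (cases "\<beta> = \<alpha>")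
      case False
      then have "\<beta> < \<alpha>" using that by simp
      then have "\<beta> \<in> I" using 3 by (simp add: ordinal_less_simps I_def)
      then show ?thesis using crI by (intro subrelI)
    qed simp
    ultimately show ?thesis by blast
  qed
qed

lemma convex_equiv_crel: "Linear_order A \<Longrightarrow> convex_equiv A (crel A (\<alpha> :: ordinal))"
  using crel_mono_convex_equiv by blast

lemma crel_mono: "Linear_order A \<Longrightarrow> (\<beta> :: ordinal) \<le> \<alpha> \<Longrightarrow> crel A \<beta> \<subseteq> crel A \<alpha>"
  using crel_mono_convex_equiv by blast

lemma crel_sub: "Linear_order A \<Longrightarrow> crel A (\<alpha> :: ordinal) \<subseteq> Field A \<times> Field A"
  by (auto dest: convex_equivD(4,5)[OF convex_equiv_crel])

section \<open>Convex embeddings\<close>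

text \<open>An isomorphism of \<open>A\<close> onto a convex subset of \<open>B\<close>.\<close>

definition convex_emb :: "'a rel \<Rightarrow> 'b rel \<Rightarrow> ('a \<Rightarrow> 'b) \<Rightarrow> bool"
  where "convex_emb A B f \<longleftrightarrow> inj_on f (Field A) \<and> f ` Field A \<subseteq> Field B \<and>
    (\<forall>a\<in>Field A. \<forall>b\<in>Field A. (a, b) \<in> A \<longleftrightarrow> (f a, f b) \<in> B) \<and>
    (\<forall>a\<in>Field A. \<forall>b\<in>Field A. \<forall>y. (f a, y) \<in> B \<longrightarrow> (y, f b) \<in> B \<longrightarrow> y \<in> f ` Field A)"

lemma convex_emb_iso: "iso A B f \<Longrightarrow> convex_emb A B f"
  by (auto simp: iso_bij_order convex_emb_def bij_betw_def dest: lin_Field)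

lemma convex_emb_Restr:
  assumes "Linear_order A" "\<And>x y z. x \<in> D \<Longrightarrow> z \<in> D \<Longrightarrow> (x, y) \<in> A \<Longrightarrow> (y, z) \<in> A \<Longrightarrow> y \<in> D"
  shows "convex_emb (Restr A D) A id"
  unfolding convex_emb_def using assms by (auto simp: Field_Restr_lin dest: lin_Field)

lemma convex_emb_comp:
  assumes "convex_emb A B f" "convex_emb B C g"
  shows "convex_emb A C (g \<circ> f)"
  unfolding convex_emb_def
proof (intro conjI ballI allI impI)
  show "inj_on (g \<circ> f) (Field A)"
    using assms by (auto simp: convex_emb_def intro: comp_inj_on inj_on_subset)
  show "(g \<circ> f) ` Field A \<subseteq> Field C" using assms unfolding convex_emb_def by fastforce
next
  fix a b assume "a \<in> Field A" "b \<in> Field A"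
  moreover from this have "f a \<in> Field B" "f b \<in> Field B" using assms by (auto simp: convex_emb_def)
  ultimately show "((a, b) \<in> A) = (((g \<circ> f) a, (g \<circ> f) b) \<in> C)"
    using assms by (simp add: convex_emb_def)
next
  fix a b y assume ab: "a \<in> Field A" "b \<in> Field A" and y: "((g \<circ> f) a, y) \<in> C" "(y, (g \<circ> f) b) \<in> C"
  have fab: "f a \<in> Field B" "f b \<in> Field B" using ab assms by (auto simp: convex_emb_def)
  then have "y \<in> g ` Field B" using y assms(2) unfolding convex_emb_def o_apply by blast
  then obtain w where w: "w \<in> Field B" "y = g w" by blast
  with y fab have "(f a, w) \<in> B" "(w, f b) \<in> B" using assms(2) by (auto simp: convex_emb_def)
  then have "w \<in> f ` Field A" using ab assms(1) unfolding convex_emb_def by blast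
  then show "y \<in> (g \<circ> f) ` Field A" using w by auto
qed

lemma finite_image_same_kernel:
  assumes "\<And>x y. x \<in> I \<Longrightarrow> y \<in> I \<Longrightarrow> g x = g y \<longleftrightarrow> h x = h y"
  shows "finite (g ` I) \<longleftrightarrow> finite (h ` I)"
proof -
  have "finite (h ` I)" if fin: "finite (g ` I)"
    and ker: "\<And>x y. x \<in> I \<Longrightarrow> y \<in> I \<Longrightarrow> g x = g y \<longrightarrow> h x = h y"
    for g :: "'a \<Rightarrow> 'x" and h :: "'a \<Rightarrow> 'y"
  proof -
    have "h (inv_into I g (g x)) = h x" if "x \<in> I" for x
      using ker[of "inv_into I g (g x)" x] that by (simp add: f_inv_into_f inv_into_into)
    then have "h ` I = (h \<circ> inv_into I g) ` (g ` I)" by (force simp: image_iff)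
    then show ?thesis using fin by simp
  qed
  from this[of g h] this[of h g] show ?thesis using assms by blast
qed

lemma interval_convex_emb:
  assumes "convex_emb A B f" "x \<in> Field A" "y \<in> Field A"
  shows "interval B (f x) (f y) = f ` interval A x y"
proof
  show "f ` interval A x y \<subseteq> interval B (f x) (f y)"
    using assms(1-3) unfolding convex_emb_def interval_def by (auto 0 3 dest: lin_Field)
  show "interval B (f x) (f y) \<subseteq> f ` interval A x y"
  proof
    fix z assume z: "z \<in> interval B (f x) (f y)"
    then have "(f x, z) \<in> B \<and> (z, f y) \<in> B \<or> (f y, z) \<in> B \<and> (z, f x) \<in> B"
      by (simp add: interval_def)
    then have "z \<in> f ` Field A"
      using assms unfolding convex_emb_def by (elim disjE conjE) metis+
    then obtain w where "w \<in> Field A" "z = f w" by blast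
    with z show "z \<in> f ` interval A x y" using assms by (auto simp: convex_emb_def interval_def)
  qed
qed

text \<open>The relations \<open>\<rho>\<^sub>\<alpha>\<close> are local: whether two points are related depends only on the interval between them.\<close>

lemma crel_convex_emb:
  fixes \<alpha> :: ordinal
  assumes "Linear_order A" "Linear_order B" "convex_emb A B f" "x \<in> Field A" "y \<in> Field A"
  shows "(f x, f y) \<in> crel B \<alpha> \<longleftrightarrow> (x, y) \<in> crel A \<alpha>"
  using assms(4,5)
proof (induction \<alpha> arbitrary: x y rule: less_induct)
  case (less \<alpha>)
  have fF: "f x \<in> Field B" "f y \<in> Field B" using less.prems assms(3) by (auto simp: convex_emb_def)
  consider "\<alpha> = (0, 0)" | i j where "\<alpha> = (i, Suc j)" | i where "\<alpha> = (Suc i, 0)"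
    by (rule ordinal_cases)
  then show ?case
  proof cases
    case 1
    then show ?thesis using less.prems fF assms(3) by (auto simp: crel_lex convex_emb_def inj_on_def)
  next
    case (2 i j)
    let ?R = "crel A (i, j)" and ?S = "crel B (i, j)"
    note R = convex_equiv_crel[OF assms(1), of "(i, j)"] and S = convex_equiv_crel[OF assms(2), of "(i, j)"]
    have F: "f z \<in> Field B" if "z \<in> Field A" for z using that assms(3) by (auto simp: convex_emb_def)
    have ker: "?R `` {z} = ?R `` {w} \<longleftrightarrow> ?S `` {f z} = ?S `` {f w}"
      if "z \<in> interval A x y" "w \<in> interval A x y" for z w
    proof -
      have zw: "z \<in> Field A" "w \<in> Field A" using that by (auto simp: interval_def lin_Field)
      then show ?thesis
        using class_eq_iff[OF R zw] class_eq_iff[OF S F F, OF zw] less.IH[of "(i, j)" z w] 2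
        by (auto simp: ordinal_less_simps)
    qed
    have "finite ((\<lambda>z. ?S `` {z}) ` interval B (f x) (f y)) \<longleftrightarrow> finite ((\<lambda>z. ?R `` {z}) ` interval A x y)"
      unfolding interval_convex_emb[OF assms(3) less.prems] image_image
      by (rule finite_image_same_kernel) (use ker in blast)
    then show ?thesis
      using less.prems fF by (simp add: 2 crel_lex condense_iff[OF assms(1) R] condense_iff[OF assms(2) S])
  next
    case (3 i)
    have "{(i', j' :: nat). i' \<le> i} = {\<beta>. fst \<beta> \<le> i}" by auto
    then show ?thesis using less.IH less.prems 3 by (simp add: crel_lex ordinal_less_simps)
  qed
qed

section \<open>Rank\<close>

lemma one_chain_iff:
  assumes "Linear_order A"
  shows "quot A (\<alpha> :: ordinal) \<cong>\<^sub>c one_chain \<longleftrightarrow> Field A \<noteq> {} \<and> crel A \<alpha> = Field A \<times> Field A"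
proof -
  let ?R = "crel A \<alpha>"
  note R = convex_equiv_crel[OF assms, of \<alpha>]
  have F: "Field (quot A \<alpha>) = Field A // ?R"
    unfolding quot_def by (rule Field_quot_chain[OF assms R])
  have F1: "Field one_chain = {()}" by (auto simp: one_chain_def Field_def)
  show ?thesis
  proof
    assume "quot A \<alpha> \<cong>\<^sub>c one_chain"
    then obtain f where f: "bij_betw f (Field A // ?R) {()}"
      unfolding chain_iso_def iso_bij_order F F1 by blast
    then have c: "card (Field A // ?R) = 1" using bij_betw_same_card[OF f] by simp
    then obtain c where c: "Field A // ?R = {c}" using card_1_singletonE by blast
    have "Field A \<noteq> {}" using c by (auto simp: quotient_def)
    moreover have "(x, y) \<in> ?R" if "x \<in> Field A" "y \<in> Field A" for x y
    proof -
      have "?R `` {x} \<in> {c}" "?R `` {y} \<in> {c}" using that quotientI c by metis+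
      then show ?thesis using class_eq_iff[OF R that] by simp
    qed
    ultimately show "Field A \<noteq> {} \<and> ?R = Field A \<times> Field A" using crel_sub[OF assms, of \<alpha>] by auto
  next
    assume a: "Field A \<noteq> {} \<and> ?R = Field A \<times> Field A"
    then have q: "Field A // ?R = {Field A}" by (auto simp: quotient_def)
    then have "quot A \<alpha> = {(Field A, Field A)}"
      using a lin_refl[OF assms] by (auto simp: quot_def quot_chain_def)
    then show "quot A \<alpha> \<cong>\<^sub>c one_chain"
      by (auto simp: chain_iso_def iso_bij_order one_chain_def Field_def bij_betw_def)
  qed
qed

lemma has_rank_iff:
  assumes "Linear_order A"
  shows "has_rank A (\<alpha> :: ordinal) \<longleftrightarrow> Field A \<noteq> {} \<and> crel A \<alpha> = Field A \<times> Field A \<and>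
    (\<forall>\<beta><\<alpha>. crel A \<beta> \<noteq> Field A \<times> Field A)"
  unfolding has_rank_def one_chain_iff[OF assms] by (cases "Field A = {}") (simp_all del: split_paired_All)

lemma has_rank_iso:
  fixes \<alpha> :: ordinal
  assumes "A \<cong>\<^sub>c B" "Linear_order A" "has_rank B \<alpha>"
  shows "has_rank A \<alpha>"
proof -
  obtain f where f: "iso A B f" using assms(1) by (auto simp: chain_iso_def)
  have B: "Linear_order B" using Linear_order_iso f assms(2) by blast
  have F: "Field B = f ` Field A" using f by (auto simp: iso_bij_order bij_betw_def)
  have c: "(f x, f y) \<in> crel B \<beta> \<longleftrightarrow> (x, y) \<in> crel A \<beta>" if "x \<in> Field A" "y \<in> Field A" for x y and \<beta> :: ordinal
    using crel_convex_emb[OF assms(2) B convex_emb_iso[OF f]] that by blast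
  have t: "crel A \<beta> = Field A \<times> Field A \<longleftrightarrow> crel B \<beta> = Field B \<times> Field B" for \<beta> :: ordinal
  proof -
    have "crel A \<beta> \<subseteq> Field A \<times> Field A" "crel B \<beta> \<subseteq> Field B \<times> Field B"
      using crel_sub assms(2) B by blast+
    then have "crel A \<beta> = Field A \<times> Field A \<longleftrightarrow> (\<forall>x\<in>Field A. \<forall>y\<in>Field A. (x, y) \<in> crel A \<beta>)"
      "crel B \<beta> = Field B \<times> Field B \<longleftrightarrow> (\<forall>x\<in>Field A. \<forall>y\<in>Field A. (f x, f y) \<in> crel B \<beta>)"
      unfolding F by blast+
    then show ?thesis using c by simp
  qed
  show ?thesis using assms(3) unfolding has_rank_iff[OF assms(2)] has_rank_iff[OF B] t
    by (simp add: F)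
qed

lemma convex_emb_tail: "Linear_order A \<Longrightarrow> convex_emb (tail A x) A id"
  unfolding tail_def above_def
  by (rule convex_emb_Restr) (auto intro: lin_trans)

text \<open>An isomorphism between two tails of a chain is compatible with all \<open>\<rho>\<^sub>\<alpha>\<close> of the whole chain.\<close>

lemma tail_isoE:
  assumes A: "Linear_order A" and x: "x \<in> Field A" "x' \<in> Field A" and t: "tail A x \<cong>\<^sub>c tail A x'"
  obtains g where "bij_betw g (above A x) (above A x')" "g x = x'"
    "\<And>u v. (x, u) \<in> A \<Longrightarrow> (x, v) \<in> A \<Longrightarrow> (g u, g v) \<in> A \<longleftrightarrow> (u, v) \<in> A"
    "\<And>u v \<alpha>. (x, u) \<in> A \<Longrightarrow> (x, v) \<in> A \<Longrightarrow> (g u, g v) \<in> crel A (\<alpha> :: ordinal) \<longleftrightarrow> (u, v) \<in> crel A \<alpha>"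
proof -
  obtain g where g: "iso (tail A x) (tail A x') g" using t unfolding chain_iso_def by blast
  have b: "bij_betw g (above A x) (above A x')" using g by (simp add: iso_bij_order Field_tail A)
  have gin: "(x', g u) \<in> A" if "(x, u) \<in> A" for u
    using b that unfolding bij_betw_def above_def by blast
  have o: "(g u, g v) \<in> A \<longleftrightarrow> (u, v) \<in> A" if "(x, u) \<in> A" "(x, v) \<in> A" for u v
    using g gin that by (simp add: iso_bij_order Field_tail A above_def tail_iff)
  have gx: "g x = x'"
  proof -
    have "x' \<in> g ` above A x" using b lin_refl[OF A x(2)] by (auto simp: bij_betw_def above_def)
    then obtain w where w: "(x, w) \<in> A" "g w = x'" by (auto simp: above_def)
    then have "(g x, x') \<in> A" using o[of x w] lin_refl[OF A x(1)] by simp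
    then show ?thesis using gin[OF lin_refl[OF A x(1)]] lin_antisym[OF A] by blast
  qed
  have c: "(g u, g v) \<in> crel A \<alpha> \<longleftrightarrow> (u, v) \<in> crel A \<alpha>"
    if u: "(x, u) \<in> A" "(x, v) \<in> A" for u v and \<alpha> :: ordinal
  proof -
    note T = Linear_order_tail[OF A]
    have "u \<in> Field (tail A x)" "v \<in> Field (tail A x)" "g u \<in> Field (tail A x')" "g v \<in> Field (tail A x')"
      using u gin by (simp_all add: Field_tail A above_def)
    then show ?thesis
      using crel_convex_emb[OF T A convex_emb_tail[OF A], of u x v \<alpha>]
        crel_convex_emb[OF T A convex_emb_tail[OF A], of "g u" x' "g v" \<alpha>]
        crel_convex_emb[OF T T convex_emb_iso[OF g], of u v \<alpha>]
      by simp
  qed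
  show ?thesis by (rule that[OF b gx o c])
qed

text \<open>In a uniform chain, what happens above some point happens above every point. In particular,
  if the chain has rank \<open>\<gamma>\<close>, then it has no last \<open>\<beta>\<close>-component for any \<open>\<beta> < \<gamma>\<close>.\<close>

lemma uniform_no_last_component:
  fixes \<beta> \<gamma> :: ordinal
  assumes "uniform A" "\<not> crel A \<gamma> \<subseteq> crel A \<beta>" "x \<in> Field A"
  shows "\<exists>y. (x, y) \<in> A \<and> (x, y) \<in> crel A \<gamma> \<and> (x, y) \<notin> crel A \<beta>"
proof -
  have A: "Linear_order A" using assms(1) by (simp add: uniform_def)
  note Cs = convex_equivD(2)[OF convex_equiv_crel[OF A]]
  obtain u v where uv: "(u, v) \<in> crel A \<gamma>" "(u, v) \<notin> crel A \<beta>" using assms(2) by (meson subrelI)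
  moreover have F: "u \<in> Field A" "v \<in> Field A" using uv(1) crel_sub[OF A] by blast+
  moreover have "(v, u) \<in> crel A \<gamma>" "(v, u) \<notin> crel A \<beta>" using uv Cs by blast+
  ultimately obtain u v where uv: "(u, v) \<in> crel A \<gamma>" "(u, v) \<notin> crel A \<beta>" "u \<in> Field A" "(u, v) \<in> A"
    using lin_total[OF A] by metis
  have "tail A u \<cong>\<^sub>c tail A x" using assms(1,3) uv(3) unfolding uniform_def by blast
  then obtain g where g: "bij_betw g (above A u) (above A x)" "g u = x"
    "\<And>u' v' \<alpha>. (u, u') \<in> A \<Longrightarrow> (u, v') \<in> A \<Longrightarrow>
      (g u', g v') \<in> crel A (\<alpha> :: ordinal) \<longleftrightarrow> (u', v') \<in> crel A \<alpha>"
    by (rule tail_isoE[OF A uv(3) assms(3)]) (rule that)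
  have "(x, g v) \<in> A" using g(1) uv(4) unfolding bij_betw_def above_def by blast
  moreover have "(x, g v) \<in> crel A \<alpha> \<longleftrightarrow> (u, v) \<in> crel A \<alpha>" for \<alpha> :: ordinal
    using g(3)[OF lin_refl[OF A uv(3)] uv(4)] g(2) by simp
  ultimately show ?thesis using uv by (intro exI[of _ "g v"]) simp
qed


(* Keeps the index \<open>1\<close> in \<open>omega_plus n\<close> from being rewritten to \<open>Suc 0\<close>. *)
declare One_nat_def [simp del]

lemma has_rankD:
  assumes "has_rank A (\<alpha> :: ordinal)" "Linear_order A"
  shows "Field A \<noteq> {}" "crel A \<alpha> = Field A \<times> Field A" "\<beta> < \<alpha> \<Longrightarrow> crel A \<beta> \<noteq> Field A \<times> Field A"
  using assms(1) unfolding has_rank_iff[OF assms(2)] by blast+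

section \<open>Block decompositions\<close>

text \<open>A presentation of a chain as an ordered sum of nonempty chains indexed by \<open>I \<subseteq> \<int>\<close>; \<open>p x\<close> is
  the index of the summand that contains \<open>x\<close>, and \<open>block B p i\<close> is the \<open>i\<close>-th summand. Mostly \<open>I\<close> is \<open>\<int>\<close> or
  the set of nonnegative integers.\<close>

definition blocks :: "'a rel \<Rightarrow> ('a \<Rightarrow> int) \<Rightarrow> int set \<Rightarrow> bool"
  where "blocks B p I \<longleftrightarrow> Linear_order B \<and> p ` Field B = I \<and> (\<forall>x y. (x, y) \<in> B \<longrightarrow> p x \<le> p y)"

definition block :: "'a rel \<Rightarrow> ('a \<Rightarrow> int) \<Rightarrow> int \<Rightarrow> 'a rel"
  where "block B p i = Restr B {x. p x = i}"

lemma blocks_less: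
  assumes "blocks B p I" "x \<in> Field B" "y \<in> Field B" "p x < p y"
  shows "(x, y) \<in> B"
proof (rule ccontr)
  assume "(x, y) \<notin> B"
  then have "(y, x) \<in> B" using assms lin_total[of B x y] by (auto simp: blocks_def)
  then have "p y \<le> p x" using assms(1) by (auto simp: blocks_def)
  then show False using assms by simp
qed

lemma blocks_iff:
  assumes "blocks B p I" "x \<in> Field B" "y \<in> Field B"
  shows "(x, y) \<in> B \<longleftrightarrow> p x < p y \<or> p x = p y \<and> (x, y) \<in> block B p (p x)"
  using blocks_less[OF assms] assms(1) unfolding blocks_def block_def by fastforce

lemma Field_block: "Linear_order B \<Longrightarrow> Field (block B p i) = {x \<in> Field B. p x = i}"
  unfolding block_def by (auto simp: Field_Restr_lin)

lemma Linear_order_block: "Linear_order B \<Longrightarrow> Linear_order (block B p i)"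
  unfolding block_def by (rule Linear_order_Restr)

lemma convex_emb_block:
  assumes "blocks B p I"
  shows "convex_emb (block B p i) B id"
  unfolding block_def
proof (rule convex_emb_Restr)
  fix x y z assume a: "x \<in> {x. p x = i}" "z \<in> {x. p x = i}" "(x, y) \<in> B" "(y, z) \<in> B"
  then have "p x \<le> p y" "p y \<le> p z" using assms unfolding blocks_def by blast+
  then show "y \<in> {x. p x = i}" using a by simp
qed (use assms in \<open>simp add: blocks_def\<close>)

text \<open>Isomorphisms between corresponding blocks combine to an isomorphism that respects the block index.\<close>

lemma blocks_match:
  assumes B: "blocks B p I" and B': "blocks B' p' I"
    and iso: "\<And>i. i \<in> I \<Longrightarrow> block B p i \<cong>\<^sub>c block B' p' i"
  obtains f where "iso B B' f" "\<And>x. x \<in> Field B \<Longrightarrow> p' (f x) = p x"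
proof -
  have lin: "Linear_order B" "Linear_order B'" using B B' by (auto simp: blocks_def)
  obtain g where g: "\<And>i. i \<in> I \<Longrightarrow> iso (block B p i) (block B' p' i) (g i)"
    using iso unfolding chain_iso_def by metis
  have pI: "p x \<in> I" if "x \<in> Field B" for x using B that by (auto simp: blocks_def)
  define f where "f x = g (p x) x" for x
  have gb: "bij_betw (g i) {x \<in> Field B. p x = i} {x \<in> Field B'. p' x = i}" if "i \<in> I" for i
    using g[OF that] by (simp add: iso_bij_order Field_block lin)
  have f: "f x \<in> Field B'" "p' (f x) = p x" if "x \<in> Field B" for x
    using bij_betwE[OF gb[OF pI[OF that]]] that by (auto simp: f_def)
  have o: "(x, y) \<in> B \<longleftrightarrow> (f x, f y) \<in> B'" if xy: "x \<in> Field B" "y \<in> Field B" for x y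
  proof (cases "p x = p y")
    case True
    then have "(x, y) \<in> block B p (p x) \<longleftrightarrow> (f x, f y) \<in> block B' p' (p x)"
      using g[OF pI[OF xy(1)]] xy by (simp add: iso_bij_order Field_block lin f_def)
    then show ?thesis using True f xy by (simp add: blocks_iff[OF B xy] blocks_iff[OF B' f(1) f(1)])
  next
    case False
    then show ?thesis using f xy by (simp add: blocks_iff[OF B xy] blocks_iff[OF B' f(1) f(1)])
  qed
  have "inj_on f (Field B)"
    by (rule inj_onI) (metis o lin_antisym[OF lin(1)] lin_refl[OF lin(1)])
  moreover have "f ` Field B = Field B'"
  proof
    show "f ` Field B \<subseteq> Field B'" using f by blast
    show "Field B' \<subseteq> f ` Field B"
    proof
      fix y assume y: "y \<in> Field B'"
      then have i: "p' y \<in> I" using B' by (auto simp: blocks_def)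
      then have "y \<in> g (p' y) ` {x \<in> Field B. p x = p' y}" using gb[OF i] y by (simp add: bij_betw_def)
      then obtain x where "x \<in> Field B" "p x = p' y" "y = g (p' y) x" by blast
      then have "y = f x" "x \<in> Field B" by (simp_all add: f_def)
      then show "y \<in> f ` Field B" by blast
    qed
  qed
  ultimately have "iso B B' f" using o by (simp add: iso_bij_order bij_betw_def)
  then show ?thesis using f(2) by (rule that)
qed

lemma blocks_shift:
  assumes "blocks B p I"
  shows "blocks B (\<lambda>x. p x + d) ((\<lambda>i. i + d) ` I)" "block B (\<lambda>x. p x + d) i = block B p (i - d)"
  using assms unfolding blocks_def block_def by (auto simp: image_image)

lemma blocks_of_tail:
  assumes B: "blocks B p I" and up: "\<And>m. m \<ge> 0 \<Longrightarrow> p x + m \<in> I" and x: "x \<in> Field B"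
  shows "blocks (tail B x) (\<lambda>z. p z - p x) {0..}"
    "block (tail B x) (\<lambda>z. p z - p x) 0 = tail (block B p (p x)) x"
    "m > 0 \<Longrightarrow> block (tail B x) (\<lambda>z. p z - p x) m = block B p (p x + m)"
proof -
  have lin: "Linear_order B" using B by (simp add: blocks_def)
  have ge: "p x \<le> p z" if "(x, z) \<in> B" for z using B that by (simp add: blocks_def)
  have "(\<lambda>z. p z - p x) ` above B x = {0..}"
  proof
    show "(\<lambda>z. p z - p x) ` above B x \<subseteq> {0..}" using ge by (auto simp: above_def)
    show "{0..} \<subseteq> (\<lambda>z. p z - p x) ` above B x"
    proof
      fix m :: int assume m: "m \<in> {0..}"
      show "m \<in> (\<lambda>z. p z - p x) ` above B x"
      proof (cases "m = 0")
        case True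
        then show ?thesis using lin_refl[OF lin x] by (force simp: above_def)
      next
        case False
        have "p x + m \<in> p ` Field B" using up[of m] m B by (simp add: blocks_def)
        then obtain z where z: "z \<in> Field B" "p z = p x + m" by auto
        then have "(x, z) \<in> B" using blocks_less[OF B x z(1)] m False by simp
        then show ?thesis using z by (force simp: above_def)
      qed
    qed
  qed
  then show "blocks (tail B x) (\<lambda>z. p z - p x) {0..}"
    using B Linear_order_tail[OF lin, of x] by (auto simp: blocks_def Field_tail tail_iff)
  show "block (tail B x) (\<lambda>z. p z - p x) 0 = tail (block B p (p x)) x"
    by (auto simp: block_def tail_def above_def)
  assume "m > 0"
  then have "(x, z) \<in> B" if "z \<in> Field B" "p z = p x + m" for z
    using blocks_less[OF B x that(1)] that by simp
  then show "block (tail B x) (\<lambda>z. p z - p x) m = block B p (p x + m)"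
    by (auto simp: block_def tail_def above_def algebra_simps lin_Field)
qed

text \<open>Beyond the block of the starting point, a tail consists of entire blocks.\<close>

lemma tail_blocks_iso:
  assumes B: "blocks B p I" "\<And>m. m \<ge> 0 \<Longrightarrow> p x + m \<in> I" "x \<in> Field B"
    and B': "blocks B' p' I'" "\<And>m. m \<ge> 0 \<Longrightarrow> p' y + m \<in> I'" "y \<in> Field B'"
    and "tail (block B p (p x)) x \<cong>\<^sub>c tail (block B' p' (p' y)) y"
    and "\<And>m. m > 0 \<Longrightarrow> block B p (p x + m) \<cong>\<^sub>c block B' p' (p' y + m)"
  shows "tail B x \<cong>\<^sub>c tail B' y"
proof -
  note b = blocks_of_tail[OF B] and b' = blocks_of_tail[OF B']
  have "block (tail B x) (\<lambda>z. p z - p x) m \<cong>\<^sub>c block (tail B' y) (\<lambda>z. p' z - p' y) m" if "m \<in> {0..}" for m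
    using that assms(7,8) b(3)[of m] b'(3)[of m] by (cases "m = 0") (simp_all add: b(2) b'(2))
  then show ?thesis using blocks_match[OF b(1) b'(1)] unfolding chain_iso_def by metis
qed

section \<open>The rank of a sum of blocks\<close>

text \<open>If a convex set \<open>D\<close> has no last \<open>\<beta>\<close>-component for any \<open>\<beta> < \<alpha>\<close>, then no point of \<open>D\<close> can be
  \<open>\<alpha>\<close>-related to a point beyond \<open>D\<close>: infinitely many components would lie in between.\<close>

lemma crel_separated:
  fixes \<alpha> :: ordinal
  assumes lin: "Linear_order B" and D: "D \<subseteq> Field B"
    and convex: "\<And>u v w. u \<in> D \<Longrightarrow> w \<in> D \<Longrightarrow> (u, v) \<in> B \<Longrightarrow> (v, w) \<in> B \<Longrightarrow> v \<in> D"
    and no_last: "\<And>\<beta> u. \<beta> < \<alpha> \<Longrightarrow> u \<in> D \<Longrightarrow> \<exists>v\<in>D. (u, v) \<in> B \<and> (u, v) \<notin> crel B \<beta>"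
    and xy: "x \<in> D" "y \<notin> D" "(x, y) \<in> B"
  shows "(x, y) \<notin> crel B \<alpha>"
  using no_last
proof (induction \<alpha> rule: less_induct)
  case (less \<alpha>)
  have xyF: "x \<in> Field B" "y \<in> Field B" using xy by (auto dest: lin_Field)
  consider "\<alpha> = (0, 0)" | i j where "\<alpha> = (i, Suc j)" | i where "\<alpha> = (Suc i, 0)"
    by (rule ordinal_cases)
  then show ?case
  proof cases
    case 1
    then show ?thesis using xy by (auto simp: crel_lex)
  next
    case (2 i j)
    let ?R = "crel B (i, j)"
    note R = convex_equiv_crel[OF lin, of "(i, j)"]
    have nl: "\<exists>v\<in>D. (u, v) \<in> B \<and> (u, v) \<notin> ?R" if "u \<in> D" for u
      using less.prems[OF _ that, of "(i, j)"] 2 by (simp add: ordinal_less_simps)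
    \<comment> \<open>Otherwise finitely many points of \<open>D\<close> represent all classes beyond \<open>x\<close>, and beyond the greatest of
      them there is yet another class.\<close>
    have "infinite ((\<lambda>z. ?R `` {z}) ` interval B x y)"
    proof
      assume fin: "finite ((\<lambda>z. ?R `` {z}) ` interval B x y)"
      define E where "E = {v \<in> D. (x, v) \<in> B}"
      have "E \<subseteq> interval B x y"
      proof
        fix v assume v: "v \<in> E"
        then have "(y, v) \<notin> B" using convex[of x v y] xy by (auto simp: E_def)
        then have "(v, y) \<in> B" using lin_total[OF lin, of v y] v D xyF by (auto simp: E_def)
        then show "v \<in> interval B x y" using v by (simp add: E_def interval_def)
      qed
      then have "finite ((\<lambda>z. ?R `` {z}) ` E)" using fin by (meson finite_subset image_mono)
      from finite_subset_image[OF this subset_refl]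
      obtain X where X: "X \<subseteq> E" "finite X" "(\<lambda>z. ?R `` {z}) ` E = (\<lambda>z. ?R `` {z}) ` X"
        by (elim exE conjE) (rule that)
      have "x \<in> E" using xy lin_refl[OF lin xyF(1)] by (simp add: E_def)
      then have "X \<noteq> {}" using X(3) by blast
      moreover have XF: "X \<subseteq> Field B" using X(1) D by (auto simp: E_def)
      ultimately obtain m where m: "m \<in> X" "\<And>z. z \<in> X \<Longrightarrow> (z, m) \<in> B"
        using finite_has_greatest[OF lin X(2)] by blast
      obtain v where v: "v \<in> D" "(m, v) \<in> B" "(m, v) \<notin> ?R" using nl[of m] m X by (auto simp: E_def)
      then have "v \<in> E" using m X lin_trans[OF lin, of x m v] by (auto simp: E_def)
      then have "?R `` {v} \<in> (\<lambda>z. ?R `` {z}) ` X" using X(3) by blast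
      then obtain z where z: "z \<in> X" "?R `` {v} = ?R `` {z}" by blast
      then have "(z, v) \<in> ?R"
        using class_eq_iff[OF R, of z v] XF v(1) D by auto
      then have "(m, v) \<in> ?R" using convex_equivD_right[OF R, of z m v] m(2)[OF z(1)] v(2) by blast
      then show False using v by blast
    qed
    then show ?thesis by (simp add: 2 crel_lex condense_iff[OF lin R])
  next
    case (3 i)
    have eq: "{(i', j' :: nat). i' \<le> i} = {\<beta> :: ordinal. fst \<beta> \<le> i}" by auto
    have "(x, y) \<notin> crel B \<beta>" if "fst \<beta> \<le> i" for \<beta> :: ordinal
    proof (rule less.IH)
      show lt: "\<beta> < \<alpha>" using that 3 by (simp add: ordinal_less_simps)
      fix \<gamma> u assume "\<gamma> < \<beta>" "u \<in> D"
      then show "\<exists>v\<in>D. (u, v) \<in> B \<and> (u, v) \<notin> crel B \<gamma>"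
        using less.prems[of \<gamma> u] order_less_trans[OF _ lt] by blast
    qed
    then show ?thesis unfolding 3 crel_lex eq by blast
  qed
qed

text \<open>In a sum of uniform chains of rank \<open>\<omega> + n\<close>, the \<open>(\<omega>+n)\<close>-components are exactly the summands.\<close>

lemma block_crel_iff:
  assumes B: "blocks B p I"
    and rank: "\<And>i. i \<in> I \<Longrightarrow> uniform (block B p i) \<and> has_rank (block B p i) (omega_plus n)"
    and xy: "x \<in> Field B" "y \<in> Field B"
  shows "(x, y) \<in> crel B (omega_plus n) \<longleftrightarrow> p x = p y"
proof -
  have lin: "Linear_order B" using B by (simp add: blocks_def)
  note R = convex_equiv_crel[OF lin, of "omega_plus n"]
  have pI: "p z \<in> I" if "z \<in> Field B" for z using B that by (auto simp: blocks_def)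
  note emb = convex_emb_block[OF B]
  have total: "(u, v) \<in> crel (block B p i) (omega_plus n)"
    if "i \<in> I" "u \<in> Field (block B p i)" "v \<in> Field (block B p i)" for u v i
    using has_rankD(2)[OF _ Linear_order_block[OF lin]] rank[OF that(1)] that(2,3) by blast
  have eq: "(u, v) \<in> crel B (omega_plus n)" if "u \<in> Field B" "v \<in> Field B" "p u = p v" for u v
    using total[OF pI[OF that(1)], of u v] crel_convex_emb[OF Linear_order_block[OF lin] lin emb, of u "p u" v] that
    by (simp add: Field_block lin)
  have lt: "(u, v) \<notin> crel B (omega_plus n)" if uv: "u \<in> Field B" "v \<in> Field B" "p u < p v" for u v
  proof (rule crel_separated[OF lin, of "Field (block B p (p u))"])
    let ?D = "block B p (p u)"
    note linD = Linear_order_block[OF lin, of p "p u"]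
    show "Field ?D \<subseteq> Field B" by (auto simp: Field_block lin)
    show "u \<in> Field ?D" "v \<notin> Field ?D" using uv by (auto simp: Field_block lin)
    show "(u, v) \<in> B" using blocks_less[OF B uv] .
    show "b \<in> Field ?D" if "a \<in> Field ?D" "c \<in> Field ?D" "(a, b) \<in> B" "(b, c) \<in> B" for a b c
    proof -
      have "p a \<le> p b" "p b \<le> p c" using B that(3,4) unfolding blocks_def by blast+
      then show ?thesis using that lin_Field(2)[OF that(3)] by (simp add: Field_block lin)
    qed
    fix \<beta> :: ordinal and w assume b: "\<beta> < omega_plus n" and w: "w \<in> Field ?D"
    have r: "uniform ?D" "has_rank ?D (omega_plus n)" using rank[OF pI[OF uv(1)]] by blast+
    then have full: "crel ?D (omega_plus n) = Field ?D \<times> Field ?D" and "crel ?D \<beta> \<noteq> Field ?D \<times> Field ?D"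
      using has_rankD[OF _ linD] b by blast+
    then have "\<not> crel ?D (omega_plus n) \<subseteq> crel ?D \<beta>" using crel_sub[OF linD, of \<beta>] by simp
    then obtain z where z: "(w, z) \<in> ?D" "(w, z) \<notin> crel ?D \<beta>"
      using uniform_no_last_component[OF r(1) _ w, of "omega_plus n" \<beta>] by blast
    have zF: "z \<in> Field ?D" using z(1) by (rule lin_Field)
    then have "(w, z) \<notin> crel B \<beta>" using z(2) crel_convex_emb[OF linD lin emb w zF] by simp
    moreover have "(w, z) \<in> B" using z(1) by (simp add: block_def)
    ultimately show "\<exists>z\<in>Field ?D. (w, z) \<in> B \<and> (w, z) \<notin> crel B \<beta>" using zF by blast
  qed
  show ?thesis
  proof (cases "p x = p y")
    case True
    then show ?thesis using eq xy by blast
  next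
    case False
    then have "(x, y) \<notin> crel B (omega_plus n) \<or> (y, x) \<notin> crel B (omega_plus n)"
      using lt[of x y] lt[of y x] xy by (cases "p x < p y") simp_all
    then show ?thesis using False convex_equivD(2)[OF R] by blast
  qed
qed

lemma blocks_has_rank:
  assumes B: "blocks B p I" and I: "0 \<in> I" "1 \<in> I"
    and rank: "\<And>i. i \<in> I \<Longrightarrow> uniform (block B p i) \<and> has_rank (block B p i) (omega_plus n)"
  shows "has_rank B (omega_plus (Suc n))"
proof -
  have lin: "Linear_order B" using B by (simp add: blocks_def)
  let ?R = "crel B (omega_plus n)"
  note R = convex_equiv_crel[OF lin, of "omega_plus n"] and c = block_crel_iff[OF B rank]
  have "0 \<in> p ` Field B" "1 \<in> p ` Field B" using B I by (auto simp: blocks_def)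
  then obtain x0 x1 where x: "x0 \<in> Field B" "p x0 = 0" "x1 \<in> Field B" "p x1 = 1" by (metis imageE)
  then have n: "(x0, x1) \<notin> ?R" using c by simp
  have "(x, y) \<in> crel B (omega_plus (Suc n))" if xy: "x \<in> Field B" "y \<in> Field B" for x y
  proof -
    have "p z \<in> {min (p x) (p y)..max (p x) (p y)}" if "z \<in> interval B x y" for z
      using B that unfolding blocks_def interval_def by fastforce
    then have fin: "finite (p ` interval B x y)"
      by (meson finite_atLeastAtMost_int finite_subset image_subsetI)
    have "finite ((\<lambda>z. ?R `` {z}) ` interval B x y) \<longleftrightarrow> finite (p ` interval B x y)"
    proof (rule finite_image_same_kernel)
      fix u v assume "u \<in> interval B x y" "v \<in> interval B x y"
      then have "u \<in> Field B" "v \<in> Field B" by (auto simp: interval_def dest: lin_Field)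
      then show "?R `` {u} = ?R `` {v} \<longleftrightarrow> p u = p v" using c class_eq_iff[OF R] by simp
    qed
    then show ?thesis using fin xy by (simp add: crel_lex condense_iff[OF lin R])
  qed
  then have "crel B (omega_plus (Suc n)) = Field B \<times> Field B" using crel_sub[OF lin] by blast
  moreover have "crel B \<beta> \<noteq> Field B \<times> Field B" if "\<beta> < omega_plus (Suc n)" for \<beta> :: ordinal
  proof -
    have "\<beta> \<le> omega_plus n" using that by (simp add: ordinal_less_simps)
    then have "(x0, x1) \<notin> crel B \<beta>" using n crel_mono[OF lin] by blast
    then show ?thesis using x by blast
  qed
  ultimately show ?thesis using x unfolding has_rank_iff[OF lin] by blast
qed

lemma components_blocks:
  assumes B: "blocks B p I"
    and c: "\<And>x y. x \<in> Field B \<Longrightarrow> y \<in> Field B \<Longrightarrow> (x, y) \<in> crel B (omega_plus n) \<longleftrightarrow> p x = p y"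
  shows "components B (omega_plus n) = (\<lambda>i. {x \<in> Field B. p x = i}) ` I"
proof -
  have lin: "Linear_order B" using B by (simp add: blocks_def)
  have "crel B (omega_plus n) `` {x} = {y \<in> Field B. p y = p x}" if "x \<in> Field B" for x
    using c[OF that] crel_sub[OF lin, of "omega_plus n"] by auto
  then have "components B (omega_plus n) = (\<lambda>x. {y \<in> Field B. p y = p x}) ` Field B"
    unfolding components_def quotient_def by auto
  also have "\<dots> = (\<lambda>i. {x \<in> Field B. p x = i}) ` p ` Field B" by (simp add: image_image)
  finally show ?thesis using B by (simp add: blocks_def)
qed

lemma predecessors_blocks:
  assumes B: "blocks B p {0..}"
    and c: "\<And>x y. x \<in> Field B \<Longrightarrow> y \<in> Field B \<Longrightarrow> (x, y) \<in> crel B (omega_plus n) \<longleftrightarrow> p x = p y"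
    and i: "i \<ge> 0"
  shows "finite (predecessors (quot B (omega_plus n)) {x \<in> Field B. p x = i})"
    "card (predecessors (quot B (omega_plus n)) {x \<in> Field B. p x = i}) = nat i"
proof -
  define K where "K j = {x \<in> Field B. p x = j}" for j
  have lin: "Linear_order B" using B by (simp add: blocks_def)
  note R = convex_equiv_crel[OF lin, of "omega_plus n"]
  have comp: "components B (omega_plus n) = K ` {0..}"
    unfolding K_def by (rule components_blocks[OF B c])
  have ne: "\<exists>x. x \<in> K j" if "j \<ge> 0" for j
  proof -
    have "j \<in> p ` Field B" using B that by (simp add: blocks_def)
    then show ?thesis unfolding K_def by auto
  qed
  have le: "(K j, K k) \<in> quot B (omega_plus n) \<longleftrightarrow> j \<le> k" if jk: "j \<ge> 0" "k \<ge> 0" for j k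
  proof -
    obtain x y where x: "x \<in> K j" and y: "y \<in> K k" using ne jk by blast
    have "K j \<in> Field B // crel B (omega_plus n)" "K k \<in> Field B // crel B (omega_plus n)"
      using comp jk unfolding components_def by auto
    then have "(K j, K k) \<in> quot B (omega_plus n) \<longleftrightarrow> (\<exists>x\<in>K j. \<exists>y\<in>K k. (x, y) \<in> B)"
      unfolding quot_def quot_chain_def by blast
    also have "\<dots> \<longleftrightarrow> j \<le> k"
    proof
      assume "\<exists>x\<in>K j. \<exists>y\<in>K k. (x, y) \<in> B"
      then show "j \<le> k" using B unfolding blocks_def K_def by blast
    next
      assume "j \<le> k"
      show "\<exists>x\<in>K j. \<exists>y\<in>K k. (x, y) \<in> B"
      proof (cases "j = k")
        case True
        then show ?thesis using x lin_refl[OF lin, of x] by (auto simp: K_def)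
      next
        case False
        then show ?thesis using blocks_less[OF B, of x y] x y \<open>j \<le> k\<close> by (auto simp: K_def)
      qed
    qed
    finally show ?thesis .
  qed
  have inj: "j = k" if "K j = K k" "j \<ge> 0" for j k using ne[OF that(2)] that(1) by (auto simp: K_def)
  have "predecessors (quot B (omega_plus n)) (K i) = K ` {0..<i}"
  proof
    show "predecessors (quot B (omega_plus n)) (K i) \<subseteq> K ` {0..<i}"
    proof
      fix d assume d: "d \<in> predecessors (quot B (omega_plus n)) (K i)"
      then have "d \<in> components B (omega_plus n)"
        by (auto simp: predecessors_def quot_def quot_chain_def components_def)
      then obtain j where j: "j \<ge> 0" "d = K j" unfolding comp by auto
      then have "j \<le> i" "j \<noteq> i" using d le i by (auto simp: predecessors_def)
      then show "d \<in> K ` {0..<i}" using j by auto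
    qed
    show "K ` {0..<i} \<subseteq> predecessors (quot B (omega_plus n)) (K i)"
    proof
      fix d assume "d \<in> K ` {0..<i}"
      then obtain j where j: "0 \<le> j" "j < i" "d = K j" by auto
      then have "K j \<noteq> K i" using inj[of j i] by auto
      then show "d \<in> predecessors (quot B (omega_plus n)) (K i)"
        using le[of j i] j by (simp add: predecessors_def)
    qed
  qed
  moreover have "inj_on K {0..<i}" by (rule inj_onI) (use inj in auto)
  ultimately show "finite (predecessors (quot B (omega_plus n)) {x \<in> Field B. p x = i})"
    "card (predecessors (quot B (omega_plus n)) {x \<in> Field B. p x = i}) = nat i"
    unfolding K_def[symmetric] by (simp_all add: card_image)
qed

section \<open>Locally finite chains\<close>

text \<open>A chain with finite intervals and no last element is isomorphic to \<open>\<nat>\<close> or \<open>\<int>\<close>; here for the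
  order that \<open>A\<close> induces on a set \<open>S\<close>.\<close>

lemma locally_finite_index:
  assumes lin: "Linear_order A" and S: "S \<subseteq> Field A" "S \<noteq> {}"
    and fin: "\<And>x y. x \<in> S \<Longrightarrow> y \<in> S \<Longrightarrow> finite (interval A x y \<inter> S)"
    and no_max: "\<And>x. x \<in> S \<Longrightarrow> \<exists>y\<in>S. (x, y) \<in> A \<and> x \<noteq> y"
  obtains q :: "'a \<Rightarrow> int" where "q ` S = UNIV \<or> q ` S = {0..}"
    "\<And>x y. x \<in> S \<Longrightarrow> y \<in> S \<Longrightarrow> q x \<le> q y \<longleftrightarrow> (x, y) \<in> A"
proof -
  define lt where "lt x y \<longleftrightarrow> (x, y) \<in> A \<and> x \<noteq> y" for x y
  note refl = lin_refl[OF lin] and trans = lin_trans[OF lin] and anti = lin_antisym[OF lin]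
  have tot: "(x, y) \<in> A \<or> lt y x" if "x \<in> S" "y \<in> S" for x y
    using lin_total[OF lin] that S(1) refl unfolding lt_def by blast
  have lt_trans: "lt x z" if "lt x y" "lt y z" for x y z
    using that trans anti unfolding lt_def by blast
  have not_lt: "\<not> lt y x" if "(x, y) \<in> A" for x y
    using that anti unfolding lt_def by blast
  have le_lt: "lt x z" if "(x, y) \<in> A" "lt y z" for x y z
    using that trans anti unfolding lt_def by blast
  have lt_le: "lt x z" if "lt x y" "(y, z) \<in> A" for x y z
    using that trans anti unfolding lt_def by blast
  have ltD: "(x, y) \<in> A" if "lt x y" for x y
    using that by (simp add: lt_def)
  \<comment> \<open>The index is the signed number of points between a base point \<open>b\<close> and the given point. If there is a
    least point, it is taken as \<open>b\<close>.\<close>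
  have "\<exists>b\<in>S. (\<exists>m\<in>S. \<forall>x\<in>S. (m, x) \<in> A) \<longrightarrow> (\<forall>x\<in>S. (b, x) \<in> A)" using S(2) by blast
  then obtain b where b: "b \<in> S" "(\<exists>m\<in>S. \<forall>x\<in>S. (m, x) \<in> A) \<longrightarrow> (\<forall>x\<in>S. (b, x) \<in> A)" by blast
  define U where "U y = {z \<in> S. (b, z) \<in> A \<and> lt z y}" for y
  define L where "L y = {z \<in> S. (y, z) \<in> A \<and> lt z b}" for y
  define q where "q y = int (card (U y)) - int (card (L y))" for y
  have finU: "finite (U y)" "finite (L y)" if "y \<in> S" for y
  proof -
    have "U y \<subseteq> interval A b y \<inter> S" "L y \<subseteq> interval A b y \<inter> S"
      using ltD by (auto simp: U_def L_def interval_def)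
    then show "finite (U y)" "finite (L y)" using fin[OF b(1) that] finite_subset by blast+
  qed
  have emptyL: "L w = {}" if "(b, w) \<in> A" for w
  proof -
    have False if "z \<in> L w" for z
      using that trans[OF \<open>(b, w) \<in> A\<close>, of z] not_lt[of b z] by (simp add: L_def)
    then show ?thesis by blast
  qed
  have emptyU: "U w = {}" if "(w, b) \<in> A" for w
  proof -
    have False if "z \<in> U w" for z
      using that lt_le[of z w b] \<open>(w, b) \<in> A\<close> not_lt[of b z] by (simp add: U_def)
    then show ?thesis by blast
  qed
  have step: "q y' = q y + 1" if y: "y \<in> S" "y' \<in> S" "lt y y'"
    and imm: "\<And>z. z \<in> S \<Longrightarrow> (y, z) \<in> A \<Longrightarrow> lt z y' \<Longrightarrow> z = y" for y y'
  proof (cases "(b, y) \<in> A")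
    case True
    have "U y' = insert y (U y)"
    proof
      show "U y' \<subseteq> insert y (U y)"
      proof
        fix z assume "z \<in> U y'"
        then show "z \<in> insert y (U y)" using imm[of z] tot[OF y(1), of z] by (auto simp: U_def)
      qed
      show "insert y (U y) \<subseteq> U y'"
      proof
        fix z assume "z \<in> insert y (U y)"
        then show "z \<in> U y'" using True y lt_trans[of z y y'] by (auto simp: U_def)
      qed
    qed
    moreover have "y \<notin> U y" by (simp add: U_def lt_def)
    moreover have "L y = {}" "L y' = {}"
      using emptyL[OF True] emptyL[OF trans[OF True ltD[OF y(3)]]] by blast+
    ultimately show ?thesis using finU[OF y(1)] by (simp add: q_def)
  next
    case False
    then have yb: "lt y b" using tot[OF b(1) y(1)] by blast
    have "(y', b) \<in> A" using imm[OF b(1) ltD[OF yb]] yb tot[OF y(2) b(1)] by (auto simp: lt_def)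
    then have "U y = {}" "U y' = {}" using emptyU ltD[OF yb] by blast+
    moreover have "L y = insert y (L y')"
    proof
      show "L y \<subseteq> insert y (L y')"
      proof
        fix z assume "z \<in> L y"
        then show "z \<in> insert y (L y')" using imm[of z] tot[OF y(2), of z] by (auto simp: L_def)
      qed
      show "insert y (L y') \<subseteq> L y"
      proof
        fix z assume "z \<in> insert y (L y')"
        then show "z \<in> L y" using yb y S(1) refl[of y] trans[OF ltD[OF y(3)], of z]
          by (auto simp: L_def)
      qed
    qed
    moreover have "y \<notin> L y'" using not_lt y(3) by (auto simp: L_def)
    ultimately show ?thesis using finU[OF y(2)] by (simp add: q_def)
  qed
  have mono: "q x < q y" if xy: "x \<in> S" "y \<in> S" "lt x y" for x y
  proof -
    have "U x \<subseteq> U y" using lt_trans xy(3) unfolding U_def by blast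
    moreover have "L y \<subseteq> L x" using trans ltD[OF xy(3)] unfolding L_def by blast
    moreover have "x \<in> U y - U x \<or> x \<in> L x - L y"
    proof -
      have "\<not> lt x x" "\<not> (y, x) \<in> A" "(x, x) \<in> A"
        using not_lt xy refl S(1) by (auto simp: lt_def)
      then show ?thesis using tot[OF b(1) xy(1)] xy by (simp add: U_def L_def)
    qed
    ultimately have "card (U x) \<le> card (U y)" "card (L y) \<le> card (L x)"
      "card (U x) < card (U y) \<or> card (L y) < card (L x)"
      using finU[OF xy(1)] finU[OF xy(2)] by (auto intro: card_mono psubset_card_mono)
    then show ?thesis unfolding q_def by linarith
  qed
  have up: "\<exists>y'\<in>S. q y' = q y + 1" if y: "y \<in> S" for y
  proof -
    obtain z where z: "z \<in> S" "lt y z" using no_max[OF y] by (auto simp: lt_def)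
    define X where "X = {w \<in> S. lt y w \<and> (w, z) \<in> A}"
    have "X \<subseteq> interval A y z \<inter> S" using ltD by (auto simp: X_def interval_def)
    then have "finite X" by (rule finite_subset) (rule fin[OF y z(1)])
    moreover have "z \<in> X" using z S(1) refl by (auto simp: X_def)
    moreover have "X \<subseteq> Field A" using S(1) by (auto simp: X_def)
    ultimately obtain m where m: "m \<in> X" "\<And>w. w \<in> X \<Longrightarrow> (m, w) \<in> A"
      using finite_has_least[OF lin, of X] by blast
    have "w = y" if w: "w \<in> S" "(y, w) \<in> A" "lt w m" for w
    proof (rule ccontr)
      assume "w \<noteq> y"
      then have "w \<in> X" using w m(1) trans[OF ltD[OF w(3)], of z] by (simp add: X_def lt_def)
      then show False using m(2) not_lt w(3) by blast
    qed
    then have "q m = q y + 1" using step[OF y, of m] m(1) by (simp add: X_def)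
    then show ?thesis using m(1) unfolding X_def by blast
  qed
  have down: "\<exists>y'\<in>S. q y' = q y - 1" if y: "y \<in> S" "z \<in> S" "lt z y" for y z
  proof -
    define X where "X = {w \<in> S. (z, w) \<in> A \<and> lt w y}"
    have "X \<subseteq> interval A y z \<inter> S" using ltD by (auto simp: X_def interval_def)
    then have "finite X" by (rule finite_subset) (rule fin[OF y(1,2)])
    moreover have "z \<in> X" using y S(1) refl by (auto simp: X_def)
    moreover have "X \<subseteq> Field A" using S(1) by (auto simp: X_def)
    ultimately obtain m where m: "m \<in> X" "\<And>w. w \<in> X \<Longrightarrow> (w, m) \<in> A"
      using finite_has_greatest[OF lin, of X] by blast
    have "w = m" if w: "w \<in> S" "(m, w) \<in> A" "lt w y" for w
    proof -
      have "w \<in> X" using w m(1) trans[of z m w] by (simp add: X_def)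
      then show ?thesis using anti[OF m(2) w(2)] by blast
    qed
    then have "q y = q m + 1" using step[OF _ y(1), of m] m(1) by (simp add: X_def)
    then show ?thesis using m(1) unfolding X_def by force
  qed
  have ups: "\<exists>y'\<in>S. q y' = q y + int k" if "y \<in> S" for y k
  proof (induction k)
    case 0
    then show ?case using that by auto
  next
    case (Suc k)
    then obtain y' where "y' \<in> S" "q y' = q y + int k" by blast
    then show ?case using up[of y'] by (auto simp: algebra_simps)
  qed
  have qb: "q b = 0" using emptyL emptyU refl b(1) S(1) by (auto simp: q_def)
  have pos: "{0..} \<subseteq> q ` S"
  proof
    fix m :: int assume "m \<in> {0..}"
    then show "m \<in> q ` S" using ups[OF b(1), of "nat m"] qb by force
  qed
  have img: "q ` S = UNIV \<or> q ` S = {0..}"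
  proof (cases "\<exists>m\<in>S. \<forall>x\<in>S. (m, x) \<in> A")
    case True
    then have "L x = {}" if "x \<in> S" for x using emptyL b(2) that by blast
    then have "q ` S \<subseteq> {0..}" by (auto simp: q_def)
    then show ?thesis using pos by blast
  next
    case False
    have "\<exists>y'\<in>S. q y' = - int k" for k
    proof (induction k)
      case 0
      then show ?case using b qb by auto
    next
      case (Suc k)
      then obtain y where y: "y \<in> S" "q y = - int k" by blast
      then obtain z where "z \<in> S" "(y, z) \<notin> A" using False by blast
      then have "lt z y" using tot y by blast
      then show ?case using down[OF y(1) \<open>z \<in> S\<close>] y by force
    qed
    then have neg: "- int k \<in> q ` S" for k by (metis image_eqI)
    have "m \<in> q ` S" for m
      using pos neg[of "nat (- m)"] by (cases "m \<ge> 0") auto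
    then show ?thesis by blast
  qed
  have "q x \<le> q y \<longleftrightarrow> (x, y) \<in> A" if "x \<in> S" "y \<in> S" for x y
    using mono[OF that] mono[OF that(2,1)] tot[OF that] by (cases "x = y") (auto simp: lt_def)
  then show ?thesis using img that by blast
qed


section \<open>Strings and weights\<close>

lemma str_minus_simps:
  assumes "s \<in> finite_strings (Suc (Suc n))"
  shows "length s = Suc (Suc n)" "str_minus s \<in> finite_strings (Suc n)" "last s = s ! Suc n" "i \<le> n \<Longrightarrow> str_minus s ! i = s ! i"
proof -
  show l: "length s = Suc (Suc n)" using assms by (simp add: finite_strings_def)
  then show "last s = s ! Suc n" by (cases s rule: rev_cases) (auto simp: nth_append)
  show "str_minus s \<in> finite_strings (Suc n)" "i \<le> n \<Longrightarrow> str_minus s ! i = s ! i"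
    using assms unfolding finite_strings_def str_minus_def by (auto simp: nth_butlast)
qed

lemma str_plus_simps:
  assumes "s \<in> finite_strings (Suc (Suc n))"
  shows "length (str_plus s) = Suc n" "str_plus s ! n = s ! Suc n" "\<And>i. i < n \<Longrightarrow> str_plus s ! i = s ! i"
    "s ! Suc n \<noteq> Suc n \<Longrightarrow> str_plus s \<in> finite_strings (Suc n)"
    "butlast (str_plus s) = butlast (butlast s)"
proof -
  have l: "length s = Suc (Suc n)" "last s = s ! Suc n" using str_minus_simps[OF assms] by auto
  show a: "length (str_plus s) = Suc n" "str_plus s ! n = s ! Suc n"
    using l by (auto simp: str_plus_def nth_append)
  show b: "str_plus s ! i = s ! i" if "i < n" for i
    using that l by (simp add: str_plus_def nth_append nth_butlast)
  show "butlast (str_plus s) = butlast (butlast s)" by (simp add: str_plus_def)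
  show "str_plus s \<in> finite_strings (Suc n)" if "s ! Suc n \<noteq> Suc n"
    unfolding finite_strings_def
  proof (intro CollectI conjI allI impI)
    fix i assume i: "i < Suc n"
    have s: "s ! j \<le> j" if "j < Suc (Suc n)" for j using assms that by (auto simp: finite_strings_def)
    show "str_plus s ! i \<le> i"
      using i a b[of i] s[of i] s[of "Suc n"] that by (cases "i = n") auto
  qed (rule a)
qed

lemma leaves_one: "length s \<le> 1 \<Longrightarrow> leaves s k = [k]"
  by (subst leaves.simps) simp

lemma leaves_step:
  assumes "s \<in> finite_strings (Suc (Suc n))"
  shows "leaves s k = (if s ! Suc n = Suc n then leaves (str_minus s) 0
    else leaves (str_plus s) (Suc k) @ leaves (str_minus s) 0)"
  using str_minus_simps[OF assms] by (subst leaves.simps) (simp add: One_nat_def)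

text \<open>The leftmost leaf of the tree of \<open>s \<in> \<S>(n+1)\<close> is the only one that can have weight \<open>n\<close>; this
  happens iff every step towards it goes to a left child. Placing the tree below \<open>k\<close> further left steps
  only changes this weight, to \<open>n + k\<close>; \<open>shift_wt n k\<close> is this change. The weights are the positions of the
  zeros of \<open>s\<close>.\<close>

definition shift_wt :: "nat \<Rightarrow> nat \<Rightarrow> nat \<Rightarrow> nat"
  where "shift_wt n k w = (if w = n then n + k else w)"

lemma leaves_shift_and_set:
  assumes "s \<in> finite_strings (Suc n)"
  shows "leaves s k = map (shift_wt n k) (leaves s 0) \<and> set (leaves s 0) = {i. i \<le> n \<and> s ! i = 0}"
  using assms
proof (induction n arbitrary: s k)
  case 0
  then have "length s \<le> 1" "s ! 0 = 0" by (auto simp: finite_strings_def)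
  then show ?case by (auto simp: leaves_one[of s] shift_wt_def)
next
  case (Suc n)
  note m = str_minus_simps[OF Suc.prems] and p = str_plus_simps[OF Suc.prems]
  have setm: "set (leaves (str_minus s) 0) = {i. i \<le> n \<and> s ! i = 0}"
    using conjunct2[OF Suc.IH[OF m(2)]] m(4) by auto
  then have mapm: "map (shift_wt (Suc n) k) (leaves (str_minus s) 0) = leaves (str_minus s) 0" for k
    by (intro map_idI) (auto simp: shift_wt_def)
  show ?case
  proof (cases "s ! Suc n = Suc n")
    case True
    then show ?thesis using mapm setm by (auto simp: leaves_step[OF Suc.prems] le_Suc_eq)
  next
    case False
    note IH = Suc.IH[OF p(4)[OF False]]
    have setp: "set (leaves (str_plus s) 0) = {i. i \<le> n \<and> str_plus s ! i = 0}" using IH by blast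
    have "leaves (str_plus s) (Suc k) = map (shift_wt (Suc n) k) (leaves (str_plus s) (Suc 0))"
      using conjunct1[OF IH, of "Suc k"] conjunct1[OF IH, of "Suc 0"] setp
      by (auto simp: shift_wt_def)
    moreover have "set (leaves (str_plus s) (Suc 0)) \<union> {i. i \<le> n \<and> s ! i = 0} = {i. i \<le> Suc n \<and> s ! i = 0}"
    proof -
      have "set (leaves (str_plus s) (Suc 0)) = shift_wt n (Suc 0) ` {i. i \<le> n \<and> str_plus s ! i = 0}"
        using conjunct1[OF IH, of "Suc 0"] setp by (metis list.set_map)
      also have "\<dots> \<union> {i. i \<le> n \<and> s ! i = 0} = {i. i \<le> Suc n \<and> s ! i = 0}"
      proof
        show "shift_wt n (Suc 0) ` {i. i \<le> n \<and> str_plus s ! i = 0} \<union> {i. i \<le> n \<and> s ! i = 0}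
          \<subseteq> {i. i \<le> Suc n \<and> s ! i = 0}"
          using p(2,3) by (auto simp: shift_wt_def le_less)
        show "{i. i \<le> Suc n \<and> s ! i = 0} \<subseteq>
          shift_wt n (Suc 0) ` {i. i \<le> n \<and> str_plus s ! i = 0} \<union> {i. i \<le> n \<and> s ! i = 0}"
        proof
          fix i assume i: "i \<in> {i. i \<le> Suc n \<and> s ! i = 0}"
          show "i \<in> shift_wt n (Suc 0) ` {i. i \<le> n \<and> str_plus s ! i = 0} \<union> {i. i \<le> n \<and> s ! i = 0}"
          proof (cases "i = Suc n")
            case True
            then have "n \<in> {i. i \<le> n \<and> str_plus s ! i = 0}" "i = shift_wt n (Suc 0) n"
              using i p(2) by (auto simp: shift_wt_def)
            then show ?thesis by blast
          qed (use i in auto)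
        qed
      qed
      finally show ?thesis .
    qed
    ultimately show ?thesis
      using False mapm setm by (simp add: leaves_step[OF Suc.prems])
  qed
qed

lemma leaves_shift: "s \<in> finite_strings (Suc n) \<Longrightarrow> leaves s k = map (shift_wt n k) (leaves s 0)"
  using leaves_shift_and_set by blast

lemma set_leaves: "s \<in> finite_strings (Suc n) \<Longrightarrow> set (leaves s 0) = {i. i \<le> n \<and> s ! i = 0}"
  using leaves_shift_and_set by blast

lemma max_wt_eq:
  assumes "s \<in> finite_strings (Suc n)"
  shows "max_wt s = Max {i. i \<le> n \<and> s ! i = 0}"
proof -
  have "wt s ` {..<num_leaves s} = set (leaves s 0)"
    by (auto simp: wt_def num_leaves_def set_conv_nth image_iff)
  then show ?thesis by (simp add: max_wt_def set_leaves[OF assms])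
qed

section \<open>Chains given by a function of the weights\<close>

text \<open>\<open>weighted_chain s f\<close> is \<open>\<A>(s)[M]\<close> for the array whose entry at a leaf of weight \<open>w\<close> is \<open>f w\<close>. Every array
  determined by a short array is of this form.\<close>

definition weighted_chain :: "nat list \<Rightarrow> (nat \<Rightarrow> 'a rel) \<Rightarrow> 'a point rel"
  where "weighted_chain s f = arr s (map f (leaves s 0))"

lemma weighted_chain_cong:
  assumes "s \<in> finite_strings (Suc n)" "\<And>k. k \<le> n \<Longrightarrow> s ! k = 0 \<Longrightarrow> f k = g k"
  shows "weighted_chain s f = weighted_chain s g"
proof -
  have "map f (leaves s 0) = map g (leaves s 0)" using assms by (simp add: set_leaves)
  then show ?thesis unfolding weighted_chain_def by (rule arg_cong)
qed

lemma weighted_chain_one: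
  assumes "s \<in> finite_strings (Suc 0)"
  shows "weighted_chain s f = dir_image (f 0) Base"
  using assms unfolding weighted_chain_def
  by (subst arr.simps) (simp add: finite_strings_def leaves_one)

text \<open>The summands of \<open>weighted_chain s f\<close> for a string \<open>s\<close> of length at least \<open>2\<close>, and their index set. In a sum
  \<open>\<A>(s\<^sup>+)[\<dots>] + \<A>(s\<^sup>-)[\<dots>] \<nat>\<close> the first summand has index \<open>0\<close>.\<close>

definition summand :: "nat list \<Rightarrow> (nat \<Rightarrow> 'a rel) \<Rightarrow> int \<Rightarrow> 'a point rel"
  where "summand s f i = (if last s \<noteq> length s - 1 \<and> i = 0
    then weighted_chain (str_plus s) (f \<circ> shift_wt (length s - 2) (Suc 0)) else weighted_chain (str_minus s) f)"

definition summand_index :: "nat list \<Rightarrow> int set"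
  where "summand_index s = (if last s = length s - 1 then UNIV else {0..})"

lemma weighted_chain_step:
  assumes "s \<in> finite_strings (Suc (Suc n))"
  shows "last s = length s - 1 \<Longrightarrow>
      weighted_chain s f = dir_image (chain_prod (summand s f 0) int_chain) Prod"
    "last s \<noteq> length s - 1 \<Longrightarrow>
      weighted_chain s f = dir_image (chain_sum (summand s f 0) (chain_prod (summand s f 1) nat_chain)) Sum"
proof -
  note m = str_minus_simps[OF assms] and p = str_plus_simps[OF assms]
  {
    assume "last s = length s - 1"
    then show "weighted_chain s f = dir_image (chain_prod (summand s f 0) int_chain) Prod"
      using m unfolding weighted_chain_def summand_def
      by (subst arr.simps) (simp add: leaves_step[OF assms])
  next
    assume l: "last s \<noteq> length s - 1"
    let ?sp = "str_plus s"
    have sp: "?sp \<in> finite_strings (Suc n)" using p(4) l m by simp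
    have "map f (leaves s 0) = map (f \<circ> shift_wt n (Suc 0)) (leaves ?sp 0) @ map f (leaves (str_minus s) 0)"
      using l m leaves_shift[OF sp, of "Suc 0"] by (simp add: leaves_step[OF assms])
    moreover have "num_leaves ?sp = length (leaves ?sp 0)" by (simp add: num_leaves_def)
    ultimately show "weighted_chain s f =
        dir_image (chain_sum (summand s f 0) (chain_prod (summand s f 1) nat_chain)) Sum"
      using m l unfolding weighted_chain_def summand_def
      by (subst arr.simps) simp
  }
qed

lemma Field_chain_prod: "Linear_order A \<Longrightarrow> Linear_order B \<Longrightarrow> Field (chain_prod A B) = Field A \<times> Field B"
proof
  show "Field (chain_prod A B) \<subseteq> Field A \<times> Field B"
    unfolding Field_def[of "chain_prod A B"] by (auto simp: chain_prod_def)
  assume "Linear_order A" "Linear_order B"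
  then have "((a, b), (a, b)) \<in> chain_prod A B" if "a \<in> Field A" "b \<in> Field B" for a b
    using that lin_refl[of A] by (simp add: chain_prod_def)
  then show "Field A \<times> Field B \<subseteq> Field (chain_prod A B)" by (auto intro: lin_Field)
qed

lemma Linear_order_chain_prod:
  assumes A: "Linear_order A" and B: "Linear_order B"
  shows "Linear_order (chain_prod A B)"
proof (rule Linear_orderI)
  fix x assume "x \<in> Field (chain_prod A B)"
  then show "(x, x) \<in> chain_prod A B"
    unfolding Field_chain_prod[OF A B] using lin_refl[OF A] by (auto simp: chain_prod_def)
next
  fix x y z assume "(x, y) \<in> chain_prod A B" "(y, z) \<in> chain_prod A B"
  then show "(x, z) \<in> chain_prod A B"
    using lin_trans[OF A] lin_trans[OF B] lin_antisym[OF B] unfolding chain_prod_def by auto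
next
  fix x y assume "(x, y) \<in> chain_prod A B" "(y, x) \<in> chain_prod A B"
  then show "x = y" using lin_antisym[OF A] lin_antisym[OF B] unfolding chain_prod_def by auto
next
  fix x y assume "x \<in> Field (chain_prod A B)" "y \<in> Field (chain_prod A B)"
  then show "(x, y) \<in> chain_prod A B \<or> (y, x) \<in> chain_prod A B"
    unfolding Field_chain_prod[OF A B] using lin_total[OF A, of "fst x" "fst y"] lin_total[OF B, of "snd x" "snd y"]
    by (auto simp: chain_prod_def)
qed

lemma Field_chain_sum:
  "Linear_order A \<Longrightarrow> Linear_order B \<Longrightarrow> Field (chain_sum A B) = Inl ` Field A \<union> Inr ` Field B"
proof
  show "Field (chain_sum A B) \<subseteq> Inl ` Field A \<union> Inr ` Field B"
    unfolding Field_def[of "chain_sum A B"] by (auto simp: chain_sum_def dest: lin_Field)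
  assume A: "Linear_order A" and B: "Linear_order B"
  have "Inl a \<in> Field (chain_sum A B)" if "a \<in> Field A" for a
    by (rule lin_Field(1)[of _ "Inl a"]) (use that lin_refl[OF A] in \<open>simp add: chain_sum_def\<close>)
  moreover have "Inr b \<in> Field (chain_sum A B)" if "b \<in> Field B" for b
    by (rule lin_Field(1)[of _ "Inr b"]) (use that lin_refl[OF B] in \<open>simp add: chain_sum_def\<close>)
  ultimately show "Inl ` Field A \<union> Inr ` Field B \<subseteq> Field (chain_sum A B)" by blast
qed

lemma chain_sum_simps:
  "(Inl a, Inl b) \<in> chain_sum A B \<longleftrightarrow> (a, b) \<in> A"
  "(Inr c, Inr d) \<in> chain_sum A B \<longleftrightarrow> (c, d) \<in> B"
  "(Inl a, Inr d) \<in> chain_sum A B \<longleftrightarrow> a \<in> Field A \<and> d \<in> Field B"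
  "(Inr d, Inl a) \<notin> chain_sum A B"
  by (auto simp: chain_sum_def)

lemma Linear_order_chain_sum:
  assumes A: "Linear_order A" and B: "Linear_order B"
  shows "Linear_order (chain_sum A B)"
proof (rule Linear_orderI)
  fix x assume "x \<in> Field (chain_sum A B)"
  then show "(x, x) \<in> chain_sum A B"
    unfolding Field_chain_sum[OF A B] using lin_refl[OF A] lin_refl[OF B] by (auto simp: chain_sum_def)
next
  fix x y z assume "(x, y) \<in> chain_sum A B" "(y, z) \<in> chain_sum A B"
  then show "(x, z) \<in> chain_sum A B"
    by (cases x; cases y; cases z)
      (auto simp: chain_sum_simps lin_Field intro: lin_trans[OF A] lin_trans[OF B])
next
  fix x y assume "(x, y) \<in> chain_sum A B" "(y, x) \<in> chain_sum A B"
  then show "x = y" 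
    by (cases x; cases y) (auto simp: chain_sum_simps dest: lin_antisym[OF A] lin_antisym[OF B])
next
  fix x y assume "x \<in> Field (chain_sum A B)" "y \<in> Field (chain_sum A B)"
  then show "(x, y) \<in> chain_sum A B \<or> (y, x) \<in> chain_sum A B"
    unfolding Field_chain_sum[OF A B]
    by (cases x; cases y) (auto simp: chain_sum_simps dest: lin_total[OF A] lin_total[OF B])
qed

lemma nat_int_chain: "Linear_order nat_chain" "Linear_order int_chain" "Field nat_chain = UNIV" "Field int_chain = UNIV"
proof -
  show F: "Field nat_chain = UNIV" "Field int_chain = UNIV"
    by (auto simp: nat_chain_def int_chain_def Field_def)
  show "Linear_order nat_chain" "Linear_order int_chain"
    by (auto intro!: Linear_orderI simp: nat_chain_def int_chain_def)
qed

lemma iso_dir_image: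
  assumes "inj f"
  shows "iso A (dir_image A f) f"
  using assms unfolding iso_bij_order dir_image_Field
  by (auto simp: bij_betw_def dir_image_def inj_eq intro: inj_on_subset)

lemma inj_point: "inj Base" "inj Prod" "inj Sum"
  by (auto intro: injI)

lemma dir_image_inj_iff: "inj f \<Longrightarrow> (f x, f y) \<in> dir_image A f \<longleftrightarrow> (x, y) \<in> A"
  by (auto simp: dir_image_def inj_eq)

text \<open>The index of the summand of \<open>\<A>(s)[M]\<close> that contains a given point, in the block decomposition
  given by the recursive definition.\<close>

fun block_index :: "'a point \<Rightarrow> int" where
  "block_index (Base _) = 0"
| "block_index (Prod (_, i)) = i"
| "block_index (Sum (Inl _)) = 0"
| "block_index (Sum (Inr (_, m))) = int m + 1"

lemma isoI_block:
  assumes B: "Linear_order B" and f: "f ` Field A = {x \<in> Field B. p x = i}"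
    and o: "\<And>a b. a \<in> Field A \<Longrightarrow> b \<in> Field A \<Longrightarrow> (a, b) \<in> A \<longleftrightarrow> (f a, f b) \<in> B" and A: "Linear_order A"
  shows "block B p i \<cong>\<^sub>c A"
proof -
  have "inj_on f (Field A)"
    by (rule inj_onI) (metis o lin_antisym[OF A] lin_refl[OF A])
  moreover have "p (f a) = i" if "a \<in> Field A" for a using f that by blast
  ultimately have "iso A (block B p i) f"
    using o f by (simp add: iso_bij_order bij_betw_def Field_block[OF B]) (simp add: block_def)
  then show ?thesis using chain_iso_sym chain_iso_def by blast
qed

lemma weighted_chain_blocks:
  assumes s: "s \<in> finite_strings (Suc (Suc n))"
    and sub: "\<And>i. i \<in> summand_index s \<Longrightarrow> Linear_order (summand s f i) \<and> Field (summand s f i) \<noteq> {}"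
  shows "blocks (weighted_chain s f) block_index (summand_index s)"
    "i \<in> summand_index s \<Longrightarrow> block (weighted_chain s f) block_index i \<cong>\<^sub>c summand s f i"
proof -
  let ?B = "weighted_chain s f"
  have "blocks ?B block_index (summand_index s) \<and>
    (\<forall>i\<in>summand_index s. block ?B block_index i \<cong>\<^sub>c summand s f i)"
  proof (cases "last s = length s - 1")
    case True
    define Y where "Y = summand s f 0"
    have I: "summand_index s = UNIV" using True by (simp add: summand_index_def)
    have Y: "summand s f i = Y" for i using True by (simp add: summand_def Y_def)
    have lY: "Linear_order Y" "Field Y \<noteq> {}" using sub[of 0] I by (simp_all add: Y)
    have B: "?B = dir_image (chain_prod Y int_chain) Prod"
      using weighted_chain_step(1)[OF s True, of f] unfolding Y .
    have lP: "Linear_order (chain_prod Y int_chain)"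
      using Linear_order_chain_prod[OF lY(1) nat_int_chain(2)] .
    have lB: "Linear_order ?B" using Linear_order_iso[OF iso_dir_image[OF inj_point(2)] lP] B by simp
    have F: "Field ?B = Prod ` (Field Y \<times> UNIV)"
      by (simp add: B dir_image_Field Field_chain_prod[OF lY(1) nat_int_chain(2)] nat_int_chain(4))
    have o: "(Prod (a, i), Prod (b, j)) \<in> ?B \<longleftrightarrow>
        a \<in> Field Y \<and> b \<in> Field Y \<and> (i < j \<or> i = j \<and> (a, b) \<in> Y)" for a b i j
      unfolding B dir_image_inj_iff[OF inj_point(2)]
      by (auto simp: chain_prod_def nat_int_chain) (auto simp: int_chain_def)
    have "block_index ` Field ?B = UNIV"
    proof -
      obtain a where "a \<in> Field Y" using lY by blast
      then have "i \<in> block_index ` Field ?B" for i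
        unfolding F by (intro image_eqI[of _ _ "Prod (a, i)"]) auto
      then show ?thesis by blast
    qed
    moreover have "block_index x \<le> block_index y" if "(x, y) \<in> ?B" for x y
    proof -
      have "x \<in> Field ?B" "y \<in> Field ?B" using that by (auto dest: lin_Field)
      then show ?thesis using that unfolding F by (auto simp: o)
    qed
    ultimately have "blocks ?B block_index (summand_index s)" using lB I by (simp add: blocks_def)
    moreover have "block ?B block_index i \<cong>\<^sub>c Y" for i
    proof (rule isoI_block[OF lB _ _ lY(1), of "\<lambda>a. Prod (a, i)"])
      show "(\<lambda>a. Prod (a, i)) ` Field Y = {x \<in> Field ?B. block_index x = i}" unfolding F by auto
    qed (simp add: o)
    ultimately show ?thesis by (simp add: Y)
  next
    case False
    define X Y where "X = summand s f 0" and "Y = summand s f 1"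
    have I: "summand_index s = {0..}" using False by (simp add: summand_index_def)
    have Y: "summand s f i = Y" if "i \<noteq> 0" for i using that by (simp add: summand_def Y_def)
    have lX: "Linear_order X" "Field X \<noteq> {}" using sub[of 0] I by (simp_all add: X_def)
    have lY: "Linear_order Y" "Field Y \<noteq> {}" using sub[of 1] I by (simp_all add: Y_def)
    let ?C = "chain_prod Y nat_chain"
    have B: "?B = dir_image (chain_sum X ?C) Sum"
      using weighted_chain_step(2)[OF s False, of f] unfolding X_def Y_def .
    have lC: "Linear_order ?C" using Linear_order_chain_prod[OF lY(1) nat_int_chain(1)] .
    have lB: "Linear_order ?B"
      using Linear_order_iso[OF iso_dir_image[OF inj_point(3)] Linear_order_chain_sum[OF lX(1) lC]] B by simp
    have FC: "Field ?C = Field Y \<times> UNIV"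
      by (simp add: Field_chain_prod[OF lY(1) nat_int_chain(1)] nat_int_chain)
    have F: "Field ?B = Sum ` (Inl ` Field X \<union> Inr ` (Field Y \<times> UNIV))"
      by (simp add: B dir_image_Field Field_chain_sum[OF lX(1) lC] FC)
    have o: "(Sum (Inl a), Sum (Inl b)) \<in> ?B \<longleftrightarrow> (a, b) \<in> X"
      "(Sum (Inr (c, i)), Sum (Inr (d, j))) \<in> ?B \<longleftrightarrow>
        c \<in> Field Y \<and> d \<in> Field Y \<and> (i < j \<or> i = j \<and> (c, d) \<in> Y)"
      "(Sum (Inr (c, i)), Sum (Inl a)) \<notin> ?B" for a b c d i j
    proof -
      show "(Sum (Inl a), Sum (Inl b)) \<in> ?B \<longleftrightarrow> (a, b) \<in> X"
        "(Sum (Inr (c, i)), Sum (Inl a)) \<notin> ?B"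
        unfolding B dir_image_inj_iff[OF inj_point(3)] by (auto simp: chain_sum_def)
      have "(Sum (Inr (c, i)), Sum (Inr (d, j))) \<in> ?B \<longleftrightarrow> ((c, i), (d, j)) \<in> ?C"
        unfolding B dir_image_inj_iff[OF inj_point(3)] by (auto simp: chain_sum_def)
      then show "(Sum (Inr (c, i)), Sum (Inr (d, j))) \<in> ?B \<longleftrightarrow>
        c \<in> Field Y \<and> d \<in> Field Y \<and> (i < j \<or> i = j \<and> (c, d) \<in> Y)"
        by (auto simp: chain_prod_def nat_int_chain) (auto simp: nat_chain_def)
    qed
    have "block_index ` Field ?B = {0..}"
    proof
      show "block_index ` Field ?B \<subseteq> {0..}" unfolding F by auto
      show "{0..} \<subseteq> block_index ` Field ?B"
      proof
        fix i :: int assume i: "i \<in> {0..}"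
        obtain a b where ab: "a \<in> Field X" "b \<in> Field Y" using lX lY by blast
        show "i \<in> block_index ` Field ?B"
        proof (cases "i = 0")
          case True
          then show ?thesis unfolding F using ab by (intro image_eqI[of _ _ "Sum (Inl a)"]) auto
        next
          case False
          then show ?thesis unfolding F using ab i
            by (intro image_eqI[of _ _ "Sum (Inr (b, nat (i - 1)))"]) auto
        qed
      qed
    qed
    moreover have "block_index x \<le> block_index y" if "(x, y) \<in> ?B" for x y
    proof -
      have "x \<in> Field ?B" "y \<in> Field ?B" using that by (auto dest: lin_Field)
      then show ?thesis using that unfolding F by (auto simp: o)
    qed
    ultimately have "blocks ?B block_index (summand_index s)" using lB I by (simp add: blocks_def)
    moreover have "block ?B block_index 0 \<cong>\<^sub>c X"
    proof (rule isoI_block[OF lB _ _ lX(1), of "\<lambda>a. Sum (Inl a)"])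
      show "(\<lambda>a. Sum (Inl a)) ` Field X = {x \<in> Field ?B. block_index x = 0}" unfolding F by auto
    qed (simp add: o)
    moreover have "block ?B block_index i \<cong>\<^sub>c Y" if "i > 0" for i
    proof (rule isoI_block[OF lB _ _ lY(1), of "\<lambda>a. Sum (Inr (a, nat (i - 1)))"])
      show "(\<lambda>a. Sum (Inr (a, nat (i - 1)))) ` Field Y = {x \<in> Field ?B. block_index x = i}"
        unfolding F using that by force
    qed (simp add: o)
    ultimately show ?thesis using I X_def Y by (metis atLeast_iff order_le_less)
  qed
  then show "blocks ?B block_index (summand_index s)"
    "i \<in> summand_index s \<Longrightarrow> block ?B block_index i \<cong>\<^sub>c summand s f i" by blast+
qed

text \<open>Each summand is again of the form \<open>weighted_chain t g\<close>, where \<open>t\<close> and \<open>g\<close> differ from \<open>s\<close> and \<open>f\<close> only at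
  the last position and the greatest weight.\<close>

lemma summand_cases:
  assumes s: "s \<in> finite_strings (Suc (Suc n))"
  obtains t g where "summand s f i = weighted_chain t g" "t \<in> finite_strings (Suc n)" "butlast t = butlast (butlast s)"
    "\<And>k. k < n \<Longrightarrow> t ! k = s ! k" "\<And>k. k < n \<Longrightarrow> g k = f k"
    "\<And>k. k \<le> n \<Longrightarrow> t ! k = 0 \<Longrightarrow> \<exists>k'\<le>Suc n. s ! k' = 0 \<and> g k = f k'"
proof (cases "last s \<noteq> length s - 1 \<and> i = 0")
  case True
  note m = str_minus_simps[OF s] and p = str_plus_simps[OF s]
  show ?thesis
  proof (rule that[of "str_plus s" "f \<circ> shift_wt n (Suc 0)"])
    show "summand s f i = weighted_chain (str_plus s) (f \<circ> shift_wt n (Suc 0))"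
      using True m by (simp add: summand_def)
    show "str_plus s \<in> finite_strings (Suc n)" using True m p by simp
    show "butlast (str_plus s) = butlast (butlast s)" by (rule p)
    show "str_plus s ! k = s ! k" "(f \<circ> shift_wt n (Suc 0)) k = f k" if "k < n" for k
      using that p by (auto simp: shift_wt_def)
    fix k assume k: "k \<le> n" "str_plus s ! k = 0"
    show "\<exists>k'\<le>Suc n. s ! k' = 0 \<and> (f \<circ> shift_wt n (Suc 0)) k = f k'"
    proof (cases "k = n")
      case True
      then show ?thesis using k p by (intro exI[of _ "Suc n"]) (simp add: shift_wt_def)
    next
      case False
      then show ?thesis using k p by (intro exI[of _ k]) (simp add: shift_wt_def)
    qed
  qed
next
  case False
  note m = str_minus_simps[OF s]
  show ?thesis
  proof (rule that[of "str_minus s" f])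
    show "summand s f i = weighted_chain (str_minus s) f" unfolding summand_def using False by (simp only: if_False)
    show "\<exists>k'\<le>Suc n. s ! k' = 0 \<and> f k = f k'" if "k \<le> n" "str_minus s ! k = 0" for k
      using that m by (intro exI[of _ k]) simp
  qed (use m in \<open>auto simp: str_minus_def\<close>)
qed

section \<open>Uniformity of the chains over \<open>\<omega>\<close>\<close>

text \<open>A family of chains that may be the entries of a short array.\<close>

definition short_set :: "'a rel set \<Rightarrow> bool"
  where "short_set G \<longleftrightarrow> (\<forall>X\<in>G. uniform X \<and> has_rank X (omega_plus 0)) \<and> (\<forall>X\<in>G. \<forall>Y\<in>G. tails_iso X Y)"

text \<open>Up to isomorphism, the tails of \<open>\<A>(s)[M]\<close> depend neither on the last entry of \<open>s \<in> \<S>(n+1)\<close> nor on the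
  entry of weight \<open>n\<close> in \<open>M\<close>. The case of equal strings and arrays gives uniformity.\<close>

lemma weighted_chain_tails:
  assumes "short_set G" "s \<in> finite_strings (Suc n)" "s' \<in> finite_strings (Suc n)" "butlast s = butlast s'"
    and "\<And>k. k < n \<Longrightarrow> s ! k = 0 \<Longrightarrow> f k = f' k"
    and "\<And>k. k \<le> n \<Longrightarrow> s ! k = 0 \<Longrightarrow> f k \<in> G" "\<And>k. k \<le> n \<Longrightarrow> s' ! k = 0 \<Longrightarrow> f' k \<in> G"
  shows "Linear_order (weighted_chain s f) \<and> has_rank (weighted_chain s f) (omega_plus n) \<and>
    tails_iso (weighted_chain s f) (weighted_chain s' f')"
  using assms(2-)
proof (induction n arbitrary: s s' f f')
  case 0
  have z: "s ! 0 = 0" "s' ! 0 = 0" using 0 by (auto simp: finite_strings_def)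
  then have G: "f 0 \<in> G" "f' 0 \<in> G" using 0 by auto
  have i: "weighted_chain s f \<cong>\<^sub>c f 0" "weighted_chain s' f' \<cong>\<^sub>c f' 0"
    using 0 weighted_chain_one iso_dir_image[OF inj_point(1)] chain_iso_sym unfolding chain_iso_def
    by metis+
  have u: "uniform (f 0)" "uniform (f' 0)" "has_rank (f 0) (omega_plus 0)" "tails_iso (f 0) (f' 0)"
    using G assms(1) by (auto simp: short_set_def)
  have l: "Linear_order (weighted_chain s f)" "Linear_order (weighted_chain s' f')"
    using uniform_iso[OF i(1) u(1)] uniform_iso[OF i(2) u(2)] by (auto simp: uniform_def)
  show ?case using l has_rank_iso[OF i(1) l(1) u(3)] tails_iso_cong[OF i l u(4)] by blast
next
  case (Suc n)
  have sub: "uniform (summand s f i) \<and> has_rank (summand s f i) (omega_plus n)"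
    if s: "s \<in> finite_strings (Suc (Suc n))" and fG: "\<And>k. k \<le> Suc n \<Longrightarrow> s ! k = 0 \<Longrightarrow> f k \<in> G" for s f i
  proof -
    obtain t g where t: "summand s f i = weighted_chain t g" "t \<in> finite_strings (Suc n)"
      "\<And>k. k \<le> n \<Longrightarrow> t ! k = 0 \<Longrightarrow> \<exists>k'\<le>Suc n. s ! k' = 0 \<and> g k = f k'"
      by (rule summand_cases[OF s, of f i]) (rule that)
    have "g k \<in> G" if "k \<le> n" "t ! k = 0" for k using t(3)[OF that] fG by auto
    then show ?thesis using Suc.IH[OF t(2) t(2), of g g] t(1) by (simp add: uniform_iff)
  qed
  have tl: "tails_iso (summand s f i) (summand s' f' j)" for i j
  proof -
    obtain t g where t: "summand s f i = weighted_chain t g" "t \<in> finite_strings (Suc n)"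
      "butlast t = butlast (butlast s)" "\<And>k. k < n \<Longrightarrow> t ! k = s ! k" "\<And>k. k < n \<Longrightarrow> g k = f k"
      "\<And>k. k \<le> n \<Longrightarrow> t ! k = 0 \<Longrightarrow> \<exists>k'\<le>Suc n. s ! k' = 0 \<and> g k = f k'"
      by (rule summand_cases[OF Suc.prems(1), of f i]) (rule that)
    obtain t' g' where t': "summand s' f' j = weighted_chain t' g'" "t' \<in> finite_strings (Suc n)"
      "butlast t' = butlast (butlast s')" "\<And>k. k < n \<Longrightarrow> t' ! k = s' ! k" "\<And>k. k < n \<Longrightarrow> g' k = f' k"
      "\<And>k. k \<le> n \<Longrightarrow> t' ! k = 0 \<Longrightarrow> \<exists>k'\<le>Suc n. s' ! k' = 0 \<and> g' k = f' k'"
      by (rule summand_cases[OF Suc.prems(2), of f' j]) (rule that)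
    have "g k \<in> G" if "k \<le> n" "t ! k = 0" for k using t(6)[OF that] Suc.prems(5) by auto
    moreover have "g' k \<in> G" if "k \<le> n" "t' ! k = 0" for k using t'(6)[OF that] Suc.prems(6) by auto
    moreover have "butlast t = butlast t'" using t(3) t'(3) Suc.prems(3) by simp
    moreover have "g k = g' k" if "k < n" "t ! k = 0" for k
      using that t(4,5) t'(5) Suc.prems(4)[of k] by simp
    ultimately show ?thesis using Suc.IH[OF t(2) t'(2), of g g'] t(1) t'(1) by simp
  qed
  let ?B = "weighted_chain s f" and ?B' = "weighted_chain s' f'"
  have sf: "uniform (summand s f i) \<and> has_rank (summand s f i) (omega_plus n)"
    and sf': "uniform (summand s' f' i) \<and> has_rank (summand s' f' i) (omega_plus n)" for i
    by (rule sub; fact Suc.prems)+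
  have lin: "Linear_order (summand s f i) \<and> Field (summand s f i) \<noteq> {}"
    "Linear_order (summand s' f' i) \<and> Field (summand s' f' i) \<noteq> {}" for i
    using sf[of i] sf'[of i] has_rankD(1) unfolding uniform_def by blast+
  note b = weighted_chain_blocks[OF Suc.prems(1) lin(1)] and b' = weighted_chain_blocks[OF Suc.prems(2) lin(2)]
  have lB: "Linear_order ?B" "Linear_order ?B'" using b b' by (simp_all add: blocks_def)
  note lb = Linear_order_block[OF lB(1), of block_index] Linear_order_block[OF lB(2), of block_index]
  have up: "i + m \<in> summand_index s" if "i \<in> summand_index s" "m \<ge> 0" for i m s
    using that by (auto simp: summand_index_def split: if_splits)
  have "uniform (block ?B block_index i) \<and> has_rank (block ?B block_index i) (omega_plus n)"
    if "i \<in> summand_index s" for i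
    using b(2)[OF that] sf[of i] uniform_iso has_rank_iso[OF _ lb(1)] by blast
  then have "has_rank ?B (omega_plus (Suc n))"
    by (intro blocks_has_rank[OF b(1)]) (auto simp: summand_index_def)
  moreover have "tails_iso ?B ?B'"
    unfolding tails_iso_def
  proof (intro ballI)
    fix x y assume xy: "x \<in> Field ?B" "y \<in> Field ?B'"
    have I: "block_index x \<in> summand_index s" "block_index y \<in> summand_index s'"
      using b(1) b'(1) xy by (auto simp: blocks_def)
    show "tail ?B x \<cong>\<^sub>c tail ?B' y"
    proof (rule tail_blocks_iso[OF b(1) up[OF I(1)] xy(1) b'(1) up[OF I(2)] xy(2)])
      show "tail (block ?B block_index (block_index x)) x \<cong>\<^sub>c tail (block ?B' block_index (block_index y)) y"
        using tails_iso_cong[OF b(2)[OF I(1)] b'(2)[OF I(2)] lb tl] xy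
        by (simp add: tails_iso_def Field_block lB)
      fix m :: int assume m: "m > 0"
      have "str_minus s = str_minus s'" using Suc.prems(3) by (simp add: str_minus_def)
      moreover have "weighted_chain (str_minus s) f = weighted_chain (str_minus s) f'"
        by (rule weighted_chain_cong[OF str_minus_simps(2)[OF Suc.prems(1)]])
          (use str_minus_simps(4)[OF Suc.prems(1)] Suc.prems(4) in auto)
      moreover have "summand s f (i + m) = weighted_chain (str_minus s) f" if "i \<in> summand_index s" for i s and f :: "nat \<Rightarrow> 'a rel"
        using that m by (auto simp: summand_def summand_index_def split: if_splits)
      ultimately have "summand s f (block_index x + m) = summand s' f' (block_index y + m)"
        using I by simp
      then show "block ?B block_index (block_index x + m) \<cong>\<^sub>c block ?B' block_index (block_index y + m)"
        using b(2)[OF up[OF I(1)], of m] b'(2)[OF up[OF I(2)], of m] m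
        by (metis chain_iso_sym chain_iso_trans less_imp_le)
    qed
  qed
  ultimately show ?case using lB by blast
qed

lemma weighted_chain_uniform:
  assumes "short_set G" "s \<in> finite_strings (Suc n)" "\<And>k. k \<le> n \<Longrightarrow> s ! k = 0 \<Longrightarrow> f k \<in> G"
  shows "uniform (weighted_chain s f)" "has_rank (weighted_chain s f) (omega_plus n)"
  using weighted_chain_tails[OF assms(1,2,2), of f f] assms(3) by (auto simp: uniform_iff)

lemma summand_uniform:
  assumes "short_set G" and s: "s \<in> finite_strings (Suc (Suc n))" and "\<And>k. k \<le> Suc n \<Longrightarrow> s ! k = 0 \<Longrightarrow> f k \<in> G"
  shows "uniform (summand s f i)" "has_rank (summand s f i) (omega_plus n)"
proof -
  obtain t g where t: "summand s f i = weighted_chain t g" "t \<in> finite_strings (Suc n)"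
    "\<And>k. k \<le> n \<Longrightarrow> t ! k = 0 \<Longrightarrow> \<exists>k'\<le>Suc n. s ! k' = 0 \<and> g k = f k'"
    by (rule summand_cases[OF s, of f i]) (rule that)
  have "g k \<in> G" if "k \<le> n" "t ! k = 0" for k using t(3)[OF that] assms(3) by auto
  then show "uniform (summand s f i)" "has_rank (summand s f i) (omega_plus n)"
    using weighted_chain_uniform[OF assms(1) t(2), of g] t(1) by auto
qed


section \<open>Derived sequences\<close>

lemma next_pos_simps:
  "\<pi> n = 0 \<Longrightarrow> next_pos \<pi> (Suc n) = next_pos \<pi> n"
  "0 < \<pi> n \<Longrightarrow> next_pos \<pi> n = enat n"
proof -
  assume z: "\<pi> n = 0"
  then have eq: "(n \<le> v \<and> \<pi> v > 0) \<longleftrightarrow> (Suc n \<le> v \<and> \<pi> v > 0)" for v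
    by (cases "v = n") auto
  then have "(\<exists>v\<ge>n. \<pi> v > 0) \<longleftrightarrow> (\<exists>v\<ge>Suc n. \<pi> v > 0)" by blast
  then show "next_pos \<pi> (Suc n) = next_pos \<pi> n" unfolding next_pos_def eq by simp
next
  assume p: "0 < \<pi> n"
  then have "(LEAST v. n \<le> v \<and> 0 < \<pi> v) = n" by (intro Least_equality) auto
  then show "next_pos \<pi> n = enat n" using p by (auto simp: next_pos_def)
qed

lemma derived_nth:
  "i < n \<Longrightarrow> derived \<sigma> \<pi> n ! i = the_enat (\<sigma> (enat i))"
  "derived \<sigma> \<pi> n ! n = the_enat (\<sigma> (next_pos \<pi> n))"
  "length (derived \<sigma> \<pi> n) = Suc n"
  by (auto simp: derived_def nth_append)

lemma derived_step_nth:
  "i < n \<Longrightarrow> derived \<sigma> \<pi> (Suc n) ! i = derived \<sigma> \<pi> n ! i"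
  "\<pi> n = 0 \<Longrightarrow> derived \<sigma> \<pi> (Suc n) ! Suc n = derived \<sigma> \<pi> n ! n"
  "0 < \<pi> n \<Longrightarrow> derived \<sigma> \<pi> (Suc n) ! n = derived \<sigma> \<pi> n ! n"
  by (simp_all add: derived_nth next_pos_simps)

lemma derived_plus: "\<pi> n = 0 \<Longrightarrow> str_plus (derived \<sigma> \<pi> (Suc n)) = derived \<sigma> \<pi> n"
  by (simp add: derived_def str_plus_def next_pos_simps butlast_append)

lemma derived_minus: "0 < \<pi> n \<Longrightarrow> str_minus (derived \<sigma> \<pi> (Suc n)) = derived \<sigma> \<pi> n"
  by (simp add: derived_def str_minus_def next_pos_simps butlast_append)

lemma derived_top_iff:
  assumes "compatible \<sigma> \<pi>"
  shows "derived \<sigma> \<pi> (Suc n) ! Suc n = Suc n \<longleftrightarrow> \<pi> n = \<infinity>"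
proof -
  have c: "\<sigma> (next_pos \<pi> (Suc n)) \<le> enat (Suc n)" "\<sigma> (next_pos \<pi> (Suc n)) = enat (Suc n) \<longleftrightarrow> \<pi> n = \<infinity>"
    using assms unfolding compatible_def by blast+
  then show ?thesis by (cases "\<sigma> (next_pos \<pi> (Suc n))") (auto simp: derived_nth)
qed

lemma leaves_derived_Suc:
  assumes c: "compatible \<sigma> \<pi>"
  shows "\<pi> n = \<infinity> \<Longrightarrow> leaves (derived \<sigma> \<pi> (Suc n)) 0 = leaves (derived \<sigma> \<pi> n) 0"
    "\<pi> n = 0 \<Longrightarrow> leaves (derived \<sigma> \<pi> (Suc n)) 0 =
      map (shift_wt n (Suc 0)) (leaves (derived \<sigma> \<pi> n) 0) @ leaves (str_minus (derived \<sigma> \<pi> (Suc n))) 0"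
    "0 < \<pi> n \<Longrightarrow> \<pi> n < \<infinity> \<Longrightarrow> leaves (derived \<sigma> \<pi> (Suc n)) 0 =
      map (shift_wt n (Suc 0)) (leaves (str_plus (derived \<sigma> \<pi> (Suc n))) 0) @ leaves (derived \<sigma> \<pi> n) 0"
proof -
  note S = derived_finite_strings[OF c, of "Suc n"] and S0 = derived_finite_strings[OF c, of n]
  note st = leaves_step[OF S, of 0] and t = derived_top_iff[OF c, of n]
  show "leaves (derived \<sigma> \<pi> (Suc n)) 0 = leaves (derived \<sigma> \<pi> n) 0" if "\<pi> n = \<infinity>"
    using st t that derived_minus[of \<pi> n \<sigma>] by simp
  show "leaves (derived \<sigma> \<pi> (Suc n)) 0 =
      map (shift_wt n (Suc 0)) (leaves (derived \<sigma> \<pi> n) 0) @ leaves (str_minus (derived \<sigma> \<pi> (Suc n))) 0"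
    if "\<pi> n = 0"
    using st t that derived_plus[of \<pi> n \<sigma>, OF that] leaves_shift[OF S0, of "Suc 0"] by simp
  assume p: "0 < \<pi> n" "\<pi> n < \<infinity>"
  then have "derived \<sigma> \<pi> (Suc n) ! Suc n \<noteq> Suc n" using t by auto
  then show "leaves (derived \<sigma> \<pi> (Suc n)) 0 =
      map (shift_wt n (Suc 0)) (leaves (str_plus (derived \<sigma> \<pi> (Suc n))) 0) @ leaves (derived \<sigma> \<pi> n) 0"
    using st derived_minus[of \<pi> n \<sigma>, OF p(1)] leaves_shift[OF str_plus_simps(4)[OF S], of "Suc 0"] by simp
qed

section \<open>New stages\<close>

context
  fixes \<sigma> :: "enat \<Rightarrow> enat" and \<pi> :: "nat \<Rightarrow> enat"
begin

lemma stage_new: "k \<in> index_set \<sigma> \<pi> \<Longrightarrow> new_stage \<sigma> \<pi> (stage \<sigma> \<pi> k)"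
  using finite_enumerate_in_set[of "{m. new_stage \<sigma> \<pi> m}" k] enumerate_in_set[of "{m. new_stage \<sigma> \<pi> m}" k]
  by (cases "finite {m. new_stage \<sigma> \<pi> m}") (auto simp: index_set_def stage_def)

lemma stage_strict_mono: "k' \<in> index_set \<sigma> \<pi> \<Longrightarrow> k < k' \<Longrightarrow> stage \<sigma> \<pi> k < stage \<sigma> \<pi> k'"
  using finite_enumerate_mono[of k k' "{m. new_stage \<sigma> \<pi> m}"] enumerate_mono[of k k' "{m. new_stage \<sigma> \<pi> m}"]
  by (cases "finite {m. new_stage \<sigma> \<pi> m}") (auto simp: index_set_def stage_def)

lemma new_stage_ex: "new_stage \<sigma> \<pi> m \<Longrightarrow> \<exists>k\<in>index_set \<sigma> \<pi>. stage \<sigma> \<pi> k = m"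
  using finite_enumerate_Ex[of "{m. new_stage \<sigma> \<pi> m}" m] enumerate_Ex[of "{m. new_stage \<sigma> \<pi> m}" m]
  by (cases "finite {m. new_stage \<sigma> \<pi> m}") (auto simp: index_set_def stage_def)

lemma stage_index_stage:
  assumes "k \<in> index_set \<sigma> \<pi>"
  shows "stage_index \<sigma> \<pi> (stage \<sigma> \<pi> k) = k"
proof -
  have "{j \<in> index_set \<sigma> \<pi>. stage \<sigma> \<pi> j \<le> stage \<sigma> \<pi> k} \<subseteq> {..k}"
    using stage_strict_mono by (fastforce simp: not_le[symmetric] intro: leI)
  moreover have "k \<in> {j \<in> index_set \<sigma> \<pi>. stage \<sigma> \<pi> j \<le> stage \<sigma> \<pi> k}" using assms by simp
  ultimately show ?thesis unfolding stage_index_def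
    by (intro Max_eqI) (auto intro: finite_subset)
qed

lemma stage_index_new:
  assumes "new_stage \<sigma> \<pi> m"
  shows "stage_index \<sigma> \<pi> m \<in> index_set \<sigma> \<pi>" "stage \<sigma> \<pi> (stage_index \<sigma> \<pi> m) = m"
  using new_stage_ex[OF assms] stage_index_stage by auto

lemma zero_index: "0 \<in> index_set \<sigma> \<pi>" "stage \<sigma> \<pi> 0 = 0"
proof -
  have n: "new_stage \<sigma> \<pi> 0" by (simp add: new_stage_def)
  then have "card {m. new_stage \<sigma> \<pi> m} > 0" if "finite {m. new_stage \<sigma> \<pi> m}"
    using that by (auto simp: card_gt_0_iff)
  then show "0 \<in> index_set \<sigma> \<pi>" by (simp add: index_set_def)
  show "stage \<sigma> \<pi> 0 = 0" using n by (simp add: stage_def enumerate_0 Least_equality)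
qed

end

section \<open>Arrays determined by a short array\<close>

text \<open>An entry of \<open>M\<^sub>n\<close> only depends on its weight: it is \<open>L w\<close> at weight \<open>w < n\<close> and \<open>P n\<close> at weight \<open>n\<close>.
  Here \<open>P n\<close> stands for the first \<open>\<omega>\<close>-component of \<open>C\<^sub>n\<close>, and \<open>L w\<close> for that of the \<open>(\<omega>+w)\<close>-components which
  are not the first in their \<open>(\<omega>+w+1)\<close>-component; they are irrelevant if there is no such first component.\<close>

definition entry :: "(nat \<Rightarrow> 'a rel) \<Rightarrow> (nat \<Rightarrow> 'a rel) \<Rightarrow> nat \<Rightarrow> nat \<Rightarrow> 'a rel"
  where "entry L P n w = (if w < n then L w else P n)"

text \<open>The relations between \<open>L\<close>, \<open>P\<close> and the short array \<open>U\<close> that the recursion for \<open>M\<^sub>n\<close> imposes.\<close>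

definition coherent :: "(enat \<Rightarrow> enat) \<Rightarrow> (nat \<Rightarrow> enat) \<Rightarrow> (nat \<Rightarrow> 'a rel) \<Rightarrow> (nat \<Rightarrow> 'a rel) \<Rightarrow> (nat \<Rightarrow> 'a rel) \<Rightarrow> bool"
  where "coherent \<sigma> \<pi> U L P \<longleftrightarrow> P 0 = U 0 \<and>
    (\<forall>n. (\<pi> n = 0 \<longrightarrow> P (Suc n) = P n) \<and>
      (\<pi> n = 0 \<and> derived \<sigma> \<pi> (Suc n) ! n = 0 \<longrightarrow> L n = U (stage_index \<sigma> \<pi> (Suc n))) \<and>
      (0 < \<pi> n \<longrightarrow> L n = P n) \<and>
      (0 < \<pi> n \<and> \<pi> n < \<infinity> \<and> derived \<sigma> \<pi> (Suc n) ! Suc n = 0 \<longrightarrow>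
        P (Suc n) = U (stage_index \<sigma> \<pi> (Suc n))))"

lemma coherent_exists: "\<exists>L P. coherent \<sigma> \<pi> U L P"
proof -
  define P where "P = rec_nat (U 0) (\<lambda>n X. if \<pi> n = 0 then X else U (stage_index \<sigma> \<pi> (Suc n)))"
  define L where "L n = (if \<pi> n = 0 then U (stage_index \<sigma> \<pi> (Suc n)) else P n)" for n
  have "coherent \<sigma> \<pi> U L P" unfolding coherent_def L_def by (auto simp: P_def)
  then show ?thesis by blast
qed

text \<open>If weight \<open>n\<close> occurs for \<open>s \<in> \<S>(n+1)\<close>, then exactly at the first leaf.\<close>

lemma leaves_first:
  assumes "s \<in> finite_strings (Suc n)"
  shows "\<exists>r. leaves s 0 = (if s ! n = 0 then [n] else []) @ r \<and> (\<forall>w\<in>set r. w < n)"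
  using assms
proof (induction n arbitrary: s)
  case 0
  then have "length s \<le> 1" "s ! 0 = 0" by (auto simp: finite_strings_def)
  then show ?case by (auto simp: leaves_one[of s])
next
  case (Suc n)
  note m = str_minus_simps[OF Suc.prems] and p = str_plus_simps[OF Suc.prems]
  have setm: "\<forall>w\<in>set (leaves (str_minus s) 0). w < Suc n" using set_leaves[OF m(2)] by auto
  show ?case
  proof (cases "s ! Suc n = Suc n")
    case True
    then show ?thesis using setm by (auto simp: leaves_step[OF Suc.prems])
  next
    case False
    obtain r where r: "leaves (str_plus s) 0 = (if s ! Suc n = 0 then [n] else []) @ r" "\<forall>w\<in>set r. w < n"
      using Suc.IH[OF p(4)[OF False]] p(2) by auto
    have "map (shift_wt n (Suc 0)) r = r" using r(2) by (intro map_idI) (auto simp: shift_wt_def)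
    then have "leaves (str_plus s) (Suc 0) = (if s ! Suc n = 0 then [Suc n] else []) @ r"
      using leaves_shift[OF p(4)[OF False], of "Suc 0"] r(1) by (auto simp: shift_wt_def)
    then show ?thesis using False setm r(2)
      by (intro exI[of _ "r @ leaves (str_minus s) 0"]) (auto simp: leaves_step[OF Suc.prems])
  qed
qed

text \<open>The weights of \<open>s\<^sub>n\<^sub>+\<^sub>1\<close>: those at copied positions come from \<open>s\<^sub>n\<close>, the weight at a new position is \<open>n\<close> or
  \<open>n + 1\<close>, and every other weight also occurs at a copied position.\<close>

lemma array_step:
  assumes c: "compatible \<sigma> \<pi>" and fin: "\<pi> n < \<infinity>"
  defines "l \<equiv> leaves (derived \<sigma> \<pi> n) 0" and "l' \<equiv> leaves (derived \<sigma> \<pi> (Suc n)) 0"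
  shows "copy_start \<sigma> \<pi> n + length l \<le> length l'"
    "\<And>i. i < length l \<Longrightarrow> l' ! (copy_start \<sigma> \<pi> n + i) = (if \<pi> n = 0 then shift_wt n (Suc 0) (l ! i) else l ! i)"
    "\<And>i. i < length l' \<Longrightarrow> i \<notin> copied \<sigma> \<pi> n \<Longrightarrow> new_stage \<sigma> \<pi> (Suc n) \<Longrightarrow> i = new_position \<sigma> \<pi> (Suc n) \<Longrightarrow>
      l' ! i = (if \<pi> n = 0 then n else Suc n)"
    "\<And>i. i < length l' \<Longrightarrow> i \<notin> copied \<sigma> \<pi> n \<Longrightarrow> \<not> (new_stage \<sigma> \<pi> (Suc n) \<and> i = new_position \<sigma> \<pi> (Suc n)) \<Longrightarrow>
      \<exists>j\<in>copied \<sigma> \<pi> n. l' ! j = l' ! i"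
proof -
  let ?s = "derived \<sigma> \<pi> n" and ?t = "derived \<sigma> \<pi> (Suc n)"
  note S = derived_finite_strings[OF c, of "Suc n"] and S0 = derived_finite_strings[OF c, of n]
  have top: "?t ! Suc n \<noteq> Suc n" using derived_top_iff[OF c, of n] fin by auto
  have setl: "set l = {i. i \<le> n \<and> ?s ! i = 0}" unfolding l_def by (rule set_leaves[OF S0])
  have nl: "num_leaves ?s = length l" "num_leaves ?t = length l'" by (simp_all add: num_leaves_def l_def l'_def)
  let ?goal = "copy_start \<sigma> \<pi> n + length l \<le> length l' \<and>
    (\<forall>i<length l. l' ! (copy_start \<sigma> \<pi> n + i) = (if \<pi> n = 0 then shift_wt n (Suc 0) (l ! i) else l ! i)) \<and>
    (\<forall>i<length l'. i \<notin> copied \<sigma> \<pi> n \<longrightarrow> (if new_stage \<sigma> \<pi> (Suc n) \<and> i = new_position \<sigma> \<pi> (Suc n)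
      then l' ! i = (if \<pi> n = 0 then n else Suc n) else \<exists>j\<in>copied \<sigma> \<pi> n. l' ! j = l' ! i))"
  have ?goal
  proof (cases "\<pi> n = 0")
    case True
    let ?m = "str_minus ?t"
    note m = str_minus_simps[OF S]
    obtain r where r: "leaves ?m 0 = (if ?m ! n = 0 then [n] else []) @ r" "\<forall>w\<in>set r. w < n"
      using leaves_first[OF m(2)] by blast
    have l': "l' = map (shift_wt n (Suc 0)) l @ leaves ?m 0"
      unfolding l'_def l_def by (rule leaves_derived_Suc(2)[OF c True])
    have cs: "copy_start \<sigma> \<pi> n = 0" "copied \<sigma> \<pi> n = {0..<length l}"
      using True by (simp_all add: copy_start_def copied_def nl)
    have new: "new_stage \<sigma> \<pi> (Suc n) \<longleftrightarrow> ?m ! n = 0" "new_position \<sigma> \<pi> (Suc n) = length l"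
      using True m(4)[of n] by (simp_all add: new_stage_def new_position_def nl)
    have C: "if new_stage \<sigma> \<pi> (Suc n) \<and> i = new_position \<sigma> \<pi> (Suc n)
      then l' ! i = n else \<exists>j\<in>copied \<sigma> \<pi> n. l' ! j = l' ! i"
      if i: "i < length l'" "i \<notin> copied \<sigma> \<pi> n" for i
    proof (cases "new_stage \<sigma> \<pi> (Suc n) \<and> i = new_position \<sigma> \<pi> (Suc n)")
      case True
      then show ?thesis using r(1) new by (simp add: l' nth_append)
    next
      case False
      define k where "k = i - length l"
      have k: "i = length l + k" "k < length (leaves ?m 0)" using i l' by (auto simp: k_def cs)
      then have v: "l' ! i = leaves ?m 0 ! k" by (simp add: l' nth_append)
      have "leaves ?m 0 ! k \<in> set r"
        using False k r(1) new by (cases k) (auto simp: nth_append split: if_splits)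
      then have "l' ! i < n" using r(2) v by auto
      moreover have "l' ! i \<in> {w. w \<le> n \<and> ?m ! w = 0}" using set_leaves[OF m(2)] k(2) v by (metis nth_mem)
      ultimately have "l' ! i \<in> set l" using m(4) derived_step_nth(1) setl by auto
      then obtain j where j: "j < length l" "l ! j = l' ! i" by (auto simp: in_set_conv_nth)
      then have "l' ! j = l' ! i" using \<open>l' ! i < n\<close> by (simp add: l' nth_append shift_wt_def)
      then show ?thesis using j False cs by auto
    qed
    have A: "copy_start \<sigma> \<pi> n + length l \<le> length l'" by (simp add: cs l')
    have B: "l' ! (copy_start \<sigma> \<pi> n + i) = shift_wt n (Suc 0) (l ! i)" if "i < length l" for i
      using that by (simp add: cs l' nth_append)
    show ?thesis unfolding if_P[OF True] by (intro conjI allI impI A B C)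
  next
    case False
    then have pos: "0 < \<pi> n" by simp
    let ?p = "str_plus ?t"
    note p = str_plus_simps[OF S]
    obtain r where r: "leaves ?p 0 = (if ?t ! Suc n = 0 then [n] else []) @ r" "\<forall>w\<in>set r. w < n"
      using leaves_first[OF p(4)[OF top]] p(2) by auto
    have l'0: "l' = map (shift_wt n (Suc 0)) (leaves ?p 0) @ l"
      unfolding l'_def l_def by (rule leaves_derived_Suc(3)[OF c pos fin])
    have "map (shift_wt n (Suc 0)) r = r" using r(2) by (intro map_idI) (auto simp: shift_wt_def)
    then have "l' = ((if ?t ! Suc n = 0 then [Suc n] else []) @ r) @ l"
      using r(1) by (auto simp: l'0 shift_wt_def)
    then obtain q where q: "q = (if ?t ! Suc n = 0 then [Suc n] else []) @ r" and l': "l' = q @ l" by blast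
    have cs: "copy_start \<sigma> \<pi> n = length q" "copied \<sigma> \<pi> n = {length q..<length q + length l}"
      using False by (simp_all add: copy_start_def copied_def nl l')
    have new: "new_stage \<sigma> \<pi> (Suc n) \<longleftrightarrow> ?t ! Suc n = 0" "new_position \<sigma> \<pi> (Suc n) = 0"
      using False pos fin by (simp_all add: new_stage_def new_position_def)
    have C: "if new_stage \<sigma> \<pi> (Suc n) \<and> i = new_position \<sigma> \<pi> (Suc n)
      then l' ! i = Suc n else \<exists>j\<in>copied \<sigma> \<pi> n. l' ! j = l' ! i"
      if i: "i < length l'" "i \<notin> copied \<sigma> \<pi> n" for i
    proof (cases "new_stage \<sigma> \<pi> (Suc n) \<and> i = new_position \<sigma> \<pi> (Suc n)")
      case True
      then show ?thesis using new by (simp add: l' q nth_append)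
    next
      case False
      have k: "i < length q" using i l' cs by auto
      then have v: "l' ! i = q ! i" by (simp add: l' nth_append)
      have vr: "q ! i \<in> set r"
        using False k new by (cases i) (auto simp: q nth_append split: if_splits)
      then have "l' ! i < n" using r(2) v by auto
      moreover have "l' ! i \<in> set (leaves ?p 0)" using vr r(1) v by auto
      then have "l' ! i \<in> {w. w \<le> n \<and> ?p ! w = 0}" unfolding set_leaves[OF p(4)[OF top]] .
      ultimately have "l' ! i \<in> set l" using p(3) derived_step_nth(1) setl by auto
      then obtain j where j: "j < length l" "l ! j = l' ! i" by (auto simp: in_set_conv_nth)
      then have "l' ! (length q + j) = l' ! i" by (simp add: l' nth_append)
      moreover have "length q + j \<in> copied \<sigma> \<pi> n" using j cs by simp
      ultimately show ?thesis using False by (simp only: if_False) blast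
    qed
    have A: "copy_start \<sigma> \<pi> n + length l \<le> length l'" by (simp only: cs l' length_append order_refl)
    have B: "l' ! (copy_start \<sigma> \<pi> n + i) = l ! i" for i
      unfolding cs(1) l' by (rule nth_append_length_plus)
    show ?thesis unfolding if_not_P[OF False] by (intro conjI allI impI A B C)
  qed
  note g = conjunct1[OF this] conjunct1[OF conjunct2[OF this]] conjunct2[OF conjunct2[OF this]]
  show "copy_start \<sigma> \<pi> n + length l \<le> length l'" by (rule g(1))
  show "l' ! (copy_start \<sigma> \<pi> n + i) = (if \<pi> n = 0 then shift_wt n (Suc 0) (l ! i) else l ! i)"
    if "i < length l" for i
    using g(2) that by blast
  have C: "if new_stage \<sigma> \<pi> (Suc n) \<and> i = new_position \<sigma> \<pi> (Suc n)
      then l' ! i = (if \<pi> n = 0 then n else Suc n) else \<exists>j\<in>copied \<sigma> \<pi> n. l' ! j = l' ! i"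
    if "i < length l'" "i \<notin> copied \<sigma> \<pi> n" for i
    using g(3) that by blast
  show "l' ! i = (if \<pi> n = 0 then n else Suc n)"
    if "i < length l'" "i \<notin> copied \<sigma> \<pi> n" "new_stage \<sigma> \<pi> (Suc n)" "i = new_position \<sigma> \<pi> (Suc n)" for i
    using C[OF that(1,2)] unfolding if_P[OF conjI[OF that(3,4)]] .
  show "\<exists>j\<in>copied \<sigma> \<pi> n. l' ! j = l' ! i"
    if "i < length l'" "i \<notin> copied \<sigma> \<pi> n" "\<not> (new_stage \<sigma> \<pi> (Suc n) \<and> i = new_position \<sigma> \<pi> (Suc n))" for i
    using C[OF that(1,2)] unfolding if_not_P[OF that(3)] .
qed

lemma entry_step:
  assumes "coherent \<sigma> \<pi> U L P" "w \<le> n"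
  shows "entry L P (Suc n) (if \<pi> n = 0 then shift_wt n (Suc 0) w else w) = entry L P n w"
  using assms by (auto simp: entry_def shift_wt_def coherent_def)

lemma entry_new:
  assumes "coherent \<sigma> \<pi> U L P" "new_stage \<sigma> \<pi> (Suc n)"
  shows "entry L P (Suc n) (if \<pi> n = 0 then n else Suc n) = U (stage_index \<sigma> \<pi> (Suc n))"
  using assms by (auto simp: entry_def coherent_def new_stage_def)

lemma derived_zero_leaves:
  assumes "compatible \<sigma> \<pi>"
  shows "leaves (derived \<sigma> \<pi> 0) 0 = [0]"
  by (rule leaves_one) (simp add: derived_nth One_nat_def)

text \<open>The functions \<open>L\<close> and \<open>P\<close> that are coherent with \<open>U\<close> give arrays determined by \<open>U\<close>, and there are no others.\<close>

lemma determines_arrays_entry: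
  assumes c: "compatible \<sigma> \<pi>" and h: "coherent \<sigma> \<pi> U L P"
  shows "determines_arrays \<sigma> \<pi> U (\<lambda>n. map (entry L P n) (leaves (derived \<sigma> \<pi> n) 0))"
  unfolding determines_arrays_def
proof (intro conjI allI)
  show "map (entry L P 0) (leaves (derived \<sigma> \<pi> 0) 0) = [U 0]"
    using h by (simp add: derived_zero_leaves[OF c] entry_def coherent_def)
next
  fix n
  let ?s = "derived \<sigma> \<pi> n" and ?t = "derived \<sigma> \<pi> (Suc n)"
  let ?M = "map (entry L P n) (leaves ?s 0)" and ?M' = "map (entry L P (Suc n)) (leaves ?t 0)"
  have le: "w \<le> n" if "w \<in> set (leaves ?s 0)" for w
    using that set_leaves[OF derived_finite_strings[OF c, of n]] by auto
  show "if \<pi> n = \<infinity> then ?M' = ?M else length ?M' = num_leaves ?t \<and>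
      (\<forall>i<num_leaves ?s. ?M' ! (copy_start \<sigma> \<pi> n + i) = ?M ! i) \<and>
      (\<forall>i<num_leaves ?t. i \<notin> copied \<sigma> \<pi> n \<longrightarrow>
        (if new_stage \<sigma> \<pi> (Suc n) \<and> i = new_position \<sigma> \<pi> (Suc n) then ?M' ! i = U (stage_index \<sigma> \<pi> (Suc n))
         else \<exists>j\<in>copied \<sigma> \<pi> n. wt ?t j = wt ?t i \<and> ?M' ! i = ?M' ! j))"
  proof (cases "\<pi> n = \<infinity>")
    case True
    have "entry L P (Suc n) w = entry L P n w" if "w \<in> set (leaves ?s 0)" for w
      using entry_step[OF h le[OF that]] True by simp
    then show ?thesis using True leaves_derived_Suc(1)[OF c True] by simp
  next
    case False
    then have fin: "\<pi> n < \<infinity>" by simp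
    note st = array_step[OF c fin]
    have cl: "j < length (leaves ?t 0)" if "j \<in> copied \<sigma> \<pi> n" for j
      using that st(1) by (auto simp: copied_def num_leaves_def)
    have a: "?M' ! (copy_start \<sigma> \<pi> n + i) = ?M ! i" if "i < num_leaves ?s" for i
      using that st(1) st(2)[of i] entry_step[OF h, of "leaves ?s 0 ! i" n] le[of "leaves ?s 0 ! i"]
      by (simp add: num_leaves_def)
    have b: "if new_stage \<sigma> \<pi> (Suc n) \<and> i = new_position \<sigma> \<pi> (Suc n) then ?M' ! i = U (stage_index \<sigma> \<pi> (Suc n))
         else \<exists>j\<in>copied \<sigma> \<pi> n. wt ?t j = wt ?t i \<and> ?M' ! i = ?M' ! j"
      if i: "i < num_leaves ?t" "i \<notin> copied \<sigma> \<pi> n" for i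
    proof (cases "new_stage \<sigma> \<pi> (Suc n) \<and> i = new_position \<sigma> \<pi> (Suc n)")
      case True
      then show ?thesis using st(3)[of i] i entry_new[OF h] by (simp add: num_leaves_def)
    next
      case False
      then obtain j where j: "j \<in> copied \<sigma> \<pi> n" "leaves ?t 0 ! j = leaves ?t 0 ! i"
        using st(4)[of i] i by (auto simp: num_leaves_def)
      then have "wt ?t j = wt ?t i \<and> ?M' ! i = ?M' ! j"
        using i cl[OF j(1)] by (simp add: wt_def num_leaves_def)
      then show ?thesis using False j(1) by (simp only: if_False) blast
    qed
    have "length ?M' = num_leaves ?t" by (simp add: num_leaves_def)
    then show ?thesis unfolding if_not_P[OF False] by (intro conjI allI impI a b)
  qed
qed

lemma determines_arrays_unique:
  assumes c: "compatible \<sigma> \<pi>" and h: "coherent \<sigma> \<pi> U L P" and M: "determines_arrays \<sigma> \<pi> U M"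
  shows "M n = map (entry L P n) (leaves (derived \<sigma> \<pi> n) 0)"
proof (induction n)
  case 0
  show ?case using h M by (simp add: derived_zero_leaves[OF c] entry_def coherent_def determines_arrays_def)
next
  case (Suc n)
  let ?s = "derived \<sigma> \<pi> n" and ?t = "derived \<sigma> \<pi> (Suc n)"
  have le: "w \<le> n" if "w \<in> set (leaves ?s 0)" for w
    using that set_leaves[OF derived_finite_strings[OF c, of n]] by auto
  show ?case
  proof (cases "\<pi> n = \<infinity>")
    case True
    have "entry L P (Suc n) w = entry L P n w" if "w \<in> set (leaves ?s 0)" for w
      using entry_step[OF h le[OF that]] True by simp
    then have "map (entry L P (Suc n)) (leaves ?t 0) = M n"
      using Suc leaves_derived_Suc(1)[OF c True] by simp
    then show ?thesis using True M by (simp add: determines_arrays_def)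
  next
    case False
    then have fin: "\<pi> n < \<infinity>" by simp
    note st = array_step[OF c fin]
    have len: "length (M (Suc n)) = num_leaves ?t"
      and cp: "\<And>i. i < num_leaves ?s \<Longrightarrow> M (Suc n) ! (copy_start \<sigma> \<pi> n + i) = M n ! i"
      and nw: "\<And>i. i < num_leaves ?t \<Longrightarrow> i \<notin> copied \<sigma> \<pi> n \<Longrightarrow>
        (if new_stage \<sigma> \<pi> (Suc n) \<and> i = new_position \<sigma> \<pi> (Suc n) then M (Suc n) ! i = U (stage_index \<sigma> \<pi> (Suc n))
         else \<exists>j\<in>copied \<sigma> \<pi> n. wt ?t j = wt ?t i \<and> M (Suc n) ! i = M (Suc n) ! j)"
      using M False unfolding determines_arrays_def by (metis (no_types, lifting))+
    have copied: "M (Suc n) ! j = entry L P (Suc n) (leaves ?t 0 ! j)" if j: "j \<in> copied \<sigma> \<pi> n" for j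
    proof -
      define i where "i = j - copy_start \<sigma> \<pi> n"
      have i: "j = copy_start \<sigma> \<pi> n + i" "i < length (leaves ?s 0)"
        using j by (auto simp: i_def copied_def num_leaves_def)
      then show ?thesis
        using cp[of i] st(2)[OF i(2)] entry_step[OF h, of "leaves ?s 0 ! i" n] le[of "leaves ?s 0 ! i"] Suc
        by (simp add: num_leaves_def)
    qed
    have "M (Suc n) ! i = entry L P (Suc n) (leaves ?t 0 ! i)" if i: "i < num_leaves ?t" for i
    proof (cases "i \<in> copied \<sigma> \<pi> n")
      case True
      then show ?thesis by (rule copied)
    next
      case nc: False
      show ?thesis
      proof (cases "new_stage \<sigma> \<pi> (Suc n) \<and> i = new_position \<sigma> \<pi> (Suc n)")
        case True
        then show ?thesis using nw[OF i nc] st(3)[of i] nc i entry_new[OF h] by (simp add: num_leaves_def)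
      next
        case False
        then have "\<exists>j\<in>copied \<sigma> \<pi> n. wt ?t j = wt ?t i \<and> M (Suc n) ! i = M (Suc n) ! j"
          using nw[OF i nc] by (simp only: if_False)
        then obtain j where "j \<in> copied \<sigma> \<pi> n" "wt ?t j = wt ?t i" "M (Suc n) ! i = M (Suc n) ! j" by blast
        then show ?thesis using copied by (simp add: wt_def)
      qed
    qed
    then show ?thesis using len by (intro nth_equalityI) (simp_all add: num_leaves_def)
  qed
qed

lemma entry_in_short_array:
  assumes c: "compatible \<sigma> \<pi>" and h: "coherent \<sigma> \<pi> U L P" and w: "w \<le> n" "derived \<sigma> \<pi> n ! w = 0"
  shows "entry L P n w \<in> U ` index_set \<sigma> \<pi>"
proof -
  have P: "P n \<in> U ` index_set \<sigma> \<pi>" if "derived \<sigma> \<pi> n ! n = 0" for n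
    using that
  proof (induction n)
    case 0
    then show ?case using h zero_index(1)[of \<sigma> \<pi>] by (auto simp: coherent_def)
  next
    case (Suc n)
    show ?case
    proof (cases "\<pi> n = 0")
      case True
      then have "P (Suc n) = P n" "derived \<sigma> \<pi> n ! n = 0"
        using h Suc.prems derived_step_nth(2)[of \<pi> n \<sigma>, OF True] by (auto simp: coherent_def)
      then show ?thesis using Suc.IH by simp
    next
      case False
      then have p: "0 < \<pi> n" "\<pi> n < \<infinity>" using Suc.prems derived_top_iff[OF c, of n] by auto
      then have "P (Suc n) = U (stage_index \<sigma> \<pi> (Suc n))" using h Suc.prems unfolding coherent_def by blast
      moreover have "new_stage \<sigma> \<pi> (Suc n)" using p Suc.prems by (simp add: new_stage_def)
      ultimately show ?thesis using stage_index_new(1) by simp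
    qed
  qed
  have L: "L k \<in> U ` index_set \<sigma> \<pi>" if k: "derived \<sigma> \<pi> (Suc k) ! k = 0" for k
  proof (cases "\<pi> k = 0")
    case True
    then have "L k = U (stage_index \<sigma> \<pi> (Suc k))" using h k unfolding coherent_def by blast
    moreover have "new_stage \<sigma> \<pi> (Suc k)" using True k by (simp add: new_stage_def)
    ultimately show ?thesis using stage_index_new(1) by simp
  next
    case False
    then have p: "0 < \<pi> k" by simp
    then have "L k = P k" using h unfolding coherent_def by blast
    then show ?thesis using P[of k] derived_step_nth(3)[of \<pi> k \<sigma>, OF p] k by simp
  qed
  show ?thesis
  proof (cases "w < n")
    case True
    then have "derived \<sigma> \<pi> (Suc w) ! w = 0" using w(2) by (simp add: derived_nth)
    then show ?thesis using L True by (simp add: entry_def)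
  next
    case False
    then show ?thesis using P[of n] w by (simp add: entry_def)
  qed
qed

lemma determines_arrays_cong:
  assumes "\<And>k. k \<in> index_set \<sigma> \<pi> \<Longrightarrow> U k = U' k"
  shows "determines_arrays \<sigma> \<pi> U = determines_arrays \<sigma> \<pi> U'"
proof -
  have "U 0 = U' 0" using assms zero_index(1) by blast
  moreover have "new_stage \<sigma> \<pi> (Suc n) \<and> i = p \<Longrightarrow> U (stage_index \<sigma> \<pi> (Suc n)) = U' (stage_index \<sigma> \<pi> (Suc n))"
    for n and i p :: nat
    using assms stage_index_new(1) by blast
  ultimately show ?thesis
    unfolding determines_arrays_def fun_eq_iff by (simp cong: if_cong)
qed

lemma array_chain_cong:
  assumes "\<And>k. k \<in> index_set \<sigma> \<pi> \<Longrightarrow> U k = U' k"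
  shows "array_chain \<sigma> \<pi> U = array_chain \<sigma> \<pi> U'"
  unfolding array_chain_def using determines_arrays_cong[of \<sigma> \<pi> U U', OF assms] by simp

lemma short_set_of_short_array:
  assumes "short_array \<sigma> \<pi> U"
  shows "short_set (U ` index_set \<sigma> \<pi>)"
proof -
  have u: "uniform (U k)" "has_rank (U k) (omega_plus 0)" if "k \<in> index_set \<sigma> \<pi>" for k
    using assms that by (auto simp: short_array_def short_family_def)
  have ct: "tail (U k) x \<cong>\<^sub>c common_tail (U k)" if "k \<in> index_set \<sigma> \<pi>" "x \<in> Field (U k)" for k x
  proof -
    have "(SOME x. x \<in> Field (U k)) \<in> Field (U k)" using that(2) by (rule someI)
    then show ?thesis using u(1)[OF that(1)] that(2) unfolding uniform_def common_tail_def by blast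
  qed
  have "tails_iso (U k) (U k')" if k: "k \<in> index_set \<sigma> \<pi>" "k' \<in> index_set \<sigma> \<pi>" for k k'
    unfolding tails_iso_def
  proof (intro ballI)
    fix x y assume "x \<in> Field (U k)" "y \<in> Field (U k')"
    then have "tail (U k) x \<cong>\<^sub>c common_tail (U k)" "common_tail (U k') \<cong>\<^sub>c tail (U k') y"
      using ct k chain_iso_sym by blast+
    moreover have "common_tail (U k) \<cong>\<^sub>c common_tail (U k')"
      using assms k by (auto simp: short_array_def short_family_def)
    ultimately show "tail (U k) x \<cong>\<^sub>c tail (U k') y" using chain_iso_trans by blast
  qed
  then show ?thesis using u by (auto simp: short_set_def)
qed

section \<open>Indexing by weights\<close>

text \<open>The maximal weight of \<open>s\<^sub>n\<close> is the position of the last zero of \<open>s\<^sub>n\<close>.\<close>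

lemma max_wt_step:
  assumes c: "compatible \<sigma> \<pi>"
  shows "max_wt (derived \<sigma> \<pi> n) \<le> max_wt (derived \<sigma> \<pi> (Suc n))"
    "new_stage \<sigma> \<pi> (Suc n) \<Longrightarrow> max_wt (derived \<sigma> \<pi> n) < max_wt (derived \<sigma> \<pi> (Suc n))"
proof -
  define Z where "Z n = {i. i \<le> n \<and> derived \<sigma> \<pi> n ! i = 0}" for n
  have mw: "max_wt (derived \<sigma> \<pi> n) = Max (Z n)" for n
    unfolding Z_def by (rule max_wt_eq[OF derived_finite_strings[OF c]])
  have fin: "finite (Z n)" for n by (simp add: Z_def)
  have ne: "0 \<in> Z n" for n
    using derived_finite_strings[OF c, of n] by (auto simp: Z_def finite_strings_def)
  have le: "m \<le> n" if "m \<in> Z n" for m n using that by (simp add: Z_def)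
  have MaxZ: "Max (Z n) \<in> Z n" for n using fin ne Max_in[of "Z n"] by blast
  have ge: "m \<le> Max (Z n)" if "m \<in> Z n" for m n using Max_ge[OF fin that] .
  have lt: "m \<in> Z (Suc n)" if "m \<in> Z n" "m < n" for m
    using that by (auto simp: Z_def derived_step_nth)
  have "Max (Z n) \<le> Max (Z (Suc n)) \<and> (new_stage \<sigma> \<pi> (Suc n) \<longrightarrow> Max (Z n) < Max (Z (Suc n)))"
  proof (cases "\<pi> n = 0")
    case True
    show ?thesis
    proof (cases "n \<in> Z n")
      case n: True
      then have "Suc n \<in> Z (Suc n)" using derived_step_nth(2)[of \<pi> n \<sigma>, OF True] by (simp add: Z_def)
      then have "Suc n \<le> Max (Z (Suc n))" by (rule ge)
      then show ?thesis using le[OF MaxZ[of n]] by simp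
    next
      case False
      then have l: "Max (Z n) < n" using MaxZ[of n] le by (metis le_neq_implies_less)
      then have "Max (Z n) \<le> Max (Z (Suc n))" using ge lt MaxZ by blast
      moreover have "Max (Z n) < Max (Z (Suc n))" if "new_stage \<sigma> \<pi> (Suc n)"
      proof -
        have "n \<in> Z (Suc n)" using that True by (simp add: Z_def new_stage_def)
        then show ?thesis using ge l by fastforce
      qed
      ultimately show ?thesis by blast
    qed
  next
    case False
    then have p: "0 < \<pi> n" by simp
    have "Max (Z n) \<in> Z (Suc n)"
    proof (cases "Max (Z n) = n")
      case True
      then show ?thesis using MaxZ[of n] derived_step_nth(3)[of \<pi> n \<sigma>, OF p] by (simp add: Z_def)
    next
      case False
      then show ?thesis using lt MaxZ[of n] le[OF MaxZ[of n]] by simp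
    qed
    then have "Max (Z n) \<le> Max (Z (Suc n))" by (rule ge)
    moreover have "Max (Z n) < Max (Z (Suc n))" if "new_stage \<sigma> \<pi> (Suc n)"
    proof -
      have "Suc n \<in> Z (Suc n)" using that False by (simp add: Z_def new_stage_def)
      then show ?thesis using ge[of "Suc n" "Suc n"] le[OF MaxZ[of n]] by simp
    qed
    ultimately show ?thesis by blast
  qed
  then show "max_wt (derived \<sigma> \<pi> n) \<le> max_wt (derived \<sigma> \<pi> (Suc n))"
    "new_stage \<sigma> \<pi> (Suc n) \<Longrightarrow> max_wt (derived \<sigma> \<pi> n) < max_wt (derived \<sigma> \<pi> (Suc n))"
    unfolding mw by blast+
qed

lemma max_wt_strict_mono:
  assumes c: "compatible \<sigma> \<pi>" and "m < m'" "new_stage \<sigma> \<pi> m'"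
  shows "max_wt (derived \<sigma> \<pi> m) < max_wt (derived \<sigma> \<pi> m')"
proof -
  obtain n where n: "m' = Suc n" "m \<le> n" using assms(2) by (cases m') auto
  have "max_wt (derived \<sigma> \<pi> m) \<le> max_wt (derived \<sigma> \<pi> n)"
    using lift_Suc_mono_le[of "\<lambda>n. max_wt (derived \<sigma> \<pi> n)", OF max_wt_step(1)[OF c] n(2)] .
  also have "\<dots> < max_wt (derived \<sigma> \<pi> m')" using max_wt_step(2)[OF c] assms(3) n by simp
  finally show ?thesis .
qed

lemma short_array_reindex:
  assumes "short_array_wt \<sigma> \<pi> V"
  shows "short_array \<sigma> \<pi> (reindex \<sigma> \<pi> V)"
proof -
  have "max_wt (derived \<sigma> \<pi> (stage \<sigma> \<pi> k)) \<in> weight_set \<sigma> \<pi>" if "k \<in> index_set \<sigma> \<pi>" for k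
    using stage_new[OF that] by (auto simp: weight_set_def)
  then show ?thesis
    using assms by (simp add: short_array_def short_array_wt_def short_family_def reindex_def)
qed

lemma reindex_surj:
  assumes c: "compatible \<sigma> \<pi>" and U: "short_array \<sigma> \<pi> U"
  obtains V where "short_array_wt \<sigma> \<pi> V" "\<And>k. k \<in> index_set \<sigma> \<pi> \<Longrightarrow> reindex \<sigma> \<pi> V k = U k"
proof -
  define f where "f k = max_wt (derived \<sigma> \<pi> (stage \<sigma> \<pi> k))" for k
  have "f k < f k'" if "k < k'" "k' \<in> index_set \<sigma> \<pi>" for k k'
    unfolding f_def using max_wt_strict_mono[OF c stage_strict_mono[OF that(2,1)] stage_new[OF that(2)]] .
  then have inj: "inj_on f (index_set \<sigma> \<pi>)"
    by (intro inj_onI) (metis less_irrefl linorder_neqE_nat)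
  define V where "V l = U (inv_into (index_set \<sigma> \<pi>) f l)" for l
  have V: "V (f k) = U k" if "k \<in> index_set \<sigma> \<pi>" for k
    using inv_into_f_f[OF inj that] by (simp add: V_def)
  have "weight_set \<sigma> \<pi> = f ` index_set \<sigma> \<pi>"
    using new_stage_ex stage_new unfolding weight_set_def f_def by fastforce
  then have "short_array_wt \<sigma> \<pi> V"
    using U V by (simp add: short_array_wt_def short_array_def short_family_def)
  moreover have "reindex \<sigma> \<pi> V k = U k" if "k \<in> index_set \<sigma> \<pi>" for k
    using V[OF that] by (simp add: reindex_def f_def)
  ultimately show ?thesis by (rule that)
qed


section \<open>Unions of increasing sequences of convex subchains\<close>

lemma convex_emb_iso_image:
  assumes "convex_emb A B f" "Linear_order B"
  shows "iso A (Restr B (f ` Field A)) f"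
proof -
  have "Field (Restr B (f ` Field A)) = f ` Field A"
    using assms by (auto simp: Field_Restr_lin convex_emb_def)
  then show ?thesis using assms(1) by (auto simp: iso_bij_order convex_emb_def bij_betw_def)
qed

text \<open>\<open>L\<close> is the union of an increasing sequence of convex subchains, the \<open>n\<close>-th one being the image of \<open>C n\<close>
  under \<open>j n\<close>; the inclusions correspond to the embeddings \<open>e n\<close>.\<close>

definition convex_union :: "(nat \<Rightarrow> 'b rel) \<Rightarrow> (nat \<Rightarrow> 'b \<Rightarrow> 'b) \<Rightarrow> 'c rel \<Rightarrow> (nat \<Rightarrow> 'b \<Rightarrow> 'c) \<Rightarrow> bool"
  where "convex_union C e L j \<longleftrightarrow> Linear_order L \<and> (\<forall>n. convex_emb (C n) L (j n)) \<and>
    (\<forall>n. \<forall>x\<in>Field (C n). e n x \<in> Field (C (Suc n)) \<and> j (Suc n) (e n x) = j n x) \<and> Field L = (\<Union>n. j n ` Field (C n))"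

lemma convex_unionD:
  assumes "convex_union C e L j"
  shows "Linear_order L" "convex_emb (C n) L (j n)" "x \<in> Field (C n) \<Longrightarrow> e n x \<in> Field (C (Suc n))"
    "x \<in> Field (C n) \<Longrightarrow> j (Suc n) (e n x) = j n x" "Field L = (\<Union>n. j n ` Field (C n))"
  using assms unfolding convex_union_def by blast+

lemma convex_union_mono:
  assumes "convex_union C e L j" "n \<le> m"
  shows "j n ` Field (C n) \<subseteq> j m ` Field (C m)"
proof -
  have "j n ` Field (C n) \<subseteq> j (Suc n) ` Field (C (Suc n))" for n
    
  proof
    fix y assume "y \<in> j n ` Field (C n)"
    then obtain x where "x \<in> Field (C n)" "y = j n x" by blast
    then have "y = j (Suc n) (e n x)" "e n x \<in> Field (C (Suc n))"
      using convex_unionD(3,4)[OF assms(1)] by auto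
    then show "y \<in> j (Suc n) ` Field (C (Suc n))" by blast
  qed
  then show ?thesis using lift_Suc_mono_le[of "\<lambda>n. j n ` Field (C n)"] assms(2) by blast
qed

lemma convex_union_common:
  assumes "convex_union C e L j" "x \<in> Field L" "y \<in> Field L"
  obtains n a b where "a \<in> Field (C n)" "b \<in> Field (C n)" "x = j n a" "y = j n b"
proof -
  obtain n m where "x \<in> j n ` Field (C n)" "y \<in> j m ` Field (C m)"
    using assms(2,3) unfolding convex_unionD(5)[OF assms(1)] by blast
  then have "x \<in> j (max n m) ` Field (C (max n m))" "y \<in> j (max n m) ` Field (C (max n m))"
    using convex_union_mono[OF assms(1), of n "max n m"] convex_union_mono[OF assms(1), of m "max n m"] by auto
  then show ?thesis using that by blast
qed

text \<open>Such a union is uniform as soon as all its members are: two points lie in a common member \<open>C n\<close>, and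
  above that member their tails coincide.\<close>

lemma convex_union_uniform:
  assumes u: "convex_union C e L j" and C: "\<And>n. uniform (C n)"
  shows "uniform L"
  unfolding uniform_def
proof (intro conjI ballI)
  show lin: "Linear_order L" using convex_unionD(1)[OF u] .
  fix x y assume xy: "x \<in> Field L" "y \<in> Field L"
  obtain n a b where ab: "a \<in> Field (C n)" "b \<in> Field (C n)" "x = j n a" "y = j n b"
    by (rule convex_union_common[OF u xy]) (rule that)
  define D where "D = j n ` Field (C n)"
  have emb: "convex_emb (C n) L (j n)" using convex_unionD(2)[OF u] .
  then have convex: "v \<in> D" if "u \<in> D" "w \<in> D" "(u, v) \<in> L" "(v, w) \<in> L" for u v w
    using that unfolding convex_emb_def D_def by blast
  have xyD: "x \<in> D" "y \<in> D" using ab by (simp_all add: D_def)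
  have DF: "D \<subseteq> Field L" using emb unfolding convex_emb_def D_def by blast
  \<comment> \<open>A tail from a point of \<open>D\<close> has at most two blocks: its part in \<open>D\<close>, and the points above \<open>D\<close>.\<close>
  define p :: "'b \<Rightarrow> int" where "p z = (if z \<in> D then 0 else 1)" for z
  have above: "(z, w) \<in> L" if "z \<in> D" "w \<notin> D" "(z', w) \<in> L" "z' \<in> D" for z z' w
  proof (rule ccontr)
    assume "(z, w) \<notin> L"
    then have "(w, z) \<in> L" using lin_total[OF lin, of z w] that DF lin_Field(2)[OF that(3)] by blast
    then show False using convex[OF that(4,1,3)] that by blast
  qed
  have isoD: "iso (C n) (Restr L D) (j n)" unfolding D_def by (rule convex_emb_iso_image[OF emb lin])
  have linC: "Linear_order (C n)" using C by (simp add: uniform_def)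
  have bl: "blocks (tail L z) p (p ` above L z)" if "z \<in> D" for z
    unfolding blocks_def
  proof (intro conjI allI impI)
    show "Linear_order (tail L z)" by (rule Linear_order_tail[OF lin])
    show "p ` Field (tail L z) = p ` above L z" by (simp add: Field_tail[OF lin])
    fix u v assume "(u, v) \<in> tail L z"
    then have "(z, u) \<in> L" "(u, v) \<in> L" by (auto simp: tail_iff[OF lin])
    then show "p u \<le> p v" using convex[of z v u] that by (auto simp: p_def)
  qed
  have im: "p ` above L z = {0} \<union> (if \<exists>w. w \<notin> D \<and> (x, w) \<in> L then {1} else {})" if z: "z \<in> D" for z
  proof -
    have "0 \<in> p ` above L z"
      using z lin_refl[OF lin] DF by (force simp: above_def p_def)
    moreover have "1 \<in> p ` above L z \<longleftrightarrow> (\<exists>w. w \<notin> D \<and> (x, w) \<in> L)"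
    proof
      assume "1 \<in> p ` above L z"
      then obtain w where "w \<notin> D" "(z, w) \<in> L" by (auto simp: above_def p_def split: if_splits)
      then show "\<exists>w. w \<notin> D \<and> (x, w) \<in> L" using above[OF xyD(1) _ _ z] by blast
    next
      assume "\<exists>w. w \<notin> D \<and> (x, w) \<in> L"
      then obtain w where "w \<notin> D" "(z, w) \<in> L" using above[OF z _ _ xyD(1)] by blast
      then show "1 \<in> p ` above L z" by (force simp: above_def p_def)
    qed
    moreover have "p ` above L z \<subseteq> {0, 1}" by (auto simp: p_def)
    ultimately show ?thesis by auto
  qed
  have b0: "block (tail L z) p 0 = tail (Restr L D) z" if "z \<in> D" for z
    using that by (auto simp: block_def tail_def above_def p_def)
  have tD: "tail (Restr L D) (j n c) \<cong>\<^sub>c tail (C n) c" if "c \<in> Field (C n)" for c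
    using iso_tail[OF isoD linC that] chain_iso_sym unfolding chain_iso_def by blast
  have "block (tail L x) p i \<cong>\<^sub>c block (tail L y) p i" if "i \<in> p ` above L x" for i
  proof (cases "i = 0")
    case True
    have "tail (C n) a \<cong>\<^sub>c tail (C n) b" using C[of n] ab by (simp add: uniform_def)
    then have "tail (Restr L D) x \<cong>\<^sub>c tail (Restr L D) y"
      using tD[OF ab(1)] tD[OF ab(2)] ab(3,4) chain_iso_trans chain_iso_sym by metis
    then show ?thesis using b0 xyD True by simp
  next
    case False
    then have i1: "i = 1" using that im[OF xyD(1)] by (auto split: if_splits)
    have "z \<in> above L x \<longleftrightarrow> z \<in> above L y" if "z \<notin> D" for z
      using above[OF xyD(1) that _ xyD(2)] above[OF xyD(2) that _ xyD(1)] by (auto simp: above_def)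
    then have "block (tail L x) p i = block (tail L y) p i"
      unfolding i1 block_def tail_def by (auto simp: p_def)
    then show ?thesis by (simp add: chain_iso_refl)
  qed
  moreover have "blocks (tail L y) p (p ` above L x)" using bl[OF xyD(2)] im xyD by simp
  ultimately show "tail L x \<cong>\<^sub>c tail L y"
    using blocks_match[OF bl[OF xyD(1)], of "tail L y" p] unfolding chain_iso_def by metis
qed

lemma convex_union_crel:
  fixes \<alpha> :: ordinal
  assumes "convex_union C e L j" "Linear_order (C n)" "a \<in> Field (C n)" "b \<in> Field (C n)"
  shows "(j n a, j n b) \<in> crel L \<alpha> \<longleftrightarrow> (a, b) \<in> crel (C n) \<alpha>"
  using crel_convex_emb[OF assms(2) convex_unionD(1,2)[OF assms(1)] assms(3,4)] .

lemma convex_union_has_rank: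
  assumes u: "convex_union C e L j" and C: "\<And>n. Linear_order (C n)" "\<And>n. has_rank (C n) (omega_plus n)"
  shows "has_rank L omega_omega"
proof -
  note lin = convex_unionD(1)[OF u]
  have jF: "j n a \<in> Field L" if "a \<in> Field (C n)" for n a
    using that convex_unionD(5)[OF u] by blast
  have "(x, y) \<in> crel L omega_omega" if xy: "x \<in> Field L" "y \<in> Field L" for x y
  proof -
    obtain n a b where ab: "a \<in> Field (C n)" "b \<in> Field (C n)" "x = j n a" "y = j n b"
      by (rule convex_union_common[OF u xy]) (rule that)
    then have "(a, b) \<in> crel (C n) (omega_plus n)" using has_rankD(2)[OF C(2) C(1)] by simp
    then have "(x, y) \<in> crel L (omega_plus n)" using ab convex_union_crel[OF u C(1) ab(1,2)] by simp
    moreover have "omega_plus n \<le> omega_omega" by (simp add: less_eq_prod_def)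
    ultimately show ?thesis using crel_mono[OF lin] by blast
  qed
  then have "crel L omega_omega = Field L \<times> Field L" using crel_sub[OF lin] by blast
  moreover have "crel L \<beta> \<noteq> Field L \<times> Field L" if b: "\<beta> < omega_omega" for \<beta> :: ordinal
  proof -
    define m where "m = snd \<beta>"
    have "\<beta> \<le> omega_plus m" using b by (cases \<beta>) (auto simp: m_def less_prod_def less_eq_prod_def)
    then have sub: "crel L \<beta> \<subseteq> crel L (omega_plus m)" using crel_mono[OF lin] by blast
    have "omega_plus m < omega_plus (Suc m)" by (simp add: less_prod_def)
    then have "crel (C (Suc m)) (omega_plus m) \<noteq> Field (C (Suc m)) \<times> Field (C (Suc m))"
      using has_rankD(3)[OF C(2) C(1)] by blast
    then obtain a b where ab: "a \<in> Field (C (Suc m))" "b \<in> Field (C (Suc m))"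
      "(a, b) \<notin> crel (C (Suc m)) (omega_plus m)"
      using crel_sub[OF C(1)[of "Suc m"], of "omega_plus m"] by blast
    then have "(j (Suc m) a, j (Suc m) b) \<notin> crel L (omega_plus m)"
      using convex_union_crel[OF u C(1) ab(1,2)] by simp
    then show ?thesis using sub jF ab by blast
  qed
  moreover have "Field L \<noteq> {}" using has_rankD(1)[OF C(2) C(1), of 0] jF by blast
  ultimately show ?thesis by (simp only: has_rank_iff[OF lin]) blast
qed

section \<open>Direct limits\<close>

lemma fold_upt_add:
  assumes "n \<le> m" "m \<le> k"
  shows "fold e [m..<k] (fold e [n..<m] x) = fold e [n..<k] x"
proof -
  have "[n..<k] = [n..<m] @ [m..<k]" using assms by (metis le_add_diff_inverse upt_add_eq_append)
  then show ?thesis by simp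
qed

lemma direct_limit_convex_union:
  fixes C :: "nat \<Rightarrow> 'b rel"
  assumes lin: "\<And>n. Linear_order (C n)" and emb: "\<And>n. convex_emb (C n) (C (Suc n)) (e n)"
  shows "\<exists>j. convex_union C e (direct_limit C e) j"
proof -
  define E where "E n k x = fold e [n..<k] x" for n k :: nat and x
  have E_refl: "E n n x = x" for n x by (simp add: E_def)
  have E_emb: "convex_emb (C n) (C k) (E n k)" if "n \<le> k" for n k
    using that
  proof (induction k rule: dec_induct)
    case base
    then show ?case by (auto simp: convex_emb_def E_refl dest: lin_Field)
  next
    case (step k)
    have eq: "E n (Suc k) = e k \<circ> E n k" using step by (auto simp: E_def)
    show ?case unfolding eq by (rule convex_emb_comp[OF step.IH emb])
  qed
  have E_add: "E m k (E n m x) = E n k x" if "n \<le> m" "m \<le> k" for n m k x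
    using fold_upt_add[OF that] by (simp add: E_def)
  have EF: "E n k x \<in> Field (C k)" if "n \<le> k" "x \<in> Field (C n)" for n k x
    using E_emb[OF that(1)] that(2) by (auto simp: convex_emb_def)
  have E_iff: "(E n k x, E n k y) \<in> C k \<longleftrightarrow> (x, y) \<in> C n" "E n k x = E n k y \<longleftrightarrow> x = y"
    if "n \<le> k" "x \<in> Field (C n)" "y \<in> Field (C n)" for n k x y
    using E_emb[OF that(1)] that(2,3) by (auto simp: convex_emb_def inj_on_def)
  define Pre where "Pre = {((n, x), (m, y)) |n x m y. x \<in> Field (C n) \<and> y \<in> Field (C m) \<and>
        (fold e [n..<max n m] x, fold e [m..<max n m] y) \<in> C (max n m)}"
  define R where "R = {((n, x), (m, y)) |n x m y. x \<in> Field (C n) \<and> y \<in> Field (C m) \<and>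
        fold e [n..<max n m] x = fold e [m..<max n m] y}"
  define L where "L = direct_limit C e"
  have L: "L = quot_chain Pre R" by (simp add: L_def direct_limit_def Pre_def R_def)
  have Pre_iff: "((n, x), (m, y)) \<in> Pre \<longleftrightarrow> x \<in> Field (C n) \<and> y \<in> Field (C m) \<and> (E n k x, E m k y) \<in> C k"
    and R_iff: "((n, x), (m, y)) \<in> R \<longleftrightarrow> x \<in> Field (C n) \<and> y \<in> Field (C m) \<and> E n k x = E m k y"
    if k: "n \<le> k" "m \<le> k" for n m k x y
  proof -
    let ?N = "max n m"
    have N: "n \<le> ?N" "m \<le> ?N" "?N \<le> k" using k by auto
    have "(E n k x, E m k y) \<in> C k \<longleftrightarrow> (E n ?N x, E m ?N y) \<in> C ?N"
      "E n k x = E m k y \<longleftrightarrow> E n ?N x = E m ?N y" if "x \<in> Field (C n)" "y \<in> Field (C m)"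
      using E_iff[OF N(3) EF[OF N(1) that(1)] EF[OF N(2) that(2)]] E_add[OF N(1,3)] E_add[OF N(2,3)] by simp_all
    then show "((n, x), (m, y)) \<in> Pre \<longleftrightarrow> x \<in> Field (C n) \<and> y \<in> Field (C m) \<and> (E n k x, E m k y) \<in> C k"
      "((n, x), (m, y)) \<in> R \<longleftrightarrow> x \<in> Field (C n) \<and> y \<in> Field (C m) \<and> E n k x = E m k y"
      unfolding Pre_def R_def E_def by auto
  qed
  have FPre: "Field Pre = {(n, x). x \<in> Field (C n)}"
  proof
    show "Field Pre \<subseteq> {(n, x). x \<in> Field (C n)}" unfolding Pre_def Field_def by auto
    show "{(n, x). x \<in> Field (C n)} \<subseteq> Field Pre"
    proof clarify
      fix n x assume "x \<in> Field (C n)"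
      then have "((n, x), (n, x)) \<in> Pre" using lin_refl[OF lin] by (simp add: Pre_iff[of n n n] E_refl)
      then show "(n, x) \<in> Field Pre" by (rule lin_Field)
    qed
  qed
  define j where "j n x = R `` {(n, x)}" for n x
  have j_mem: "(m, y) \<in> j n x \<longleftrightarrow> x \<in> Field (C n) \<and> y \<in> Field (C m) \<and> E n k x = E m k y"
    if "n \<le> k" "m \<le> k" for n m k x y
    using R_iff[OF that] by (simp add: j_def)
  have j_lift: "j n x = j k (E n k x)" if k: "n \<le> k" and x: "x \<in> Field (C n)" for n k x
  proof -
    have "(m, y) \<in> j n x \<longleftrightarrow> (m, y) \<in> j k (E n k x)" for m y
    proof -
      define l where "l = max k m"
      have l: "n \<le> l" "k \<le> l" "m \<le> l" using k by (auto simp: l_def)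
      then show ?thesis using x EF[OF k x] E_add[OF k l(2)] j_mem[OF l(1,3)] j_mem[OF l(2,3)] by simp
    qed
    then show ?thesis by auto
  qed
  have quot: "Field Pre // R = {j n x |n x. x \<in> Field (C n)}"
    unfolding FPre j_def quotient_def by auto
  have self: "(n, x) \<in> j n x" if "x \<in> Field (C n)" for n x using that j_mem[of n n n] by simp
  have j_le: "(j n x, j n y) \<in> L \<longleftrightarrow> (x, y) \<in> C n" if x: "x \<in> Field (C n)" and y: "y \<in> Field (C n)" for n x y
  proof
    assume "(j n x, j n y) \<in> L"
    then obtain u v where uv: "u \<in> j n x" "v \<in> j n y" "(u, v) \<in> Pre" unfolding L quot_chain_def by blast
    obtain a b c d where u: "u = (a, b)" and v: "v = (c, d)" by (cases u, cases v)
    define k where "k = max n (max a c)"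
    have k: "n \<le> k" "a \<le> k" "c \<le> k" by (auto simp: k_def)
    have "E n k x = E a k b" "E n k y = E c k d" "(E a k b, E c k d) \<in> C k"
      using uv unfolding u v by (simp_all add: j_mem[OF k(1,2)] j_mem[OF k(1,3)] Pre_iff[OF k(2,3)])
    then show "(x, y) \<in> C n" using E_iff(1)[OF k(1) x y] by simp
  next
    assume "(x, y) \<in> C n"
    then have "((n, x), (n, y)) \<in> Pre" using x y by (simp add: Pre_iff[of n n n] E_refl)
    moreover have "j n x \<in> Field Pre // R" "j n y \<in> Field Pre // R" using x y quot by auto
    ultimately show "(j n x, j n y) \<in> L" using self[OF x] self[OF y] unfolding L quot_chain_def by blast
  qed
  have j_eq: "j n x = j n y \<longleftrightarrow> x = y" if "x \<in> Field (C n)" "y \<in> Field (C n)" for n x y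
  proof
    assume "j n x = j n y"
    then have "(n, x) \<in> j n y" using self[OF that(1)] by simp
    then show "x = y" using j_mem[of n n n] E_refl by simp
  qed simp
  have LF: "Field L = (\<Union>n. j n ` Field (C n))"
  proof
    have "Field L \<subseteq> Field Pre // R" unfolding L quot_chain_def by (auto simp: Field_def)
    then show "Field L \<subseteq> (\<Union>n. j n ` Field (C n))" unfolding quot by blast
    show "(\<Union>n. j n ` Field (C n)) \<subseteq> Field L"
    proof clarify
      fix n x assume "x \<in> Field (C n)"
      then have "(j n x, j n x) \<in> L" using j_le lin_refl[OF lin] by simp
      then show "j n x \<in> Field L" by (rule lin_Field)
    qed
  qed
  have common: "\<exists>k. c \<in> j k ` Field (C k) \<and> d \<in> j k ` Field (C k) \<and> n \<le> k"
    if cd: "c \<in> Field L" "d \<in> Field L" for c d n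
  proof -
    obtain a x b y where c: "c = j a x" "x \<in> Field (C a)" and d: "d = j b y" "y \<in> Field (C b)"
      using cd unfolding LF by blast
    define k where "k = max n (max a b)"
    have k: "a \<le> k" "b \<le> k" "n \<le> k" by (auto simp: k_def)
    have "j a x \<in> j k ` Field (C k)" "j b y \<in> j k ` Field (C k)"
      using j_lift[OF k(1) c(2)] j_lift[OF k(2) d(2)] EF[OF k(1) c(2)] EF[OF k(2) d(2)] by simp_all
    then show ?thesis using k(3) c(1) d(1) by blast
  qed
  have linL: "Linear_order L"
  proof (rule Linear_orderI)
    fix c assume "c \<in> Field L"
    then show "(c, c) \<in> L" unfolding LF using j_le lin_refl[OF lin] by auto
  next
    fix c d f assume cd: "(c, d) \<in> L" "(d, f) \<in> L"
    then have "c \<in> Field L" "d \<in> Field L" "f \<in> Field L" by (auto dest: lin_Field)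
    then obtain n where n: "c \<in> j n ` Field (C n)" "d \<in> j n ` Field (C n)" using common[of c d 0] by blast
    obtain k where k: "f \<in> j k ` Field (C k)" "n \<le> k" using common[of f f n] \<open>f \<in> Field L\<close> by blast
    have sub: "j n ` Field (C n) \<subseteq> j k ` Field (C k)" using j_lift[OF k(2)] EF[OF k(2)] by blast
    obtain x where x: "x \<in> Field (C k)" "c = j k x" using subsetD[OF sub n(1)] by blast
    obtain y where y: "y \<in> Field (C k)" "d = j k y" using subsetD[OF sub n(2)] by blast
    obtain z where z: "z \<in> Field (C k)" "f = j k z" using k(1) by blast
    have "(x, y) \<in> C k" "(y, z) \<in> C k" using cd x y z j_le by simp_all
    then show "(c, f) \<in> L" using x z j_le lin_trans[OF lin, of x y k z] by simp
  next
    fix c d assume cd: "(c, d) \<in> L" "(d, c) \<in> L"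
    then have "c \<in> Field L" "d \<in> Field L" by (auto dest: lin_Field)
    then obtain k where "c \<in> j k ` Field (C k)" "d \<in> j k ` Field (C k)"
      using common[of c d 0] by blast
    then obtain x y where "x \<in> Field (C k)" "y \<in> Field (C k)" "c = j k x" "d = j k y"
      by (elim imageE) (rule that)
    then show "c = d" using cd j_le lin_antisym[OF lin, of x y k] by simp
  next
    fix c d assume "c \<in> Field L" "d \<in> Field L"
    then obtain k where "c \<in> j k ` Field (C k)" "d \<in> j k ` Field (C k)"
      using common[of c d 0] by blast
    then obtain x y where "x \<in> Field (C k)" "y \<in> Field (C k)" "c = j k x" "d = j k y"
      by (elim imageE) (rule that)
    then show "(c, d) \<in> L \<or> (d, c) \<in> L" using j_le lin_total[OF lin, of x k y] by simp
  qed
  have "convex_emb (C n) L (j n)" for n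
    unfolding convex_emb_def
  proof (intro conjI ballI allI impI)
    show "inj_on (j n) (Field (C n))" using j_eq by (simp add: inj_on_def)
    show "j n ` Field (C n) \<subseteq> Field L" unfolding LF by blast
    show "(a, b) \<in> C n \<longleftrightarrow> (j n a, j n b) \<in> L" if "a \<in> Field (C n)" "b \<in> Field (C n)" for a b
      using j_le that by simp
    fix a b y assume ab: "a \<in> Field (C n)" "b \<in> Field (C n)" and y: "(j n a, y) \<in> L" "(y, j n b) \<in> L"
    then have "y \<in> Field L" by (auto dest: lin_Field)
    then obtain k z where k: "y = j k z" "z \<in> Field (C k)" "n \<le> k" using common[of y y n] by blast
    have "(E n k a, z) \<in> C k" "(z, E n k b) \<in> C k"
      using y ab k j_le[OF EF[OF k(3)] k(2)] j_le[OF k(2) EF[OF k(3)]] j_lift[OF k(3)] by simp_all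
    then have "z \<in> E n k ` Field (C n)" using E_emb[OF k(3)] ab unfolding convex_emb_def by blast
    then show "y \<in> j n ` Field (C n)" using k(1) j_lift[OF k(3)] by auto
  qed
  moreover have "e n x \<in> Field (C (Suc n)) \<and> j (Suc n) (e n x) = j n x" if "x \<in> Field (C n)" for n x
    using j_lift[of n "Suc n" x] EF[of n "Suc n" x] that by (simp add: E_def)
  ultimately have "convex_union C e L j" using linL LF by (simp add: convex_union_def)
  then show ?thesis unfolding L_def by blast
qed

section \<open>The chains \<open>\<A>(\<sigma>, \<pi>){U\<^sub>k}\<close> are uniform of rank \<open>\<omega> + \<omega>\<close>\<close>

text \<open>The chain \<open>C\<^sub>n\<close>, when the entries of the arrays are given by \<open>L\<close> and \<open>P\<close>.\<close>

definition stage_chain :: "(enat \<Rightarrow> enat) \<Rightarrow> (nat \<Rightarrow> enat) \<Rightarrow> (nat \<Rightarrow> 'a rel) \<Rightarrow> (nat \<Rightarrow> 'a rel) \<Rightarrow> nat \<Rightarrow> 'a point rel"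
  where "stage_chain \<sigma> \<pi> L P n = weighted_chain (derived \<sigma> \<pi> n) (entry L P n)"

lemma array_chain_coherent:
  assumes "compatible \<sigma> \<pi>" "coherent \<sigma> \<pi> U L P"
  shows "array_chain \<sigma> \<pi> U = {direct_limit (stage_chain \<sigma> \<pi> L P) e |e. array_embeddings \<pi> (stage_chain \<sigma> \<pi> L P) e}"
proof -
  have "(\<lambda>n. arr (derived \<sigma> \<pi> n) (M n)) = stage_chain \<sigma> \<pi> L P" if "determines_arrays \<sigma> \<pi> U M" for M
    using determines_arrays_unique[OF assms that] by (simp add: fun_eq_iff stage_chain_def weighted_chain_def)
  note C = this
  note M = determines_arrays_entry[OF assms]
  show ?thesis
  proof
    show "array_chain \<sigma> \<pi> U \<subseteq> {direct_limit (stage_chain \<sigma> \<pi> L P) e |e. array_embeddings \<pi> (stage_chain \<sigma> \<pi> L P) e}"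
    proof
      fix A assume "A \<in> array_chain \<sigma> \<pi> U"
      then obtain e N where N: "determines_arrays \<sigma> \<pi> U N"
        "A = direct_limit (\<lambda>n. arr (derived \<sigma> \<pi> n) (N n)) e" "array_embeddings \<pi> (\<lambda>n. arr (derived \<sigma> \<pi> n) (N n)) e"
        unfolding array_chain_def by blast
      then show "A \<in> {direct_limit (stage_chain \<sigma> \<pi> L P) e |e. array_embeddings \<pi> (stage_chain \<sigma> \<pi> L P) e}"
        unfolding C[OF N(1)] by blast
    qed
    show "{direct_limit (stage_chain \<sigma> \<pi> L P) e |e. array_embeddings \<pi> (stage_chain \<sigma> \<pi> L P) e} \<subseteq> array_chain \<sigma> \<pi> U"
    proof clarify
      fix e assume "array_embeddings \<pi> (stage_chain \<sigma> \<pi> L P) e"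
      then show "direct_limit (stage_chain \<sigma> \<pi> L P) e \<in> array_chain \<sigma> \<pi> U"
        unfolding array_chain_def mem_Collect_eq using M C[OF M, symmetric] by metis
    qed
  qed
qed

lemma stage_chain_uniform:
  assumes c: "compatible \<sigma> \<pi>" and h: "coherent \<sigma> \<pi> U L P" and U: "short_array \<sigma> \<pi> U"
  shows "uniform (stage_chain \<sigma> \<pi> L P n)" "has_rank (stage_chain \<sigma> \<pi> L P n) (omega_plus n)"
  unfolding stage_chain_def
  using weighted_chain_uniform[OF short_set_of_short_array[OF U] derived_finite_strings[OF c, of n], of "entry L P n"]
    entry_in_short_array[OF c h] by blast+

lemma summand_index_derived:
  assumes "compatible \<sigma> \<pi>"
  shows "summand_index (derived \<sigma> \<pi> (Suc n)) = (if \<pi> n = \<infinity> then UNIV else {0..})"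
  using derived_top_iff[OF assms, of n] str_minus_simps(1,3)[OF derived_finite_strings[OF assms, of "Suc n"]]
  by (simp add: summand_index_def)

text \<open>\<open>C\<^sub>n\<close> is the summand of \<open>C\<^sub>n\<^sub>+\<^sub>1\<close> with index \<open>\<pi>(n)\<close>, and equal to every summand if \<open>\<pi>(n) = \<omega>\<close>.\<close>

lemma summand_stage:
  assumes c: "compatible \<sigma> \<pi>" and h: "coherent \<sigma> \<pi> U L P" and i: "\<pi> n < \<infinity> \<Longrightarrow> i = int (the_enat (\<pi> n))"
  shows "summand (derived \<sigma> \<pi> (Suc n)) (entry L P (Suc n)) i = stage_chain \<sigma> \<pi> L P n"
proof -
  let ?t = "derived \<sigma> \<pi> (Suc n)"
  note S = derived_finite_strings[OF c, of n]
  note m = str_minus_simps[OF derived_finite_strings[OF c, of "Suc n"]]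
  have l: "last ?t \<noteq> length ?t - 1 \<longleftrightarrow> \<pi> n < \<infinity>" using m derived_top_iff[OF c, of n] by simp
  have iff: "last ?t \<noteq> length ?t - 1 \<and> i = 0 \<longleftrightarrow> \<pi> n = 0"
  proof (cases "\<pi> n < \<infinity>")
    case True
    then show ?thesis using l i by (cases "\<pi> n") (auto simp: zero_enat_def)
  next
    case False
    then show ?thesis using l by auto
  qed
  show ?thesis
  proof (cases "\<pi> n = 0")
    case True
    have "weighted_chain (derived \<sigma> \<pi> n) (entry L P (Suc n) \<circ> shift_wt n (Suc 0)) =
        weighted_chain (derived \<sigma> \<pi> n) (entry L P n)"
      by (rule weighted_chain_cong[OF S]) (use entry_step[OF h, of _ n] True in simp)
    then show ?thesis using True iff m(1) derived_plus[of \<pi> n \<sigma>, OF True]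
      by (simp add: summand_def stage_chain_def)
  next
    case False
    then have "0 < \<pi> n" by simp
    moreover have "weighted_chain (derived \<sigma> \<pi> n) (entry L P (Suc n)) = weighted_chain (derived \<sigma> \<pi> n) (entry L P n)"
      by (rule weighted_chain_cong[OF S]) (use entry_step[OF h, of _ n] False in simp)
    moreover have "\<not> (last ?t \<noteq> length ?t - 1 \<and> i = 0)" using False iff by blast
    ultimately show ?thesis using derived_minus[of \<pi> n \<sigma>]
      unfolding summand_def stage_chain_def by (simp only: if_False)
  qed
qed

lemma stage_chain_blocks:
  fixes n :: nat
  assumes c: "compatible \<sigma> \<pi>" and h: "coherent \<sigma> \<pi> U L P" and U: "short_array \<sigma> \<pi> U"
  defines "B \<equiv> stage_chain \<sigma> \<pi> L P (Suc n)" and "I \<equiv> (if \<pi> n = \<infinity> then UNIV else {0..} :: int set)"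
  shows "blocks B block_index I"
    "\<And>i. i \<in> I \<Longrightarrow> block B block_index i \<cong>\<^sub>c summand (derived \<sigma> \<pi> (Suc n)) (entry L P (Suc n)) i"
    "\<And>x y. x \<in> Field B \<Longrightarrow> y \<in> Field B \<Longrightarrow> (x, y) \<in> crel B (omega_plus n) \<longleftrightarrow> block_index x = block_index y"
proof -
  let ?t = "derived \<sigma> \<pi> (Suc n)"
  let ?f = "entry L P (Suc n)"
  note S = derived_finite_strings[OF c, of "Suc n"]
  have I: "summand_index ?t = I" using summand_index_derived[OF c] by (simp add: I_def)
  have su: "uniform (summand ?t ?f i)" "has_rank (summand ?t ?f i) (omega_plus n)" for i
    using summand_uniform[OF short_set_of_short_array[OF U] S, of ?f i] entry_in_short_array[OF c h] by blast+
  then have lin: "Linear_order (summand ?t ?f i) \<and> Field (summand ?t ?f i) \<noteq> {}" for i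
    using has_rankD(1) unfolding uniform_def by blast
  show b: "blocks B block_index I"
    using weighted_chain_blocks(1)[OF S lin] unfolding I B_def stage_chain_def .
  show iso: "block B block_index i \<cong>\<^sub>c summand ?t ?f i" if "i \<in> I" for i
    using weighted_chain_blocks(2)[OF S lin] that unfolding I B_def stage_chain_def by blast
  have "Linear_order B" using b by (simp add: blocks_def)
  then have "uniform (block B block_index i) \<and> has_rank (block B block_index i) (omega_plus n)" if "i \<in> I" for i
    using iso[OF that] su[of i] uniform_iso has_rank_iso[OF _ Linear_order_block] by blast
  then show "(x, y) \<in> crel B (omega_plus n) \<longleftrightarrow> block_index x = block_index y"
    if "x \<in> Field B" "y \<in> Field B" for x y
    using block_crel_iff[OF b _ that] by blast
qed

lemma block_Field_eq: "block B p i = Restr B {x \<in> Field B. p x = i}"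
  by (auto simp: block_def dest: lin_Field)

text \<open>An \<open>(\<omega>+n)\<close>-component of \<open>C\<^sub>n\<^sub>+\<^sub>1\<close> has exactly \<open>\<pi>(n) < \<omega>\<close> predecessors iff it is the block with index \<open>\<pi>(n)\<close>.\<close>

lemma array_embeddings_exist:
  assumes c: "compatible \<sigma> \<pi>" and h: "coherent \<sigma> \<pi> U L P" and U: "short_array \<sigma> \<pi> U"
  shows "\<exists>e. array_embeddings \<pi> (stage_chain \<sigma> \<pi> L P) e"
proof -
  let ?C = "stage_chain \<sigma> \<pi> L P"
  have "\<exists>f. \<exists>d\<in>components (?C (Suc n)) (omega_plus n). iso (?C n) (Restr (?C (Suc n)) d) f \<and>
      (\<pi> n < \<infinity> \<longrightarrow> finite (predecessors (quot (?C (Suc n)) (omega_plus n)) d) \<and>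
        enat (card (predecessors (quot (?C (Suc n)) (omega_plus n)) d)) = \<pi> n)" for n
  proof -
    define i where "i = (if \<pi> n = \<infinity> then 0 else int (the_enat (\<pi> n)))"
    define d where "d = {x \<in> Field (?C (Suc n)). block_index x = i}"
    note b = stage_chain_blocks[OF c h U, where n = n]
    have i: "i \<in> (if \<pi> n = \<infinity> then UNIV else {0..})" by (simp add: i_def)
    have "summand (derived \<sigma> \<pi> (Suc n)) (entry L P (Suc n)) i = ?C n"
      by (rule summand_stage[OF c h]) (auto simp: i_def)
    then have "Restr (?C (Suc n)) d \<cong>\<^sub>c ?C n" using b(2)[OF i] by (simp add: d_def block_Field_eq)
    then obtain f where f: "iso (?C n) (Restr (?C (Suc n)) d) f"
      using chain_iso_sym unfolding chain_iso_def by blast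
    have "components (?C (Suc n)) (omega_plus n) = (\<lambda>i. {x \<in> Field (?C (Suc n)). block_index x = i}) `
        (if \<pi> n = \<infinity> then UNIV else {0..})"
      by (rule components_blocks[OF b(1)]) (rule b(3))
    then have "d \<in> components (?C (Suc n)) (omega_plus n)"
      unfolding d_def using i by blast
    moreover have "finite (predecessors (quot (?C (Suc n)) (omega_plus n)) d) \<and>
        enat (card (predecessors (quot (?C (Suc n)) (omega_plus n)) d)) = \<pi> n" if "\<pi> n < \<infinity>"
    proof -
      have "blocks (?C (Suc n)) block_index {0..}" using b(1) that by auto
      from predecessors_blocks[OF this b(3), of i] show ?thesis
        using that unfolding d_def by (auto simp: i_def)
    qed
    ultimately show ?thesis using f by blast
  qed
  then show ?thesis unfolding array_embeddings_def by metis
qed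

lemma array_embeddingsD:
  assumes c: "compatible \<sigma> \<pi>" and h: "coherent \<sigma> \<pi> U L P" and U: "short_array \<sigma> \<pi> U"
    and e: "array_embeddings \<pi> (stage_chain \<sigma> \<pi> L P) e"
  shows "convex_emb (stage_chain \<sigma> \<pi> L P n) (stage_chain \<sigma> \<pi> L P (Suc n)) (e n)"
    "\<exists>i. (\<pi> n < \<infinity> \<longrightarrow> i = int (the_enat (\<pi> n))) \<and> e n ` Field (stage_chain \<sigma> \<pi> L P n) =
      {x \<in> Field (stage_chain \<sigma> \<pi> L P (Suc n)). block_index x = i}"
proof -
  let ?C = "stage_chain \<sigma> \<pi> L P"
  note b = stage_chain_blocks[OF c h U, where n = n]
  obtain d where d: "d \<in> components (?C (Suc n)) (omega_plus n)" "iso (?C n) (Restr (?C (Suc n)) d) (e n)"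
    "\<pi> n < \<infinity> \<Longrightarrow> enat (card (predecessors (quot (?C (Suc n)) (omega_plus n)) d)) = \<pi> n"
    using e unfolding array_embeddings_def by blast
  obtain i where i: "i \<in> (if \<pi> n = \<infinity> then UNIV else {0..})" "d = {x \<in> Field (?C (Suc n)). block_index x = i}"
  proof -
    have "components (?C (Suc n)) (omega_plus n) = (\<lambda>i. {x \<in> Field (?C (Suc n)). block_index x = i}) `
        (if \<pi> n = \<infinity> then UNIV else {0..})"
      by (rule components_blocks[OF b(1)]) (rule b(3))
    then show ?thesis using d(1) that by (auto simp only: image_iff)
  qed
  have lin: "Linear_order (?C (Suc n))" using b(1) by (simp add: blocks_def)
  have dB: "Restr (?C (Suc n)) d = block (?C (Suc n)) block_index i" by (simp add: i(2) block_Field_eq)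
  show "convex_emb (?C n) (?C (Suc n)) (e n)"
    using convex_emb_comp[OF convex_emb_iso[OF d(2)], of "?C (Suc n)" id] convex_emb_block[OF b(1)]
    unfolding dB by simp
  have "e n ` Field (?C n) = Field (block (?C (Suc n)) block_index i)"
    using d(2) unfolding dB by (simp add: iso_bij_order bij_betw_def)
  moreover have "i = int (the_enat (\<pi> n))" if fin: "\<pi> n < \<infinity>"
  proof -
    have i0: "i \<ge> 0" using i(1) fin by auto
    have "blocks (?C (Suc n)) block_index {0..}" using b(1) fin by auto
    from predecessors_blocks(2)[OF this b(3) i0] have "enat (nat i) = \<pi> n"
      using d(3)[OF fin] by (simp add: i(2))
    then show ?thesis using i0 by (metis int_nat_eq the_enat.simps)
  qed
  ultimately show "\<exists>i. (\<pi> n < \<infinity> \<longrightarrow> i = int (the_enat (\<pi> n))) \<and> e n ` Field (?C n) =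
      {x \<in> Field (?C (Suc n)). block_index x = i}"
    by (auto simp: Field_block[OF lin])
qed

lemma array_chain_nonempty:
  assumes "compatible \<sigma> \<pi>" "short_array \<sigma> \<pi> U"
  shows "array_chain \<sigma> \<pi> U \<noteq> {}"
proof -
  obtain L P where h: "coherent \<sigma> \<pi> U L P" using coherent_exists by blast
  obtain e where "array_embeddings \<pi> (stage_chain \<sigma> \<pi> L P) e"
    using array_embeddings_exist[OF assms(1) h assms(2)] by blast
  then show ?thesis unfolding array_chain_coherent[OF assms(1) h] by blast
qed

lemma array_chain_uniform:
  assumes c: "compatible \<sigma> \<pi>" and U: "short_array \<sigma> \<pi> U" and L: "L \<in> array_chain \<sigma> \<pi> U"
  shows "uniform L \<and> has_rank L omega_omega"
proof -
  obtain K P where h: "coherent \<sigma> \<pi> U K P" using coherent_exists by blast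
  obtain e where e: "array_embeddings \<pi> (stage_chain \<sigma> \<pi> K P) e" "L = direct_limit (stage_chain \<sigma> \<pi> K P) e"
    using L unfolding array_chain_coherent[OF c h] by blast
  note u = stage_chain_uniform[OF c h U]
  have lin: "Linear_order (stage_chain \<sigma> \<pi> K P n)" for n using u(1) by (simp add: uniform_def)
  obtain j where "convex_union (stage_chain \<sigma> \<pi> K P) e L j"
    using direct_limit_convex_union[of "stage_chain \<sigma> \<pi> K P" e, OF lin array_embeddingsD(1)[OF c h U e(1)]] e(2) by blast
  then show ?thesis using convex_union_uniform convex_union_has_rank[OF _ lin u(2)] u(1) by blast
qed


section \<open>Components of a uniform chain of rank \<open>\<omega> + \<omega>\<close>\<close>

text \<open>If two consecutive relations \<open>\<rho>\<^sub>\<alpha>\<close> agree, then the sequence is constant from there on.\<close>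

lemma crel_stable:
  fixes \<beta> :: ordinal and i j :: nat
  assumes lin: "Linear_order A" and eq: "crel A (i, Suc j) \<subseteq> crel A (i, j)"
  shows "crel A \<beta> \<subseteq> crel A (i, j)"
proof (induction \<beta> rule: less_induct)
  case (less \<beta>)
  show ?case
  proof (cases "\<beta> \<le> (i, j)")
    case True
    then show ?thesis by (rule crel_mono[OF lin])
  next
    case False
    then have gt: "(i, j) < \<beta>" by simp
    consider "\<beta> = (0, 0)" | a b where "\<beta> = (a, Suc b)" | a where "\<beta> = (Suc a, 0)"
      by (rule ordinal_cases)
    then show ?thesis
    proof cases
      case 1
      then show ?thesis using gt ordinal_less_simps(3) by blast
    next
      case (2 a b)
      have "(i, j) \<le> (a, b)" using gt unfolding 2 ordinal_less_simps(1) .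
      then have "crel A (i, j) \<subseteq> crel A (a, b)" by (rule crel_mono[OF lin])
      moreover have "crel A (a, b) \<subseteq> crel A (i, j)"
        using less.IH[of "(a, b)"] by (simp add: 2 ordinal_less_simps)
      ultimately have "crel A (a, b) = crel A (i, j)" by (rule subset_antisym[rotated])
      then have "crel A \<beta> = crel A (i, Suc j)" by (simp add: 2 crel_lex)
      then show ?thesis using eq by simp
    next
      case (3 a)
      have eq: "{(i', j' :: nat). i' \<le> a} = {\<gamma> :: ordinal. fst \<gamma> \<le> a}" by auto
      have "crel A \<gamma> \<subseteq> crel A (i, j)" if "fst \<gamma> \<le> a" for \<gamma> :: ordinal
        by (rule less.IH) (use that in \<open>simp add: 3 ordinal_less_simps\<close>)
      then show ?thesis unfolding 3 crel_lex eq by blast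
    qed
  qed
qed

text \<open>The \<open>(\<omega>+n)\<close>-component of a point.\<close>

definition component :: "'a rel \<Rightarrow> nat \<Rightarrow> 'a \<Rightarrow> 'a set"
  where "component A n x = crel A (omega_plus n) `` {x}"

text \<open>The component of \<open>w\<close> immediately precedes that of \<open>u\<close>.\<close>

definition next_comp :: "'a rel \<Rightarrow> nat \<Rightarrow> 'a \<Rightarrow> 'a \<Rightarrow> bool"
  where "next_comp A n w u \<longleftrightarrow> (w, u) \<in> A \<and> (w, u) \<notin> crel A (omega_plus n) \<and>
    (\<forall>z. (w, z) \<in> A \<longrightarrow> (z, u) \<in> A \<longrightarrow> (w, z) \<in> crel A (omega_plus n) \<or> (z, u) \<in> crel A (omega_plus n))"

text \<open>\<open>D\<close> has a first \<open>(\<omega>+k)\<close>-component. The least such \<open>k\<close> is the entry that \<open>D\<close> contributes to strings; the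
  value is only used if there is such a \<open>k\<close>.\<close>

definition has_first :: "'a rel \<Rightarrow> nat \<Rightarrow> 'a set \<Rightarrow> bool"
  where "has_first A k D \<longleftrightarrow> (\<exists>x\<in>D. \<forall>y\<in>D. (y, x) \<in> A \<longrightarrow> (y, x) \<in> crel A (omega_plus k))"

definition first_level :: "'a rel \<Rightarrow> 'a set \<Rightarrow> nat"
  where "first_level A D = (LEAST k. has_first A k D)"

text \<open>The first \<open>\<omega>\<close>-component of \<open>D\<close>, or \<open>{}\<close> if there is none.\<close>

definition first_comp :: "'a rel \<Rightarrow> 'a set \<Rightarrow> 'a set"
  where "first_comp A D = {x \<in> D. \<forall>y\<in>D. (y, x) \<in> A \<longrightarrow> (y, x) \<in> crel A (omega_plus 0)}"

text \<open>\<open>D\<close> is an initial segment of \<open>E\<close>.\<close>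

definition initial_in :: "'a rel \<Rightarrow> 'a set \<Rightarrow> 'a set \<Rightarrow> bool"
  where "initial_in A D E \<longleftrightarrow> D \<subseteq> E \<and> (\<forall>u\<in>D. \<forall>v\<in>E. (v, u) \<in> A \<longrightarrow> v \<in> D)"

text \<open>The string that describes the \<open>(\<omega>+n)\<close>-component \<open>D\<close>, given the levels \<open>sg i\<close> of the generic
  \<open>(\<omega>+i)\<close>-components.\<close>

definition comp_string :: "'a rel \<Rightarrow> (nat \<Rightarrow> nat) \<Rightarrow> nat \<Rightarrow> 'a set \<Rightarrow> nat list"
  where "comp_string A sg n D = map sg [0..<n] @ [first_level A D]"

text \<open>The corresponding array entries as a function of the weight, given the first \<open>\<omega>\<close>-components \<open>L i\<close> of the
  generic \<open>(\<omega>+i)\<close>-components.\<close>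

definition comp_entry :: "'a rel \<Rightarrow> (nat \<Rightarrow> 'a rel) \<Rightarrow> nat \<Rightarrow> 'a set \<Rightarrow> nat \<Rightarrow> 'a rel"
  where "comp_entry A L n D = entry L (\<lambda>_. Restr A (first_comp A D)) n"

context
  fixes A :: "'a rel"
  assumes unif: "uniform A" and rank: "has_rank A omega_omega"
begin

lemma linA: "Linear_order A"
  using unif by (simp add: uniform_def)

lemma convA: "convex_equiv A (crel A (\<alpha> :: ordinal))"
  by (rule convex_equiv_crel[OF linA])

lemma relA_sym: "(x, y) \<in> crel A \<alpha> \<Longrightarrow> (y, x) \<in> crel A (\<alpha> :: ordinal)"
  by (rule convex_equivD(2)[OF convA])

lemma relA_trans: "(x, y) \<in> crel A \<alpha> \<Longrightarrow> (y, z) \<in> crel A \<alpha> \<Longrightarrow> (x, z) \<in> crel A (\<alpha> :: ordinal)"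
  by (rule convex_equivD(3)[OF convA])

lemma relA_refl: "x \<in> Field A \<Longrightarrow> (x, x) \<in> crel A (\<alpha> :: ordinal)"
  by (rule convex_equivD(1)[OF convA])

lemma relA_Field: "(x, y) \<in> crel A (\<alpha> :: ordinal) \<Longrightarrow> x \<in> Field A \<and> y \<in> Field A"
  using convex_equivD(4,5)[OF convA] by blast

lemma relA_mono: "(x, y) \<in> crel A (omega_plus n) \<Longrightarrow> n \<le> m \<Longrightarrow> (x, y) \<in> crel A (omega_plus m)"
  using crel_mono[OF linA, of "omega_plus n" "omega_plus m"] by (auto simp: less_eq_prod_def)

lemma crel_step_proper:
  fixes i j :: nat
  assumes "i \<le> 1"
  shows "\<not> crel A (i, Suc j) \<subseteq> crel A (i, j)"
proof
  assume "crel A (i, Suc j) \<subseteq> crel A (i, j)"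
  then have "crel A omega_omega \<subseteq> crel A (i, j)" by (rule crel_stable[OF linA])
  then have "crel A (i, j) = Field A \<times> Field A"
    using has_rankD(2)[OF rank linA] crel_sub[OF linA, of "(i, j)"] by blast
  moreover have "(i, j) < omega_omega" using assms by (simp add: less_prod_def)
  ultimately show False using has_rankD(3)[OF rank linA] by blast
qed

lemma next_point:
  fixes i j :: nat
  assumes "i \<le> 1" "x \<in> Field A"
  shows "\<exists>y. (x, y) \<in> A \<and> (x, y) \<in> crel A (i, Suc j) \<and> (x, y) \<notin> crel A (i, j)"
  by (rule uniform_no_last_component[OF unif crel_step_proper[OF assms(1)] assms(2)])

lemma tail_isoA:
  assumes "x \<in> Field A" "x' \<in> Field A"
  shows "tail A x \<cong>\<^sub>c tail A x'"
  using unif assms by (simp add: uniform_def)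

lemma comp_sub: "component A n x \<subseteq> Field A"
  using relA_Field by (auto simp: component_def)

lemma comp_self: "x \<in> Field A \<Longrightarrow> x \<in> component A n x"
  using relA_refl by (simp add: component_def)

lemma comp_eq: "y \<in> component A n x \<Longrightarrow> component A n y = component A n x"
  using relA_sym relA_trans unfolding component_def by blast

lemma comp_rel: "u \<in> component A n x \<Longrightarrow> v \<in> component A n x \<longleftrightarrow> (u, v) \<in> crel A (omega_plus n)"
  using relA_sym relA_trans unfolding component_def by blast

lemma comp_mono: "n \<le> m \<Longrightarrow> component A n x \<subseteq> component A m x"
  using relA_mono by (auto simp: component_def)

lemma comp_convex:
  assumes "u \<in> component A n x" "w \<in> component A n x" "(u, v) \<in> A" "(v, w) \<in> A"
  shows "v \<in> component A n x"
proof -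
  have "(u, w) \<in> crel A (omega_plus n)" using comp_rel assms by blast
  then have "(u, v) \<in> crel A (omega_plus n)" using convex_equivD(6)[OF convA assms(3,4)] by blast
  then show ?thesis using comp_rel assms(1) by blast
qed

lemma Field_comp: "Field (Restr A (component A n x)) = component A n x"
  using comp_sub by (auto simp: Field_Restr_lin[OF linA])

lemma lin_comp: "Linear_order (Restr A (component A n x))"
  by (rule Linear_order_Restr[OF linA])

lemma emb_comp: "convex_emb (Restr A (component A n x)) A id"
  by (rule convex_emb_Restr[OF linA comp_convex])

lemma crel_comp:
  fixes \<alpha> :: ordinal
  assumes "u \<in> component A n x" "v \<in> component A n x"
  shows "(u, v) \<in> crel (Restr A (component A n x)) \<alpha> \<longleftrightarrow> (u, v) \<in> crel A \<alpha>"
  using crel_convex_emb[OF lin_comp linA emb_comp, of u n x v \<alpha>] assms by (simp add: Field_comp)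

lemma comp_has_rank:
  assumes x: "x \<in> Field A"
  shows "has_rank (Restr A (component A n x)) (omega_plus n)"
proof -
  let ?T = "Restr A (component A n x)"
  have "crel ?T (omega_plus n) = Field ?T \<times> Field ?T"
  proof
    show "crel ?T (omega_plus n) \<subseteq> Field ?T \<times> Field ?T" by (rule crel_sub[OF lin_comp])
    show "Field ?T \<times> Field ?T \<subseteq> crel ?T (omega_plus n)"
      unfolding Field_comp using crel_comp comp_rel by blast
  qed
  moreover have "crel ?T \<beta> \<noteq> Field ?T \<times> Field ?T" if b: "\<beta> < omega_plus n" for \<beta> :: ordinal
  proof -
    obtain i j where ij: "\<beta> = (i, j)" by (cases \<beta>)
    then have i: "i \<le> 1" "(i, Suc j) \<le> omega_plus n" using b by (auto simp: less_prod_def less_eq_prod_def)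
    obtain y where y: "(x, y) \<in> crel A (i, Suc j)" "(x, y) \<notin> crel A \<beta>"
      using next_point[OF i(1) x, of j] ij by blast
    have "(x, y) \<in> crel A (omega_plus n)" using y(1) crel_mono[OF linA i(2)] by blast
    then have "y \<in> component A n x" by (simp add: component_def)
    then show ?thesis using crel_comp[OF comp_self[OF x], of y n \<beta>] y(2) comp_self[OF x] by (auto simp: Field_comp)
  qed
  moreover have "Field ?T \<noteq> {}" using comp_self[OF x] unfolding Field_comp by blast
  ultimately show ?thesis by (simp only: has_rank_iff[OF lin_comp]) blast
qed

lemma comp_tails_iso: "tails_iso (Restr A (component A n x)) (Restr A (component A n x'))"
  unfolding tails_iso_def Field_comp
proof (intro ballI)
  fix y y' assume y: "y \<in> component A n x" "y' \<in> component A n x'"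
  have F: "y \<in> Field A" "y' \<in> Field A" using y comp_sub by blast+
  obtain g where g: "bij_betw g (above A y) (above A y')" "g y = y'"
    "\<And>u v. (y, u) \<in> A \<Longrightarrow> (y, v) \<in> A \<Longrightarrow> (g u, g v) \<in> A \<longleftrightarrow> (u, v) \<in> A"
    "\<And>u v \<alpha>. (y, u) \<in> A \<Longrightarrow> (y, v) \<in> A \<Longrightarrow> (g u, g v) \<in> crel A (\<alpha> :: ordinal) \<longleftrightarrow> (u, v) \<in> crel A \<alpha>"
    by (rule tail_isoE[OF linA F tail_isoA[OF F]]) (rule that)
  let ?T = "tail (Restr A (component A n x)) y" and ?T' = "tail (Restr A (component A n x')) y'"
  have FT: "Field ?T = {z. (y, z) \<in> A \<and> (y, z) \<in> crel A (omega_plus n)}"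
    "Field ?T' = {z. (y', z) \<in> A \<and> (y', z) \<in> crel A (omega_plus n)}"
    using comp_rel[OF y(1)] comp_rel[OF y(2)] y by (auto simp: Field_tail[OF lin_comp] above_def)
  have yy: "(y, y) \<in> A" using lin_refl[OF linA F(1)] .
  have "bij_betw g (Field ?T) (Field ?T')"
    unfolding FT
  proof (rule bij_betw_subset[OF g(1)])
    show "{z. (y, z) \<in> A \<and> (y, z) \<in> crel A (omega_plus n)} \<subseteq> above A y" by (auto simp: above_def)
    show "g ` {z. (y, z) \<in> A \<and> (y, z) \<in> crel A (omega_plus n)} = {z. (y', z) \<in> A \<and> (y', z) \<in> crel A (omega_plus n)}"
      (is "g ` ?X = ?X'")
    proof
      show "g ` ?X \<subseteq> ?X'" using g(2) g(3)[OF yy] g(4)[OF yy] by auto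
      show "?X' \<subseteq> g ` ?X"
      proof
        fix z' assume z': "z' \<in> ?X'"
        then have "z' \<in> g ` above A y" using g(1) by (simp add: bij_betw_def above_def)
        then obtain z where "(y, z) \<in> A" "z' = g z" by (auto simp: above_def)
        then show "z' \<in> g ` ?X" using z' g(2) g(4)[OF yy, of z] by auto
      qed
    qed
  qed
  moreover have "(u, v) \<in> ?T \<longleftrightarrow> (g u, g v) \<in> ?T'" if "u \<in> Field ?T" "v \<in> Field ?T" for u v
  proof -
    have a: "g u \<in> Field ?T'" "g v \<in> Field ?T'" using bij_betwE[OF calculation] that by blast+
    have "(u, v) \<in> ?T \<longleftrightarrow> (u, v) \<in> A" "(g u, g v) \<in> ?T' \<longleftrightarrow> (g u, g v) \<in> A"
      using that a y comp_rel[OF y(1)] comp_rel[OF y(2)] unfolding FT by (auto simp: tail_iff[OF lin_comp])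
    then show ?thesis using g(3)[of u v] that unfolding FT by simp
  qed
  ultimately show "?T \<cong>\<^sub>c ?T'" unfolding chain_iso_def iso_bij_order by blast
qed

lemma comp_uniform: "uniform (Restr A (component A n x))"
  using lin_comp comp_tails_iso by (simp add: uniform_iff)

text \<open>All components with an immediate predecessor are isomorphic: an isomorphism between the tails from
  points of the preceding components maps one to the other.\<close>

lemma next_comp_iso:
  assumes wu: "next_comp A n w u" and wu': "next_comp A n w' u'"
  shows "Restr A (component A n u) \<cong>\<^sub>c Restr A (component A n u')"
proof -
  let ?R = "crel A (omega_plus n)"
  have F: "w \<in> Field A" "w' \<in> Field A" using wu wu' by (auto simp: next_comp_def dest: lin_Field)
  obtain g where g: "bij_betw g (above A w) (above A w')" "g w = w'"
    "\<And>x y. (w, x) \<in> A \<Longrightarrow> (w, y) \<in> A \<Longrightarrow> (g x, g y) \<in> A \<longleftrightarrow> (x, y) \<in> A"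
    "\<And>x y \<alpha>. (w, x) \<in> A \<Longrightarrow> (w, y) \<in> A \<Longrightarrow> (g x, g y) \<in> crel A (\<alpha> :: ordinal) \<longleftrightarrow> (x, y) \<in> crel A \<alpha>"
    by (rule tail_isoE[OF linA F tail_isoA[OF F]]) (rule that)
  have ww: "(w, w) \<in> A" using lin_refl[OF linA F(1)] .
  have surj: "\<exists>z. (w, z) \<in> A \<and> g z = z'" if "(w', z') \<in> A" for z'
  proof -
    have "z' \<in> g ` above A w" using g(1) that by (simp add: bij_betw_def above_def)
    then show ?thesis by (auto simp: above_def)
  qed
  have a: "(w, u) \<in> A" "(w, u) \<notin> ?R" "(w', u') \<in> A" "(w', u') \<notin> ?R" using wu wu' by (auto simp: next_comp_def)
  have gu: "(w', g u) \<in> A" "(w', g u) \<notin> ?R" using g(2) g(3)[OF ww a(1)] g(4)[OF ww a(1)] a by auto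
  \<comment> \<open>A component strictly between those of \<open>w'\<close> and \<open>u'\<close>, or of \<open>w\<close> and \<open>u\<close>, would result otherwise.\<close>
  have key: "(g u, u') \<in> ?R"
  proof (cases "(g u, u') \<in> A")
    case True
    then show ?thesis using wu' gu unfolding next_comp_def by blast
  next
    case False
    then have c: "(u', g u) \<in> A" using lin_total[OF linA] a(3) gu(1) lin_Field by metis
    obtain v where v: "(w, v) \<in> A" "g v = u'" using surj[OF a(3)] by blast
    have "(v, u) \<in> A" using c v g(3)[OF v(1) a(1)] by simp
    moreover have "(w, v) \<notin> ?R" using a(4) v g(2) g(4)[OF ww v(1)] by simp
    ultimately have "(v, u) \<in> ?R" using wu v(1) unfolding next_comp_def by blast
    then have "(u', g u) \<in> ?R" using v(2) g(4)[OF v(1) a(1)] by simp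
    then show ?thesis by (rule relA_sym)
  qed
  have up: "(y, z) \<in> A" if "next_comp A n y x" "z \<in> component A n x" for x y z
  proof (rule ccontr)
    assume "(y, z) \<notin> A"
    moreover have "y \<in> Field A" "z \<in> Field A" using that comp_sub by (auto simp: next_comp_def dest: lin_Field)
    ultimately have "(z, y) \<in> A" using lin_total[OF linA] by blast
    moreover have "(y, x) \<in> A" "(y, x) \<notin> ?R" using that(1) by (auto simp: next_comp_def)
    moreover have "(z, x) \<in> ?R" using that(2) relA_sym by (simp add: component_def)
    ultimately show False using convex_equivD_right[OF convA] by blast
  qed
  have "g ` component A n u = component A n u'"
  proof
    show "g ` component A n u \<subseteq> component A n u'"
    proof clarify
      fix z assume z: "z \<in> component A n u"
      then have "(u, z) \<in> ?R" by (simp add: component_def)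
      then have "(g u, g z) \<in> ?R" using g(4)[OF a(1) up[OF wu z]] by simp
      then show "g z \<in> component A n u'" using key relA_sym relA_trans unfolding component_def by blast
    qed
    show "component A n u' \<subseteq> g ` component A n u"
    proof
      fix z' assume z': "z' \<in> component A n u'"
      obtain z where z: "(w, z) \<in> A" "g z = z'" using surj[OF up[OF wu' z']] by blast
      have "(g u, z') \<in> ?R" using z' key relA_trans unfolding component_def by blast
      then have "(u, z) \<in> ?R" using z g(4)[OF a(1) z(1)] by simp
      then show "z' \<in> g ` component A n u" using z(2) by (auto simp: component_def)
    qed
  qed
  moreover have "inj_on g (component A n u)"
    using g(1) up[OF wu] by (auto simp: bij_betw_def above_def intro: inj_on_subset)
  moreover have "(x, y) \<in> Restr A (component A n u) \<longleftrightarrow> (g x, g y) \<in> Restr A (component A n u')"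
    if "x \<in> component A n u" "y \<in> component A n u" for x y
  proof -
    have "g x \<in> component A n u'" "g y \<in> component A n u'" using calculation(1) that by blast+
    then show ?thesis using g(3)[OF up[OF wu that(1)] up[OF wu that(2)]] that by simp
  qed
  ultimately have "iso (Restr A (component A n u)) (Restr A (component A n u')) g"
    unfolding iso_bij_order Field_comp by (simp add: bij_betw_def)
  then show ?thesis unfolding chain_iso_def by blast
qed

lemma rel_between:
  assumes "(u, v) \<in> A" "(u, v) \<notin> crel A \<alpha>" "(u, u') \<in> crel A \<alpha>" "(v, v') \<in> crel A (\<alpha> :: ordinal)"
  shows "(u', v') \<in> A"
proof -
  have F: "u \<in> Field A" "v \<in> Field A" "u' \<in> Field A" "v' \<in> Field A" using assms relA_Field by blast+
  have "crel A \<alpha> `` {u'} = crel A \<alpha> `` {u}" "crel A \<alpha> `` {v'} = crel A \<alpha> `` {v}"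
    using class_eq_iff[OF convA[of \<alpha>]] F assms(3,4) by blast+
  then have "(u', v') \<in> A \<or> (u', v') \<in> crel A \<alpha>"
    using quot_chain_iff[OF linA convA[of \<alpha>] F(1,2)] quot_chain_iff[OF linA convA[of \<alpha>] F(3,4)] assms(1) by simp
  moreover have "(u', v') \<notin> crel A \<alpha>" using assms(2,3,4) relA_sym relA_trans by blast
  ultimately show ?thesis by blast
qed

text \<open>An \<open>(\<omega>+n+1)\<close>-component is an \<open>\<nat>\<close>- or \<open>\<int>\<close>-indexed sum of \<open>(\<omega>+n)\<close>-components.\<close>

lemma comp_blocks:
  assumes x: "x \<in> Field A"
  obtains p where "p ` component A (Suc n) x = UNIV \<or> p ` component A (Suc n) x = {0..}"
    "blocks (Restr A (component A (Suc n) x)) p (p ` component A (Suc n) x)"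
    "\<And>u v. u \<in> component A (Suc n) x \<Longrightarrow> v \<in> component A (Suc n) x \<Longrightarrow> p u = p v \<longleftrightarrow> (u, v) \<in> crel A (omega_plus n)"
proof -
  let ?R = "crel A (omega_plus n)"
  let ?D = "component A (Suc n) x"
  \<comment> \<open>A set \<open>S\<close> of representatives of the \<open>(\<omega>+n)\<close>-components inherits finite intervals and has no last point.\<close>
  define rep where "rep u = (SOME w. w \<in> ?R `` {u})" for u
  have rep: "(u, rep u) \<in> ?R" if "u \<in> Field A" for u
    using someI[of "\<lambda>w. w \<in> ?R `` {u}" u] relA_refl[OF that] by (simp add: rep_def)
  have rep_eq: "rep u = rep v \<longleftrightarrow> (u, v) \<in> ?R" if "u \<in> Field A" "v \<in> Field A" for u v
  proof
    assume "rep u = rep v"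
    then show "(u, v) \<in> ?R" using rep[OF that(1)] rep[OF that(2)] relA_sym relA_trans by metis
  next
    assume "(u, v) \<in> ?R"
    then have "?R `` {u} = ?R `` {v}" using class_eq_iff[OF convA that] by blast
    then show "rep u = rep v" by (simp only: rep_def)
  qed
  have DF: "?D \<subseteq> Field A" by (rule comp_sub)
  have repD: "rep u \<in> ?D" if "u \<in> ?D" for u
    using comp_rel[OF that, of "rep u"] relA_mono[OF rep, of u "Suc n"] that DF by auto
  define S where "S = rep ` ?D"
  have SD: "S \<subseteq> ?D" using repD by (auto simp: S_def)
  have repS: "rep s = s" if "s \<in> S" for s
  proof -
    obtain u where u: "u \<in> ?D" "s = rep u" using \<open>s \<in> S\<close> by (auto simp: S_def)
    then have "(u, s) \<in> ?R" "u \<in> Field A" "s \<in> Field A" using rep repD DF by auto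
    then show ?thesis using rep_eq[of u s] u(2) by simp
  qed
  have fin: "finite (interval A s t \<inter> S)" if st: "s \<in> S" "t \<in> S" for s t
  proof -
    have "(s, t) \<in> crel A (omega_plus (Suc n))" using comp_rel st SD by blast
    then have f: "finite ((\<lambda>z. ?R `` {z}) ` interval A s t)"
      by (simp add: crel_lex condense_iff[OF linA convA])
    have "inj_on (\<lambda>z. ?R `` {z}) (interval A s t \<inter> S)"
    proof (rule inj_onI)
      fix y z assume yz: "y \<in> interval A s t \<inter> S" "z \<in> interval A s t \<inter> S" "?R `` {y} = ?R `` {z}"
      have "y \<in> Field A" "z \<in> Field A" using yz SD DF by blast+
      then have "rep y = rep z" using yz(3) class_eq_iff[OF convA] rep_eq by blast
      then show "y = z" using repS yz by simp
    qed
    moreover have "finite ((\<lambda>z. ?R `` {z}) ` (interval A s t \<inter> S))"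
      by (rule finite_subset[OF _ f]) blast
    ultimately show ?thesis by (rule finite_imageD[rotated])
  qed
  have no_max: "\<exists>t\<in>S. (s, t) \<in> A \<and> s \<noteq> t" if s: "s \<in> S" for s
  proof -
    have sF: "s \<in> Field A" "s \<in> ?D" using s SD DF by blast+
    obtain y where y: "(s, y) \<in> A" "(s, y) \<in> crel A (omega_plus (Suc n))" "(s, y) \<notin> ?R"
      using next_point[OF order_refl sF(1)] by blast
    have yD: "y \<in> ?D" using comp_rel[OF sF(2)] y(2) by blast
    then have ry: "(y, rep y) \<in> ?R" using rep DF by blast
    then have "(s, rep y) \<in> A" using rel_between[OF y(1,3) relA_refl[OF sF(1)]] by blast
    moreover have "s \<noteq> rep y" using ry y(3) relA_sym by blast
    moreover have "rep y \<in> S" using yD by (simp add: S_def)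
    ultimately show ?thesis by blast
  qed
  have SF: "S \<subseteq> Field A" using SD DF by blast
  have Sne: "S \<noteq> {}" using comp_self[OF x] by (auto simp: S_def)
  obtain q :: "'a \<Rightarrow> int" where q: "q ` S = UNIV \<or> q ` S = {0..}"
    "\<And>s t. s \<in> S \<Longrightarrow> t \<in> S \<Longrightarrow> q s \<le> q t \<longleftrightarrow> (s, t) \<in> A"
    by (rule locally_finite_index[OF linA SF Sne fin no_max]) (assumption | rule that)+
  define p where "p u = q (rep u)" for u
  have im: "p ` ?D = q ` S" by (auto simp: p_def S_def)
  have peq: "p u = p v \<longleftrightarrow> (u, v) \<in> ?R" if uv: "u \<in> ?D" "v \<in> ?D" for u v
  proof -
    have S: "rep u \<in> S" "rep v \<in> S" using uv by (auto simp: S_def)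
    have "p u = p v \<longleftrightarrow> q (rep u) \<le> q (rep v) \<and> q (rep v) \<le> q (rep u)" by (auto simp: p_def)
    also have "\<dots> \<longleftrightarrow> rep u = rep v"
      using q(2)[OF S] q(2)[OF S(2,1)] lin_antisym[OF linA, of "rep u" "rep v"] by auto
    finally show ?thesis using rep_eq uv DF by blast
  qed
  have "p u \<le> p v" if "(u, v) \<in> Restr A ?D" for u v
  proof (cases "(u, v) \<in> ?R")
    case True
    then show ?thesis using peq[of u v] that by simp
  next
    case False
    have uv: "(u, v) \<in> A" "u \<in> ?D" "v \<in> ?D" using that by auto
    then have "(rep u, rep v) \<in> A" using rel_between[OF uv(1) False rep rep] subsetD[OF DF] by simp
    moreover have "rep u \<in> S" "rep v \<in> S" using uv by (auto simp: S_def)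
    ultimately show ?thesis using q(2) by (simp add: p_def)
  qed
  then have "blocks (Restr A ?D) p (p ` ?D)" 
    using lin_comp[of "Suc n" x] unfolding blocks_def Field_comp by blast
  then show ?thesis by (rule that[of p, OF q(1)[folded im] _ peq])
qed

lemma block_comp:
  assumes p: "\<And>u v. u \<in> component A (Suc n) x \<Longrightarrow> v \<in> component A (Suc n) x \<Longrightarrow> p u = p v \<longleftrightarrow> (u, v) \<in> crel A (omega_plus n)"
    and u: "u \<in> component A (Suc n) x"
  shows "{v \<in> component A (Suc n) x. p v = p u} = component A n u"
    "block (Restr A (component A (Suc n) x)) p (p u) = Restr A (component A n u)"
proof -
  have sub: "component A n u \<subseteq> component A (Suc n) x"
    using comp_mono[of n "Suc n" u] comp_eq[OF u] by simp
  have "p v = p u \<longleftrightarrow> v \<in> component A n u" if "v \<in> component A (Suc n) x" for v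
    using p[OF u that] by (auto simp: component_def[of A n u])
  then show eq: "{v \<in> component A (Suc n) x. p v = p u} = component A n u" using sub by blast
  show "block (Restr A (component A (Suc n) x)) p (p u) = Restr A (component A n u)"
    unfolding block_Field_eq Field_comp eq using sub by blast
qed

lemma blocks_next_comp:
  assumes b: "blocks (Restr A (component A (Suc n) x)) p I"
    and p: "\<And>u v. u \<in> component A (Suc n) x \<Longrightarrow> v \<in> component A (Suc n) x \<Longrightarrow> p u = p v \<longleftrightarrow> (u, v) \<in> crel A (omega_plus n)"
    and u: "u \<in> component A (Suc n) x" and i: "p u - 1 \<in> I"
  shows "\<exists>w. next_comp A n w u"
proof -
  let ?D = "component A (Suc n) x"
  obtain w where w: "w \<in> ?D" "p w = p u - 1" using b i unfolding blocks_def Field_comp by force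
  have "(w, u) \<in> Restr A ?D" by (rule blocks_less[OF b]) (use w u in \<open>simp_all add: Field_comp\<close>)
  moreover have "(w, u) \<notin> crel A (omega_plus n)" using p[OF w(1) u] w(2) by simp
  moreover have "(w, z) \<in> crel A (omega_plus n) \<or> (z, u) \<in> crel A (omega_plus n)" if z: "(w, z) \<in> A" "(z, u) \<in> A" for z
  proof -
    have zD: "z \<in> ?D" using comp_convex[OF w(1) u z] .
    then have "p w \<le> p z" "p z \<le> p u" using b z w(1) u unfolding blocks_def by auto
    then have "p w = p z \<or> p z = p u" using w(2) by linarith
    then show ?thesis using p zD w(1) u by blast
  qed
  ultimately show ?thesis unfolding next_comp_def by blast
qed

section \<open>First components\<close>

lemma has_first_initial:
  assumes i: "initial_in A D E" and D: "D \<noteq> {}" "E \<subseteq> Field A"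
    and closed: "\<And>u v. u \<in> D \<Longrightarrow> (u, v) \<in> crel A (omega_plus k) \<Longrightarrow> v \<in> D"
  shows "has_first A k D \<longleftrightarrow> has_first A k E" "k = 0 \<Longrightarrow> first_comp A D = first_comp A E"
proof -
  let ?F = "\<lambda>X. {x \<in> X. \<forall>y\<in>X. (y, x) \<in> A \<longrightarrow> (y, x) \<in> crel A (omega_plus k)}"
  have sub: "D \<subseteq> E" using i by (simp add: initial_in_def)
  have "x \<in> ?F D \<longleftrightarrow> x \<in> ?F E" for x
  proof
    assume x: "x \<in> ?F D"
    then have "(y, x) \<in> crel A (omega_plus k)" if "y \<in> E" "(y, x) \<in> A" for y
      using i that unfolding initial_in_def by blast
    then show "x \<in> ?F E" using x sub by blast
  next
    assume x: "x \<in> ?F E"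
    have "x \<in> D"
    proof (rule ccontr)
      assume n: "x \<notin> D"
      obtain z where z: "z \<in> D" using D by blast
      have "(x, z) \<notin> A" using i x z n unfolding initial_in_def by blast
      then have "(z, x) \<in> A" using lin_total[OF linA, of x z] x z sub D(2) by blast
      then have "(z, x) \<in> crel A (omega_plus k)" using x z sub by blast
      then show False using closed[OF z] n by blast
    qed
    then show "x \<in> ?F D" using x sub by blast
  qed
  then have eq: "?F D = ?F E" by blast
  have hf: "has_first A k X \<longleftrightarrow> ?F X \<noteq> {}" for X unfolding has_first_def by blast
  show "has_first A k D \<longleftrightarrow> has_first A k E" unfolding hf eq ..
  show "k = 0 \<Longrightarrow> first_comp A D = first_comp A E" using eq by (simp add: first_comp_def)
qed

lemma has_first_comp:
  assumes "x \<in> Field A"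
  shows "has_first A n (component A n x)"
  using comp_self[OF assms] comp_rel unfolding has_first_def by blast

lemma has_first_mono: "has_first A k D \<Longrightarrow> k \<le> m \<Longrightarrow> has_first A m D"
  using relA_mono unfolding has_first_def by meson

lemma first_level_le: "x \<in> Field A \<Longrightarrow> first_level A (component A n x) \<le> n"
  unfolding first_level_def by (rule Least_le) (rule has_first_comp)

lemma first_level_has_first: "has_first A k D \<Longrightarrow> has_first A (first_level A D) D"
  unfolding first_level_def by (rule LeastI)

lemma first_level_top:
  assumes "x \<in> Field A"
  shows "first_level A (component A (Suc n) x) = Suc n \<longleftrightarrow> \<not> has_first A n (component A (Suc n) x)"
proof
  assume "first_level A (component A (Suc n) x) = Suc n"
  then show "\<not> has_first A n (component A (Suc n) x)"
    unfolding first_level_def using not_less_Least[of n] by (metis lessI)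
next
  assume "\<not> has_first A n (component A (Suc n) x)"
  then have "\<not> first_level A (component A (Suc n) x) \<le> n"
    using has_first_mono first_level_has_first[OF has_first_comp[OF assms]] by blast
  then show "first_level A (component A (Suc n) x) = Suc n" using first_level_le[OF assms, of "Suc n"] by simp
qed

text \<open>Descending to an initial component changes neither the level of first components nor the first
  \<open>\<omega>\<close>-component.\<close>

lemma first_level_initial:
  assumes x: "x \<in> Field A" and i: "initial_in A (component A n x) E" "E \<subseteq> Field A"
  shows "first_level A (component A n x) = first_level A E" "first_comp A (component A n x) = first_comp A E"
    "has_first A n E"
proof -
  have closed: "v \<in> component A n x" if "k \<le> n" "u \<in> component A n x" "(u, v) \<in> crel A (omega_plus k)" for k u v
    using comp_rel[OF that(2)] relA_mono[OF that(3,1)] by blast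
  have ne: "component A n x \<noteq> {}" using comp_self[OF x] by blast
  have hf: "has_first A k (component A n x) \<longleftrightarrow> has_first A k E" if "k \<le> n" for k
    by (rule has_first_initial(1)[OF i(1) ne i(2) closed[OF that]])
  show "first_comp A (component A n x) = first_comp A E"
    by (rule has_first_initial(2)[OF i(1) ne i(2) closed[of 0]]) simp_all
  show E: "has_first A n E" using hf has_first_comp[OF x] by blast
  show "first_level A (component A n x) = first_level A E"
  proof (rule antisym)
    have "first_level A E \<le> n" unfolding first_level_def by (rule Least_le) (rule E)
    then have "has_first A (first_level A E) (component A n x)" using hf first_level_has_first[OF E] by blast
    then show "first_level A (component A n x) \<le> first_level A E"
      unfolding first_level_def[of A "component A n x"] by (rule Least_le)
    have "has_first A (first_level A (component A n x)) E"
      using hf[OF first_level_le[OF x]] first_level_has_first[OF has_first_comp[OF x]] by blast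
    then show "first_level A E \<le> first_level A (component A n x)"
      unfolding first_level_def[of A E] by (rule Least_le)
  qed
qed

lemma first_comp_is_comp:
  assumes x: "x \<in> Field A" and z: "first_level A (component A n x) = 0"
  shows "\<exists>u\<in>Field A. first_comp A (component A n x) = component A 0 u"
proof -
  have "has_first A 0 (component A n x)" using first_level_has_first[OF has_first_comp[OF x]] z by metis
  then obtain u where u: "u \<in> component A n x" "\<And>y. y \<in> component A n x \<Longrightarrow> (y, u) \<in> A \<Longrightarrow> (y, u) \<in> crel A (omega_plus 0)"
    unfolding has_first_def by blast
  have uF: "u \<in> Field A" using u(1) comp_sub by blast
  have "first_comp A (component A n x) = component A 0 u"
  proof
    show "first_comp A (component A n x) \<subseteq> component A 0 u"
    proof
      fix v assume v: "v \<in> first_comp A (component A n x)"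
      then have vF: "v \<in> component A n x" "v \<in> Field A" using comp_sub by (auto simp: first_comp_def)
      then have "(u, v) \<in> A \<or> (v, u) \<in> A" using lin_total[OF linA uF] by blast
      then show "v \<in> component A 0 u"
      proof
        assume "(u, v) \<in> A"
        then show ?thesis using v u(1) by (simp add: first_comp_def component_def)
      next
        assume "(v, u) \<in> A"
        then show ?thesis using u(2)[OF vF(1)] relA_sym by (simp add: component_def)
      qed
    qed
    show "component A 0 u \<subseteq> first_comp A (component A n x)"
    proof
      fix v assume "v \<in> component A 0 u"
      then have uv: "(u, v) \<in> crel A (omega_plus 0)" by (simp add: component_def)
      then have vn: "v \<in> component A n x" using comp_rel[OF u(1)] relA_mono by blast
      have "(y, v) \<in> crel A (omega_plus 0)" if y: "y \<in> component A n x" "(y, v) \<in> A" for y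
      proof (cases "(y, u) \<in> A")
        case True
        then show ?thesis using u(2)[OF y(1)] uv relA_trans by blast
      next
        case False
        then have "(u, y) \<in> A" using lin_total[OF linA uF, of y] y(1) comp_sub by blast
        then show ?thesis using convex_equivD_right[OF convA _ y(2) uv] by blast
      qed
      then show "v \<in> first_comp A (component A n x)" using vn by (simp add: first_comp_def)
    qed
  qed
  then show ?thesis using uF by blast
qed

end


context
  fixes A :: "'a rel"
  assumes unif: "uniform A" and rank: "has_rank A omega_omega"
begin

text \<open>An \<open>(\<omega>+n+1)\<close>-component has a first \<open>(\<omega>+n)\<close>-component iff its decomposition is indexed by \<open>\<nat>\<close>.\<close>

lemma has_first_index:
  assumes b: "blocks (Restr A (component A (Suc n) x)) p I" and I: "I = UNIV \<or> I = {0..}"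
    and p: "\<And>u v. u \<in> component A (Suc n) x \<Longrightarrow> v \<in> component A (Suc n) x \<Longrightarrow>
      p u = p v \<longleftrightarrow> (u, v) \<in> crel A (omega_plus n)"
  shows "has_first A n (component A (Suc n) x) \<longleftrightarrow> I = {0..}"
    "I = {0..} \<Longrightarrow> u \<in> component A (Suc n) x \<Longrightarrow> p u = 0 \<Longrightarrow>
      initial_in A (component A n u) (component A (Suc n) x)"
proof -
  let ?D = "component A (Suc n) x"
  have im: "p ` ?D = I" using b unfolding blocks_def Field_comp[OF unif rank] by blast
  have mono: "p u \<le> p v" if "(u, v) \<in> A" "u \<in> ?D" "v \<in> ?D" for u v
    using b that unfolding blocks_def by blast
  show "has_first A n ?D \<longleftrightarrow> I = {0..}"
  proof
    assume "has_first A n ?D"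
    then obtain u where u: "u \<in> ?D" "\<And>y. y \<in> ?D \<Longrightarrow> (y, u) \<in> A \<Longrightarrow> (y, u) \<in> crel A (omega_plus n)"
      unfolding has_first_def by blast
    show "I = {0..}"
    proof (rule ccontr)
      assume "I \<noteq> {0..}"
      then have "p u - 1 \<in> p ` ?D" using I im by simp
      then obtain w where w: "w \<in> ?D" "p w = p u - 1" by auto
      then have "(w, u) \<in> Restr A ?D"
        using blocks_less[OF b, of w u] u(1) by (simp add: Field_comp[OF unif rank])
      then have "(w, u) \<in> crel A (omega_plus n)" using u(2) by blast
      then have "p w = p u" using p[OF w(1) u(1)] by blast
      then show False using w(2) by simp
    qed
  next
    assume I: "I = {0..}"
    then have "0 \<in> p ` ?D" using im by simp
    then obtain u where u: "u \<in> ?D" "p u = 0" by auto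
    have "(y, u) \<in> crel A (omega_plus n)" if y: "y \<in> ?D" "(y, u) \<in> A" for y
    proof -
      have "p y \<in> {0..}" using y(1) im I by blast
      then have "p y = p u" using mono[OF y(2,1) u(1)] u(2) by simp
      then show ?thesis using p[OF y(1) u(1)] by blast
    qed
    then show "has_first A n ?D" using u(1) unfolding has_first_def by blast
  qed
  assume I: "I = {0..}" and u: "u \<in> ?D" "p u = 0"
  have eq: "component A n u = {v \<in> ?D. p v = 0}" using block_comp(1)[OF unif rank p u(1)] u(2) by simp
  have "v \<in> component A n u" if w: "w \<in> component A n u" "v \<in> ?D" "(v, w) \<in> A" for v w
  proof -
    have "p w = 0" "w \<in> ?D" using w(1) unfolding eq by auto
    moreover have "p v \<in> {0..}" using w(2) im I by blast
    ultimately have "p v = 0" using mono[OF w(3,2)] by simp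
    then show ?thesis using w(2) unfolding eq by simp
  qed
  then show "initial_in A (component A n u) ?D" unfolding initial_in_def eq by blast
qed

text \<open>For each \<open>n\<close>, \<open>y n\<close> is a point whose \<open>(\<omega>+n)\<close>-component is not the first in its \<open>(\<omega>+n+1)\<close>-component.
  Up to isomorphism this component does not depend on the choice.\<close>

context
  fixes y :: "nat \<Rightarrow> 'a" and sg :: "nat \<Rightarrow> nat" and L :: "nat \<Rightarrow> 'a rel"
  assumes y: "\<And>n. \<exists>w. next_comp A n w (y n)"
    and sg: "\<And>n. sg n = first_level A (component A n (y n))"
    and L: "\<And>n. L n = Restr A (first_comp A (component A n (y n)))"
begin

lemma yF: "y n \<in> Field A"
  using y[of n] by (auto simp: next_comp_def dest: lin_Field)

lemma comp_string_finite:
  assumes "x \<in> Field A"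
  shows "comp_string A sg n (component A n x) \<in> finite_strings (Suc n)"
  using first_level_le[OF unif rank assms, of n] first_level_le[OF unif rank yF]
  by (auto simp: finite_strings_def comp_string_def nth_append sg less_Suc_eq)

text \<open>The inductive step for \<open>comp_weighted_chain\<close>: the blocks of a component are the summands of its string.
  Blocks with a predecessor are generic, and a first block shares the last entry of the string and
  the first \<open>\<omega>\<close>-component with the entire component.\<close>

lemma comp_summand_iso:
  assumes x: "x \<in> Field A"
    and b: "blocks (Restr A (component A (Suc n) x)) p I" and I: "I = UNIV \<or> I = {0..}"
    and p: "\<And>u v. u \<in> component A (Suc n) x \<Longrightarrow> v \<in> component A (Suc n) x \<Longrightarrow>
      p u = p v \<longleftrightarrow> (u, v) \<in> crel A (omega_plus n)"
    and IH: "\<And>x. x \<in> Field A \<Longrightarrow> Restr A (component A n x) \<cong>\<^sub>c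
      weighted_chain (comp_string A sg n (component A n x)) (comp_entry A L n (component A n x))"
  defines "s \<equiv> comp_string A sg (Suc n) (component A (Suc n) x)"
    and "f \<equiv> comp_entry A L (Suc n) (component A (Suc n) x)"
  shows "summand_index s = I"
    "\<And>i. i \<in> I \<Longrightarrow> block (Restr A (component A (Suc n) x)) p i \<cong>\<^sub>c summand s f i"
proof -
  let ?D = "component A (Suc n) x"
  have S: "s \<in> finite_strings (Suc (Suc n))" unfolding s_def by (rule comp_string_finite[OF x])
  note m = str_minus_simps[OF S] and ps = str_plus_simps[OF S]
  have top: "s ! Suc n = first_level A ?D" by (simp add: s_def comp_string_def nth_append)
  have l: "last s = length s - 1 \<longleftrightarrow> I = UNIV"
    using m top first_level_top[OF unif rank x, of n] has_first_index(1)[OF b I p] I by auto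
  show sI: "summand_index s = I" using l I by (auto simp: summand_index_def)
  have minus: "str_minus s = comp_string A sg n (component A n (y n))"
    by (simp add: s_def comp_string_def str_minus_def sg butlast_append)
  have wm: "weighted_chain (str_minus s) f =
      weighted_chain (str_minus s) (comp_entry A L n (component A n (y n)))"
    by (rule weighted_chain_cong[OF m(2)]) (auto simp: f_def comp_entry_def entry_def L[of n])
  have other: "block (Restr A ?D) p i \<cong>\<^sub>c weighted_chain (str_minus s) f" if i: "i \<in> I" "i - 1 \<in> I" for i
  proof -
    obtain u where u: "u \<in> ?D" "p u = i" using i(1) b by (auto simp: blocks_def Field_comp[OF unif rank])
    obtain w where "next_comp A n w u" using blocks_next_comp[OF unif rank b p u(1)] i(2) u(2) by blast
    moreover obtain w' where "next_comp A n w' (y n)" using y by blast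
    ultimately have "Restr A (component A n u) \<cong>\<^sub>c Restr A (component A n (y n))"
      by (rule next_comp_iso[OF unif rank])
    moreover have "block (Restr A ?D) p i = Restr A (component A n u)"
      using block_comp(2)[OF unif rank p u(1)] u(2) by simp
    ultimately have "block (Restr A ?D) p i \<cong>\<^sub>c Restr A (component A n (y n))" by simp
    then have "block (Restr A ?D) p i \<cong>\<^sub>c weighted_chain (comp_string A sg n (component A n (y n)))
        (comp_entry A L n (component A n (y n)))"
      by (rule chain_iso_trans) (rule IH[OF yF])
    then show ?thesis unfolding wm unfolding minus .
  qed
  have first: "block (Restr A ?D) p 0 \<cong>\<^sub>c weighted_chain (str_plus s) (f \<circ> shift_wt n (Suc 0))" if I0: "I = {0..}"
  proof -
    have "0 \<in> p ` ?D" using b I0 by (simp add: blocks_def Field_comp[OF unif rank])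
    then obtain u where u: "u \<in> ?D" "p u = 0" by auto
    have uF: "u \<in> Field A" using u(1) comp_sub[OF unif rank] by blast
    have "initial_in A (component A n u) ?D" by (rule has_first_index(2)[OF b I p I0 u])
    note ini = first_level_initial[OF unif rank uF this comp_sub[OF unif rank]]
    have "str_plus s = comp_string A sg n (component A n u)"
      by (simp add: s_def comp_string_def str_plus_def ini(1) butlast_append)
    moreover have "weighted_chain (str_plus s) (f \<circ> shift_wt n (Suc 0)) =
        weighted_chain (str_plus s) (comp_entry A L n (component A n u))"
    proof (rule weighted_chain_cong)
      have "s ! Suc n \<noteq> Suc n" using l m I0 by auto
      then show "str_plus s \<in> finite_strings (Suc n)" by (rule ps(4))
    qed (auto simp: f_def comp_entry_def entry_def shift_wt_def ini(2))
    moreover have "block (Restr A ?D) p 0 = Restr A (component A n u)"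
      using block_comp(2)[OF unif rank p u(1)] u(2) by simp
    ultimately show ?thesis using IH[OF uF] by simp
  qed
  show "block (Restr A ?D) p i \<cong>\<^sub>c summand s f i" if i: "i \<in> I" for i
  proof (cases "i = 0 \<and> I = {0..}")
    case True
    then have "\<not> last s = length s - 1" using l by auto
    then have "summand s f i = weighted_chain (str_plus s) (f \<circ> shift_wt n (Suc 0))"
      using True m(1) by (simp add: summand_def)
    then show ?thesis using first True by simp
  next
    case False
    then have "i - 1 \<in> I" using I i by auto
    moreover have "summand s f i = weighted_chain (str_minus s) f"
      using False l I by (auto simp: summand_def)
    ultimately show ?thesis using other i by simp
  qed
qed

text \<open>Every component is a chain \<open>\<A>(s)[M]\<close>.\<close>

lemma comp_weighted_chain:
  "x \<in> Field A \<Longrightarrow> Restr A (component A n x) \<cong>\<^sub>c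
    weighted_chain (comp_string A sg n (component A n x)) (comp_entry A L n (component A n x))"
proof (induction n arbitrary: x)
  case 0
  have "first_comp A (component A 0 x) = component A 0 x"
    using comp_rel[OF unif rank] unfolding first_comp_def by blast
  then have "weighted_chain (comp_string A sg 0 (component A 0 x)) (comp_entry A L 0 (component A 0 x)) =
      dir_image (Restr A (component A 0 x)) Base"
    using weighted_chain_one[OF comp_string_finite[OF 0], of "comp_entry A L 0 (component A 0 x)"]
    by (simp add: comp_entry_def entry_def)
  then show ?case using iso_dir_image[OF inj_point(1)] unfolding chain_iso_def by metis
next
  case (Suc n)
  let ?D = "component A (Suc n) x"
  let ?s = "comp_string A sg (Suc n) ?D" and ?f = "comp_entry A L (Suc n) ?D"
  obtain p where p: "p ` ?D = UNIV \<or> p ` ?D = {0..}" "blocks (Restr A ?D) p (p ` ?D)"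
    "\<And>u v. u \<in> ?D \<Longrightarrow> v \<in> ?D \<Longrightarrow> p u = p v \<longleftrightarrow> (u, v) \<in> crel A (omega_plus n)"
    by (rule comp_blocks[OF unif rank Suc.prems, of n]) (rule that)
  have si: "summand_index ?s = p ` ?D"
    by (rule comp_summand_iso(1)[OF Suc.prems p(2,1) p(3) Suc.IH])
  have si': "block (Restr A ?D) p i \<cong>\<^sub>c summand ?s ?f i" if "i \<in> p ` ?D" for i
    by (rule comp_summand_iso(2)[OF Suc.prems p(2,1) p(3) Suc.IH]) (use that in auto)
  have "Linear_order (summand ?s ?f i) \<and> Field (summand ?s ?f i) \<noteq> {}" if i: "i \<in> summand_index ?s" for i
  proof -
    have iD: "i \<in> p ` ?D" using i si by simp
    then obtain u where "u \<in> ?D" "p u = i" by auto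
    then have "Field (block (Restr A ?D) p i) \<noteq> {}"
      using Field_block[OF lin_comp[OF unif rank]] by (auto simp: Field_comp[OF unif rank])
    moreover note si'[OF iD]
    ultimately show ?thesis
      using Field_eq_empty_iso Linear_order_iso[OF _ Linear_order_block[OF lin_comp[OF unif rank]]]
      unfolding chain_iso_def by blast
  qed
  note wb = weighted_chain_blocks[of ?s n ?f, OF comp_string_finite[OF Suc.prems] this]
  have "block (Restr A ?D) p i \<cong>\<^sub>c block (weighted_chain ?s ?f) block_index i" if "i \<in> p ` ?D" for i
  proof (rule chain_iso_trans[OF si'[OF that]])
    have "i \<in> summand_index ?s" using that si by simp
    then show "summand ?s ?f i \<cong>\<^sub>c block (weighted_chain ?s ?f) block_index i"
      by (intro chain_iso_sym[OF wb(2)])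
  qed
  moreover have "blocks (weighted_chain ?s ?f) block_index (p ` ?D)" using wb(1) si by simp
  ultimately show ?case using blocks_match[OF p(2)] unfolding chain_iso_def by metis
qed

end

end

section \<open>Gluing isomorphisms along an increasing sequence\<close>

text \<open>The isomorphisms need not extend each other: on \<open>D (n+1) - D n\<close> only \<open>g (n+1)\<close> is used, which respects the
  position relative to the convex set \<open>D n\<close>.\<close>

lemma glue_isos:
  assumes lin: "Linear_order A" "Linear_order B"
    and D: "\<And>n. D n \<subseteq> D (Suc n)" "Field A = (\<Union>n. D n)"
    and convex: "\<And>n x y z. x \<in> D n \<Longrightarrow> z \<in> D n \<Longrightarrow> (x, y) \<in> A \<Longrightarrow> (y, z) \<in> A \<Longrightarrow> y \<in> D n"
    and E: "\<And>n. E n \<subseteq> E (Suc n)" "Field B = (\<Union>n. E n)"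
    and g: "\<And>n. iso (Restr A (D n)) (Restr B (E n)) (g n)" "\<And>n. g (Suc n) ` D n = E n"
  shows "A \<cong>\<^sub>c B"
proof -
  define lev where "lev x = (LEAST n. x \<in> D n)" for x
  define h where "h x = g (lev x) x" for x
  have DF: "D n \<subseteq> Field A" "E n \<subseteq> Field B" for n using D(2) E(2) by blast+
  have Dm: "D n \<subseteq> D m" "E n \<subseteq> E m" if "n \<le> m" for n m
    using lift_Suc_mono_le[of D, OF D(1) that] lift_Suc_mono_le[of E, OF E(1) that] by blast+
  have lev: "x \<in> D (lev x)" if x: "x \<in> Field A" for x
  proof -
    obtain n where "x \<in> D n" using x D(2) by blast
    then show ?thesis unfolding lev_def by (rule LeastI)
  qed
  have lev_le: "lev x \<le> n" if "x \<in> D n" for x n using that unfolding lev_def by (rule Least_le)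
  have "Field (Restr A (D n)) = D n" "Field (Restr B (E n)) = E n" for n
    using DF by (auto simp: Field_Restr_lin lin)
  then have gb: "bij_betw (g n) (D n) (E n)"
    and go: "\<And>x y. x \<in> D n \<Longrightarrow> y \<in> D n \<Longrightarrow> (g n x, g n y) \<in> B \<longleftrightarrow> (x, y) \<in> A" for n
    using g(1)[of n] unfolding iso_bij_order by (auto dest: bij_betwE)
  have gE: "g n x \<in> E n" if "x \<in> D n" for n x using bij_betwE[OF gb] that by blast
  have hE: "h x \<in> E (lev x)" if "x \<in> Field A" for x unfolding h_def using gE lev[OF that] .
  have cross: "((x, y) \<in> A \<longleftrightarrow> (h x, h y) \<in> B) \<and> ((y, x) \<in> A \<longleftrightarrow> (h y, h x) \<in> B)"
    if xy: "x \<in> Field A" "y \<in> Field A" "lev x < lev y" for x y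
  proof -
    obtain m where m: "lev y = Suc m" "lev x \<le> m" using xy(3) by (cases "lev y") auto
    have xD: "x \<in> D m" using lev[OF xy(1)] Dm(1)[OF m(2)] by blast
    have yD: "y \<in> D (Suc m)" "y \<notin> D m" using lev[OF xy(2)] lev_le[of y m] m(1) by auto
    have "h x \<in> E m" using hE[OF xy(1)] Dm(2)[OF m(2)] by blast
    then have "h x \<in> g (Suc m) ` D m" by (simp only: g(2))
    then obtain x' where x': "x' \<in> D m" "g (Suc m) x' = h x" by (metis imageE)
    have x'D: "x' \<in> D (Suc m)" using x'(1) D(1) by blast
    have F: "x' \<in> Field A" using x'(1) DF by blast
    have "(h x, h y) \<in> B \<longleftrightarrow> (x', y) \<in> A" "(h y, h x) \<in> B \<longleftrightarrow> (y, x') \<in> A"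
      using go[OF x'D yD(1)] go[OF yD(1) x'D] x'(2) by (simp_all add: h_def m(1))
    moreover have "(a, y) \<in> A" if "(b, y) \<in> A" "a \<in> D m" "b \<in> D m" for a b
    proof (rule ccontr)
      assume "(a, y) \<notin> A"
      then have "(y, a) \<in> A" using lin_total[OF lin(1) xy(2), of a] that(2) DF by blast
      then show False using convex[OF that(3,2,1)] yD(2) by blast
    qed
    moreover have "(y, a) \<in> A" if "(y, b) \<in> A" "a \<in> D m" "b \<in> D m" for a b
    proof (rule ccontr)
      assume "(y, a) \<notin> A"
      then have "(a, y) \<in> A" using lin_total[OF lin(1) xy(2), of a] that(2) DF by blast
      then show False using convex[OF that(2,3) _ that(1)] yD(2) by blast
    qed
    ultimately show ?thesis using xD x'(1) by blast
  qed
  have o: "(x, y) \<in> A \<longleftrightarrow> (h x, h y) \<in> B" if xy: "x \<in> Field A" "y \<in> Field A" for x y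
  proof (cases "lev x" "lev y" rule: linorder_cases)
    case less
    then show ?thesis using cross xy by blast
  next
    case greater
    then show ?thesis using cross xy by blast
  next
    case equal
    then show ?thesis using go[of x "lev x" y] lev[OF xy(1)] lev[OF xy(2)] by (simp add: h_def)
  qed
  have "inj_on h (Field A)"
    by (rule inj_onI) (metis o lin_antisym[OF lin(1)] lin_refl[OF lin(1)])
  moreover have "h ` Field A = Field B"
  proof
    show "h ` Field A \<subseteq> Field B" using hE DF(2) by blast
    show "Field B \<subseteq> h ` Field A"
    proof
      fix z assume z: "z \<in> Field B"
      then have "\<exists>n. z \<in> E n" using E(2) by blast
      then obtain m where m: "z \<in> E m" "\<And>k. k < m \<Longrightarrow> z \<notin> E k"
        using exists_least_iff[of "\<lambda>n. z \<in> E n"] by blast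
      then obtain x where x: "x \<in> D m" "z = g m x" using gb[of m] unfolding bij_betw_def by blast
      have "x \<notin> D k" if k: "k < m" for k
      proof
        assume "x \<in> D k"
        obtain j where j: "m = Suc j" "k \<le> j" using k by (cases m) auto
        have "x \<in> D j" using \<open>x \<in> D k\<close> Dm(1)[OF j(2)] by blast
        then have "z \<in> E j" using g(2)[of j] x(2) j(1) by blast
        then show False using m(2)[of j] j(1) by simp
      qed
      then have "lev x = m" unfolding lev_def by (intro Least_equality) (use x(1) in \<open>auto simp: not_less[symmetric]\<close>)
      then have "z = h x" using x(2) by (simp add: h_def)
      then show "z \<in> h ` Field A" using x(1) DF by blast
    qed
  qed
  ultimately have "iso A B h" using o by (simp add: iso_bij_order bij_betw_def)
  then show ?thesis unfolding chain_iso_def by blast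
qed


section \<open>Every uniform chain of rank \<open>\<omega> + \<omega>\<close> is of this form\<close>

lemma initial_in_trans: "initial_in A D E \<Longrightarrow> initial_in A E F \<Longrightarrow> initial_in A D F"
  unfolding initial_in_def by blast

lemma uniform_chain_decomposition:
  fixes A :: "'a rel"
  assumes unif: "uniform A" and rank: "has_rank A omega_omega"
  shows "\<exists>\<sigma> \<pi> (U :: nat \<Rightarrow> 'a rel). compatible \<sigma> \<pi> \<and> short_array \<sigma> \<pi> U \<and> (\<forall>M \<in> array_chain \<sigma> \<pi> U. A \<cong>\<^sub>c M)"
proof -
  note lin = linA[OF unif rank]
  obtain x0 where x0: "x0 \<in> Field A" using has_rankD(1)[OF rank lin] by blast
  define D where "D n = component A n x0" for n
  have x0D: "x0 \<in> D n" for n unfolding D_def by (rule comp_self[OF unif rank x0])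
  have DF: "D n \<subseteq> Field A" for n unfolding D_def by (rule comp_sub[OF unif rank])
  have Dmono: "D n \<subseteq> D (Suc n)" for n unfolding D_def by (rule comp_mono[OF unif rank]) simp
  have FieldD: "Field A = (\<Union>n. D n)"
  proof
    show "Field A \<subseteq> (\<Union>n. D n)"
    proof
      fix x assume "x \<in> Field A"
      then have xx: "(x0, x) \<in> crel A omega_omega" using has_rankD(2)[OF rank lin] x0 by blast
      have "omega_omega = (Suc 1, 0)" by (simp add: One_nat_def numeral_2_eq_2)
      then have "\<exists>\<beta>\<in>{(i', j' :: nat). i' \<le> (1 :: nat)}. (x0, x) \<in> crel A \<beta>" using xx by (simp only: crel_lex UN_iff)
      then obtain i j where ij: "i \<le> (1 :: nat)" "(x0, x) \<in> crel A (i, j :: nat)" by blast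
      have "(i, j) \<le> omega_plus j" using ij(1) by (auto simp: less_eq_prod_def)
      then have "(x0, x) \<in> crel A (omega_plus j)" using ij(2) crel_mono[OF lin] by blast
      then show "x \<in> (\<Union>n. D n)" by (auto simp: D_def component_def)
    qed
  qed (use DF in blast)
  have "\<exists>p. (p ` D (Suc n) = UNIV \<or> p ` D (Suc n) = {0 :: int..}) \<and> blocks (Restr A (D (Suc n))) p (p ` D (Suc n)) \<and>
    (\<forall>u\<in>D (Suc n). \<forall>v\<in>D (Suc n). p u = p v \<longleftrightarrow> (u, v) \<in> crel A (omega_plus n))" for n
    by (rule comp_blocks[OF unif rank x0, of n, folded D_def]) blast
  then obtain p where p: "\<And>n. p n ` D (Suc n) = UNIV \<or> p n ` D (Suc n) = {0 :: int..}"
    "\<And>n. blocks (Restr A (D (Suc n))) (p n) (p n ` D (Suc n))"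
    "\<And>n u v. u \<in> D (Suc n) \<Longrightarrow> v \<in> D (Suc n) \<Longrightarrow> p n u = p n v \<longleftrightarrow> (u, v) \<in> crel A (omega_plus n)"
    by metis
  define I where "I n = p n ` D (Suc n)" for n
  note pI = p(1)[folded I_def] and pb = p(2)[folded I_def]
  note pb' = pb[unfolded D_def] and pr' = p(3)[unfolded D_def]
  have px0: "p n x0 \<in> I n" for n using x0D by (simp add: I_def)

  \<comment> \<open>\<open>\<pi> n\<close> is the number of components of \<open>D (n + 1)\<close> that precede \<open>D n\<close>.\<close>
  define \<pi> where "\<pi> n = (if I n = UNIV then \<infinity> else enat (nat (p n x0)))" for n
  have nUNIV: "{0 :: int..} \<noteq> UNIV"
  proof
    assume "{0 :: int..} = UNIV"
    then have "(- 1 :: int) \<in> {0..}" by simp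
    then show False by simp
  qed
  have I: "I n = (if \<pi> n = \<infinity> then UNIV else {0..})" for n
    using pI[of n] by (auto simp: \<pi>_def)
  have fin: "p n x0 = int (the_enat (\<pi> n))" if "\<pi> n < \<infinity>" for n
  proof -
    have "I n = {0..}" using that I[of n] by auto
    then show ?thesis using px0[of n] nUNIV by (simp add: \<pi>_def)
  qed
  have pi0: "p n x0 = 0" "I n = {0..}" if "\<pi> n = 0" for n
    using fin[of n] I[of n] that by (simp_all add: zero_enat_def)

  \<comment> \<open>The generic component of level \<open>n\<close> is \<open>D n\<close> itself unless that is the first one in \<open>D (n + 1)\<close>.\<close>
  have "\<exists>z. (\<exists>w. next_comp A n w z) \<and> (\<pi> n > 0 \<longrightarrow> z = x0)" for n
  proof (cases "\<pi> n = 0")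
    case True
    then have "1 \<in> p n ` D (Suc n)" using pi0(2) by (simp add: I_def)
    then obtain z where z: "z \<in> D (Suc n)" "p n z = 1" by (metis imageE)
    have "\<exists>w. next_comp A n w z"
      by (rule blocks_next_comp[OF unif rank pb' pr' z(1)[unfolded D_def]]) (use z pi0[OF True] in auto)
    then show ?thesis using True by auto
  next
    case False
    have "p n x0 - 1 \<in> I n"
    proof (cases "\<pi> n = \<infinity>")
      case True
      then show ?thesis using I by simp
    next
      case fi: False
      then have "p n x0 = int (the_enat (\<pi> n))" using fin by simp
      moreover have "the_enat (\<pi> n) \<noteq> 0" using False fi by (cases "\<pi> n") (auto simp: zero_enat_def)
      ultimately show ?thesis using I[of n] fi by simp
    qed
    then have "\<exists>w. next_comp A n w x0"
      by (rule blocks_next_comp[OF unif rank pb' pr' x0D[unfolded D_def], rotated -1]) auto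
    then show ?thesis by blast
  qed
  then obtain y where y: "\<And>n. \<exists>w. next_comp A n w (y n)" "\<And>n. \<pi> n > 0 \<Longrightarrow> y n = x0" by metis
  define sg where "sg n = first_level A (component A n (y n))" for n
  define L where "L n = Restr A (first_comp A (component A n (y n)))" for n
  define P where "P n = Restr A (first_comp A (D n))" for n
  have yF: "y n \<in> Field A" for n using y(1)[of n] by (auto simp: next_comp_def dest: lin_Field)
  \<comment> \<open>If \<open>A\<close> has no first component of any level, then \<open>\<sigma> \<infinity>\<close> is not used by any derived string.\<close>
  define \<sigma> where "\<sigma> e = (case e of enat i \<Rightarrow> enat (sg i) | \<infinity> \<Rightarrow>
    if \<exists>k. has_first A k (Field A) then enat (first_level A (Field A)) else \<infinity>)" for e
  have ini: "initial_in A (D n) (D (Suc n))" if "\<pi> n = 0" for n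
    unfolding D_def
    by (rule has_first_index(2)[OF unif rank pb' pI pr' pi0(2)[OF that] x0D[unfolded D_def] pi0(1)[OF that]])
  have iniN: "initial_in A (D n) (D m)" if "n \<le> m" "\<And>v. n \<le> v \<Longrightarrow> v < m \<Longrightarrow> \<pi> v = 0" for n m
    using that
  proof (induction m rule: dec_induct)
    case base
    then show ?case by (auto simp: initial_in_def)
  next
    case (step m)
    have "initial_in A (D n) (D m)" by (rule step.IH) (use step.prems in auto)
    moreover have "\<pi> m = 0" using step.prems[of m] step.hyps by simp
    ultimately show ?case using ini initial_in_trans by blast
  qed
  have iniF: "initial_in A (D n) (Field A)" if z: "\<And>v. n \<le> v \<Longrightarrow> \<pi> v = 0" for n
    unfolding initial_in_def
  proof (intro conjI ballI impI)
    show "D n \<subseteq> Field A" by (rule DF)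
    fix u v assume u: "u \<in> D n" and v: "v \<in> Field A" "(v, u) \<in> A"
    then obtain m where m: "v \<in> D m" using FieldD by blast
    have "D m \<subseteq> D (max n m)" using lift_Suc_mono_le[of D, OF Dmono] by simp
    moreover have "initial_in A (D n) (D (max n m))" by (rule iniN) (use z in auto)
    ultimately show "v \<in> D n" using u v m unfolding initial_in_def by blast
  qed
  have level: "\<sigma> (next_pos \<pi> n) = enat (first_level A (D n))" for n
  proof (cases "\<exists>v\<ge>n. \<pi> v > 0")
    case True
    define w where "w = (LEAST v. n \<le> v \<and> \<pi> v > 0)"
    have w: "n \<le> w" "\<pi> w > 0" using LeastI_ex[of "\<lambda>v. n \<le> v \<and> \<pi> v > 0"] True by (auto simp: w_def)
    have "\<pi> v = 0" if "n \<le> v" "v < w" for v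
      using not_less_Least[of v "\<lambda>v. n \<le> v \<and> \<pi> v > 0"] that by (auto simp: w_def)
    then have "initial_in A (D n) (D w)" by (rule iniN[OF w(1)])
    then have "first_level A (D n) = first_level A (D w)"
      using first_level_initial(1)[OF unif rank x0, of n "D w"] DF unfolding D_def by blast
    moreover have "next_pos \<pi> n = enat w" using True by (simp add: next_pos_def w_def)
    ultimately show ?thesis using y(2)[OF w(2)] by (simp add: \<sigma>_def sg_def D_def)
  next
    case False
    then have z: "\<And>v. n \<le> v \<Longrightarrow> \<pi> v = 0" by auto
    note f = first_level_initial[OF unif rank x0 iniF[OF z, unfolded D_def] order_refl, of n]
    have "next_pos \<pi> n = \<infinity>" using False by (simp add: next_pos_def)
    moreover have "\<exists>k. has_first A k (Field A)" "first_level A (D n) = first_level A (Field A)"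
      using f by (auto simp: D_def)
    ultimately show ?thesis by (simp add: \<sigma>_def)
  qed
  have derived: "derived \<sigma> \<pi> n = comp_string A sg n (D n)" for n
    by (simp add: derived_def comp_string_def level) (simp add: \<sigma>_def)
  have comp: "compatible \<sigma> \<pi>"
    unfolding compatible_def
  proof (intro conjI allI)
    show "\<sigma> i \<le> i" for i
      using first_level_le[OF unif rank yF] by (cases i) (auto simp: \<sigma>_def sg_def)
    show "\<sigma> (next_pos \<pi> n) \<le> enat n" for n
      using first_level_le[OF unif rank x0, of n] by (simp add: level D_def)
    fix n
    have "\<sigma> (next_pos \<pi> (Suc n)) = enat (Suc n) \<longleftrightarrow> \<not> has_first A n (D (Suc n))"
      using first_level_top[OF unif rank x0, of n] by (simp add: level D_def)
    also have "\<dots> \<longleftrightarrow> I n \<noteq> {0..}"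
      using has_first_index(1)[OF unif rank pb' pI pr'] by (simp add: D_def)
    also have "\<dots> \<longleftrightarrow> \<pi> n = \<infinity>" using I[of n] nUNIV by auto
    finally show "\<sigma> (next_pos \<pi> (Suc n)) = enat (Suc n) \<longleftrightarrow> \<pi> n = \<infinity>" .
  qed

  \<comment> \<open>The \<open>\<omega>\<close>-component that enters the arrays at the stage with index \<open>k\<close>.\<close>
  define U where "U k = (case stage \<sigma> \<pi> k of 0 \<Rightarrow> P 0 | Suc n \<Rightarrow> if \<pi> n = 0 then L n else P (Suc n))" for k
  have Unew: "U (stage_index \<sigma> \<pi> (Suc n)) = (if \<pi> n = 0 then L n else P (Suc n))"
    if "new_stage \<sigma> \<pi> (Suc n)" for n
    using stage_index_new(2)[OF that] by (simp add: U_def)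
  have coh: "coherent \<sigma> \<pi> U L P"
    unfolding coherent_def
  proof (intro conjI allI impI)
    show "P 0 = U 0" using zero_index(2)[of \<sigma> \<pi>] by (simp add: U_def)
    fix n
    show "P (Suc n) = P n" if "\<pi> n = 0"
      using first_level_initial(2)[OF unif rank x0 ini[OF that, unfolded D_def] comp_sub[OF unif rank]]
      by (simp add: P_def D_def)
    show "L n = U (stage_index \<sigma> \<pi> (Suc n))" if "\<pi> n = 0 \<and> derived \<sigma> \<pi> (Suc n) ! n = 0"
      using Unew[of n] that by (simp add: new_stage_def)
    show "L n = P n" if "0 < \<pi> n" using y(2)[OF that] by (simp add: L_def P_def D_def)
    show "P (Suc n) = U (stage_index \<sigma> \<pi> (Suc n))"
      if "0 < \<pi> n \<and> \<pi> n < \<infinity> \<and> derived \<sigma> \<pi> (Suc n) ! Suc n = 0"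
      using Unew[of n] that by (auto simp: new_stage_def)
  qed
  have Ucomp: "\<exists>u\<in>Field A. U k = Restr A (component A 0 u)" if k: "k \<in> index_set \<sigma> \<pi>" for k
  proof -
    have PL: "\<exists>u\<in>Field A. P n = Restr A (component A 0 u)" if "first_level A (D n) = 0" for n
      using first_comp_is_comp[OF unif rank x0, of n] that by (auto simp: P_def D_def)
    have LL: "\<exists>u\<in>Field A. L n = Restr A (component A 0 u)" if "sg n = 0" for n
      using first_comp_is_comp[OF unif rank yF[of n], of n] that by (auto simp: L_def sg_def)
    have new: "new_stage \<sigma> \<pi> (stage \<sigma> \<pi> k)" by (rule stage_new[OF k])
    show ?thesis
    proof (cases "stage \<sigma> \<pi> k")
      case 0
      have "first_level A (D 0) = 0" using first_level_le[OF unif rank x0, of 0] by (simp add: D_def)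
      then show ?thesis using PL 0 by (simp add: U_def)
    next
      case (Suc n)
      show ?thesis
      proof (cases "\<pi> n = 0")
        case True
        then have "sg n = 0" using new Suc by (simp add: new_stage_def derived comp_string_def nth_append)
        then show ?thesis using LL True Suc by (simp add: U_def)
      next
        case False
        then have "derived \<sigma> \<pi> (Suc n) ! Suc n = 0" using new Suc by (simp add: new_stage_def)
        then have "first_level A (D (Suc n)) = 0" by (simp add: derived comp_string_def nth_append)
        then show ?thesis using PL False Suc by (simp add: U_def)
      qed
    qed
  qed
  have short: "short_array \<sigma> \<pi> U"
    unfolding short_array_def short_family_def
  proof (intro conjI ballI)
    fix k assume k: "k \<in> index_set \<sigma> \<pi>"
    then obtain u where u: "u \<in> Field A" "U k = Restr A (component A 0 u)" using Ucomp by blast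
    show "uniform (U k)" unfolding u(2) by (rule comp_uniform[OF unif rank])
    show "has_rank (U k) (omega_plus 0)" unfolding u(2) by (rule comp_has_rank[OF unif rank u(1)])
    fix k' assume k': "k' \<in> index_set \<sigma> \<pi>"
    then obtain u' where u': "u' \<in> Field A" "U k' = Restr A (component A 0 u')" using Ucomp by blast
    have "u \<in> Field (U k)" "u' \<in> Field (U k')"
      unfolding u(2) u'(2) Field_comp[OF unif rank] using comp_self[OF unif rank] u(1) u'(1) by blast+
    then have "(SOME x. x \<in> Field (U k)) \<in> Field (U k)" "(SOME x. x \<in> Field (U k')) \<in> Field (U k')"
      using someI[of "\<lambda>x. x \<in> Field (U k)"] someI[of "\<lambda>x. x \<in> Field (U k')"] by blast+
    moreover have "tails_iso (U k) (U k')" unfolding u(2) u'(2) by (rule comp_tails_iso[OF unif rank])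
    ultimately show "common_tail (U k) \<cong>\<^sub>c common_tail (U k')"
      unfolding common_tail_def tails_iso_def by blast
  qed

  have entry: "comp_entry A L n (D n) = entry L P n" for n
    by (simp add: comp_entry_def entry_def P_def fun_eq_iff)
  note wch = comp_weighted_chain[OF unif rank y(1) sg_def L_def]
  have isoD: "Restr A (D n) \<cong>\<^sub>c stage_chain \<sigma> \<pi> L P n" for n
    using wch[OF x0, of n] by (simp add: stage_chain_def derived entry flip: D_def)

  have "A \<cong>\<^sub>c M" if M: "M \<in> array_chain \<sigma> \<pi> U" for M
  proof -
    let ?B = "stage_chain \<sigma> \<pi> L P"
    obtain e where e: "array_embeddings \<pi> ?B e" "M = direct_limit ?B e"
      using M unfolding array_chain_coherent[OF comp coh] by blast
    note emb = array_embeddingsD[OF comp coh short e(1)]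
    have linB: "Linear_order (?B n)" for n using stage_chain_uniform(1)[OF comp coh short] by (simp add: uniform_def)
    obtain j where j: "convex_union ?B e M j"
      using direct_limit_convex_union[of ?B e, OF linB emb(1)] e(2) by blast
    note linM = convex_unionD(1)[OF j]

    \<comment> \<open>An isomorphism on level \<open>n + 1\<close> that maps level \<open>n\<close> to level \<open>n\<close>.\<close>
    have step: "\<exists>h. iso (Restr A (D (Suc n))) (?B (Suc n)) h \<and> h ` D n = e n ` Field (?B n)" for n
    proof -
      let ?T = "Restr A (D (Suc n))"
      let ?s = "derived \<sigma> \<pi> (Suc n)" and ?f = "entry L P (Suc n)"
      have F: "Field ?T = D (Suc n)" unfolding D_def by (rule Field_comp[OF unif rank])
      obtain i where i: "\<pi> n < \<infinity> \<Longrightarrow> i = int (the_enat (\<pi> n))"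
        "e n ` Field (?B n) = {x \<in> Field (?B (Suc n)). block_index x = i}"
        using emb(2)[of n] by blast
      \<comment> \<open>If \<open>\<pi> n = \<infinity>\<close>, then the \<open>\<int>\<close>-indexed decomposition is shifted so as to match the chosen components.\<close>
      define d where "d = i - p n x0"
      have d: "d = 0" if "\<pi> n < \<infinity>" using i(1) fin that by (simp add: d_def)
      have shiftI: "(\<lambda>m. m + d) ` I n = I n"
      proof (cases "\<pi> n < \<infinity>")
        case True
        then show ?thesis using d by simp
      next
        case False
        then have "I n = UNIV" using I[of n] by simp
        then show ?thesis by (auto intro: image_eqI[of _ _ "_ - d"])
      qed
      note bs = blocks_shift[OF pb[of n], of d]
      note sb = stage_chain_blocks[OF comp coh short, where n = n, folded I]
      have sT: "block ?T (p n) m \<cong>\<^sub>c summand ?s ?f m" if "m \<in> I n" for m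
      proof -
        have "block (Restr A (component A (Suc n) x0)) (p n) m \<cong>\<^sub>c
            summand (comp_string A sg (Suc n) (component A (Suc n) x0)) (comp_entry A L (Suc n) (component A (Suc n) x0)) m"
          by (rule comp_summand_iso(2)[OF unif rank y(1) sg_def L_def x0 pb' pI pr' wch]) (use that in auto)
        then show ?thesis by (simp add: derived entry flip: D_def)
      qed
      have "block ?T (\<lambda>x. p n x + d) m \<cong>\<^sub>c block (?B (Suc n)) block_index m" if m: "m \<in> I n" for m
      proof -
        have md: "m - d \<in> I n" using m d I[of n] by (cases "\<pi> n < \<infinity>") auto
        have "summand ?s ?f (m - d) = summand ?s ?f m"
        proof (cases "\<pi> n < \<infinity>")
          case True
          then show ?thesis using d by simp
        next
          case False
          then have "\<pi> n = \<infinity>" by simp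
          then show ?thesis using summand_stage[OF comp coh, of n] by simp
        qed
        then have "block ?T (\<lambda>x. p n x + d) m \<cong>\<^sub>c summand ?s ?f m" using sT[OF md] bs(2) by simp
        then show ?thesis by (rule chain_iso_trans) (rule chain_iso_sym[OF sb(2)[OF m]])
      qed
      then obtain h where h: "iso ?T (?B (Suc n)) h" "\<And>x. x \<in> Field ?T \<Longrightarrow> block_index (h x) = p n x + d"
        using blocks_match[OF bs(1)[unfolded shiftI] sb(1)] by metis
      have Dn: "D n = {x \<in> D (Suc n). p n x = p n x0}"
        using block_comp(1)[OF unif rank pr' x0D[unfolded D_def]] unfolding D_def by blast
      have hb: "h ` D (Suc n) = Field (?B (Suc n))" using h(1) F by (simp add: iso_bij_order bij_betw_def)
      have "h ` D n = {x \<in> Field (?B (Suc n)). block_index x = i}"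
      proof
        show "h ` D n \<subseteq> {x \<in> Field (?B (Suc n)). block_index x = i}"
          using hb h(2) unfolding F by (auto simp: Dn d_def)
        show "{x \<in> Field (?B (Suc n)). block_index x = i} \<subseteq> h ` D n"
        proof
          fix z assume z: "z \<in> {x \<in> Field (?B (Suc n)). block_index x = i}"
          then have "z \<in> h ` D (Suc n)" using hb by simp
          then obtain x where x: "x \<in> D (Suc n)" "z = h x" by blast
          then have "p n x = p n x0" using h(2)[of x] z F by (simp add: d_def)
          then show "z \<in> h ` D n" using x by (simp add: Dn)
        qed
      qed
      then show ?thesis using h(1) i(2) by auto
    qed
    obtain h0 where h0: "iso (Restr A (D 0)) (?B 0) h0" using isoD[of 0] unfolding chain_iso_def by blast
    obtain hs where hs: "\<And>n. iso (Restr A (D (Suc n))) (?B (Suc n)) (hs n)" "\<And>n. hs n ` D n = e n ` Field (?B n)"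
      using step by metis
    define h where "h n = (case n of 0 \<Rightarrow> h0 | Suc k \<Rightarrow> hs k)" for n
    have h: "iso (Restr A (D n)) (?B n) (h n)" for n using h0 hs(1) by (cases n) (simp_all add: h_def)
    define E where "E n = j n ` Field (?B n)" for n
    show "A \<cong>\<^sub>c M"
    proof (rule glue_isos[OF lin linM Dmono FieldD, of E "\<lambda>n. j n \<circ> h n"])
      show "v \<in> D n" if "u \<in> D n" "w \<in> D n" "(u, v) \<in> A" "(v, w) \<in> A" for n u v w
        using comp_convex[OF unif rank] that unfolding D_def by blast
      show "E n \<subseteq> E (Suc n)" for n unfolding E_def by (rule convex_union_mono[OF j]) simp
      show "Field M = (\<Union>n. E n)" unfolding E_def by (rule convex_unionD(5)[OF j])
      show "iso (Restr A (D n)) (Restr M (E n)) (j n \<circ> h n)" for n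
        unfolding E_def by (rule iso_comp[OF h convex_emb_iso_image[OF convex_unionD(2)[OF j] linM]])
      show "(j (Suc n) \<circ> h (Suc n)) ` D n = E n" for n
      proof -
        have "(j (Suc n) \<circ> h (Suc n)) ` D n = j (Suc n) ` e n ` Field (?B n)"
          using hs(2)[of n] by (simp add: h_def flip: image_image)
        also have "\<dots> = E n" using convex_unionD(4)[OF j] by (auto simp: E_def image_image)
        finally show ?thesis .
      qed
    qed
  qed
  then show ?thesis using comp short by blast
qed

theorem mainTheorem6:
  shows
    "(\<forall>A :: 'a rel. uniform A \<and> has_rank A omega_omega \<longrightarrow>
       (\<exists>\<sigma> \<pi>. compatible \<sigma> \<pi> \<and>
         (\<exists>U :: nat \<Rightarrow> 'a rel. short_array \<sigma> \<pi> U \<and>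
            array_chain \<sigma> \<pi> U \<noteq> {} \<and> (\<forall>L \<in> array_chain \<sigma> \<pi> U. A \<cong>\<^sub>c L)) \<and>
         (\<exists>V :: nat \<Rightarrow> 'a rel. short_array_wt \<sigma> \<pi> V \<and>
            array_chain_wt \<sigma> \<pi> V \<noteq> {} \<and> (\<forall>L \<in> array_chain_wt \<sigma> \<pi> V. A \<cong>\<^sub>c L))))
     \<and>
     (\<forall>\<sigma> \<pi>. compatible \<sigma> \<pi> \<longrightarrow>
       (\<forall>U :: nat \<Rightarrow> 'b rel. short_array \<sigma> \<pi> U \<longrightarrow>
          array_chain \<sigma> \<pi> U \<noteq> {} \<and>
          (\<forall>L \<in> array_chain \<sigma> \<pi> U. uniform L \<and> has_rank L omega_omega)) \<and>
       (\<forall>V :: nat \<Rightarrow> 'b rel. short_array_wt \<sigma> \<pi> V \<longrightarrow>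
          array_chain_wt \<sigma> \<pi> V \<noteq> {} \<and>
          (\<forall>L \<in> array_chain_wt \<sigma> \<pi> V. uniform L \<and> has_rank L omega_omega)))"
proof (rule conjI; intro allI impI)
  fix A :: "'a rel" assume "uniform A \<and> has_rank A omega_omega"
  then obtain \<sigma> \<pi> and U :: "nat \<Rightarrow> 'a rel" where c: "compatible \<sigma> \<pi>" and U: "short_array \<sigma> \<pi> U"
    and iso: "\<forall>M \<in> array_chain \<sigma> \<pi> U. A \<cong>\<^sub>c M"
    using uniform_chain_decomposition[of A] by blast
  obtain V where V: "short_array_wt \<sigma> \<pi> V" "\<And>k. k \<in> index_set \<sigma> \<pi> \<Longrightarrow> reindex \<sigma> \<pi> V k = U k"
    by (rule reindex_surj[OF c U]) (rule that)
  have "array_chain_wt \<sigma> \<pi> V = array_chain \<sigma> \<pi> U"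
    unfolding array_chain_wt_def by (rule array_chain_cong[OF V(2)])
  then show "\<exists>\<sigma> \<pi>. compatible \<sigma> \<pi> \<and>
         (\<exists>U :: nat \<Rightarrow> 'a rel. short_array \<sigma> \<pi> U \<and>
            array_chain \<sigma> \<pi> U \<noteq> {} \<and> (\<forall>L \<in> array_chain \<sigma> \<pi> U. A \<cong>\<^sub>c L)) \<and>
         (\<exists>V :: nat \<Rightarrow> 'a rel. short_array_wt \<sigma> \<pi> V \<and>
            array_chain_wt \<sigma> \<pi> V \<noteq> {} \<and> (\<forall>L \<in> array_chain_wt \<sigma> \<pi> V. A \<cong>\<^sub>c L))"
    using c U iso V(1) array_chain_nonempty[OF c U] by metis
next
  fix \<sigma> \<pi> assume c: "compatible \<sigma> \<pi>"
  have "array_chain \<sigma> \<pi> U \<noteq> {} \<and> (\<forall>L \<in> array_chain \<sigma> \<pi> U. uniform L \<and> has_rank L omega_omega)"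
    if "short_array \<sigma> \<pi> U" for U :: "nat \<Rightarrow> 'b rel"
    using array_chain_nonempty[OF c that] array_chain_uniform[OF c that] by blast
  then show "(\<forall>U :: nat \<Rightarrow> 'b rel. short_array \<sigma> \<pi> U \<longrightarrow>
          array_chain \<sigma> \<pi> U \<noteq> {} \<and>
          (\<forall>L \<in> array_chain \<sigma> \<pi> U. uniform L \<and> has_rank L omega_omega)) \<and>
       (\<forall>V :: nat \<Rightarrow> 'b rel. short_array_wt \<sigma> \<pi> V \<longrightarrow>
          array_chain_wt \<sigma> \<pi> V \<noteq> {} \<and>
          (\<forall>L \<in> array_chain_wt \<sigma> \<pi> V. uniform L \<and> has_rank L omega_omega))"
    unfolding array_chain_wt_def using short_array_reindex by blast
qed

end
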